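(* Provably in Mac~Lane Type Theory: in the category $\mathfrak{BClass}$ of classes and bounded class functions, for any bounded class function $\mathcal{F}\colon\mathcal{B}\to\mathcal{A}$ the pullback functor $\mathcal{F}^*\colon\mathfrak{BClass}/\mathcal{A}\to\mathfrak{BClass}/\mathcal{B}$ has a left adjoint $\Sigma_{\mathcal{F}}$; and if $\mathcal{F}$ is locally small, then $\mathcal{F}^*$ also has a right adjoint $\Pi_{\mathcal{F}}$.
   Context: Mac~Lane Type Theory (MTT) has sets, classes and collections; sets satisfy \textsf{MAC}+V=L (ZFC without replacement, with only bounded separation, with transitive containment and V=L). $x\in^1\mathcal{A}$ means set $x$ is in class $\mathcal{A}$; classes are defined by formulas quantifying only over sets. $A\subseteq^0\mathcal{A}$ means $A$ is a set all of whose elements are in class $\mathcal{A}$. A class function $f\colon\mathcal{A}\to\mathcal{B}$ is a single-valued total class $\Gamma_f\subseteq^1\mathcal{A}\times\mathcal{B}$. It is bounded if every $A\subseteq^0\mathcal{A}$ has a set image $f(A)\subseteq^0\mathcal{B}$ with the graph of $f|_A$ a subset (a set) of $A\times f(A)$; bounded functions form the subcategory $\mathfrak{BClass}$ of the category of classes. A class function $f\colon\mathcal{C}\to\mathcal{B}$ is locally small if every set $B\subseteq^0\mathcal{B}$ has a set preimage $f^{-1}(B)\subseteq^0\mathcal{C}$ with the graph of the restriction a subset (a set) of $f^{-1}(B)\times B$. $\mathfrak{BClass}/\mathcal{A}$ denotes the slice category over $\mathcal{A}$, and $\mathcal{F}^*$ is given by canonical pullback along $\mathcal{F}$. *)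

theory Defs
  imports Main
begin

section \<open>The language of Mac Lane Type Theory\<close>

text \<open>
  A three-sorted first-order language: sort 0 (sets), sort 1 (classes), sort 2 (collections).
  Variables of each sort are numbered separately. A formula is needed as a syntactic object only
  to state the separation and comprehension schemes.
\<close>

datatype fm =
    Eq0 nat nat | Eq1 nat nat | Eq2 nat nat
  | Mem0 nat nat | Mem1 nat nat | Mem2 nat nat
  | Neg fm | And fm fm
  | All0 nat fm | All1 nat fm | All2 nat fm

text \<open>
  Bounded formulas of pure set theory. The last rule is the bounded quantifier
  \<open>\<forall>x\<^sub>i \<in> x\<^sub>j. \<phi>\<close>, with the implication written by negation and conjunction.
\<close>

inductive delta0 :: "fm \<Rightarrow> bool" where
  "delta0 (Eq0 i j)"
| "delta0 (Mem0 i j)"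
| "delta0 \<phi> \<Longrightarrow> delta0 (Neg \<phi>)"
| "delta0 \<phi> \<Longrightarrow> delta0 \<psi> \<Longrightarrow> delta0 (And \<phi> \<psi>)"
| "i \<noteq> j \<Longrightarrow> delta0 \<phi> \<Longrightarrow> delta0 (All0 i (Neg (And (Mem0 i j) (Neg \<phi>))))"

text \<open>
  Formulas without bound collection variables, and those without bound class or collection
  variables. Parameters of every sort are allowed.
\<close>

primrec no_coll_quant :: "fm \<Rightarrow> bool" where
  "no_coll_quant (Eq0 i j) = True"
| "no_coll_quant (Eq1 i j) = True"
| "no_coll_quant (Eq2 i j) = True"
| "no_coll_quant (Mem0 i j) = True"
| "no_coll_quant (Mem1 i j) = True"
| "no_coll_quant (Mem2 i j) = True"
| "no_coll_quant (Neg \<phi>) = no_coll_quant \<phi>"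
| "no_coll_quant (And \<phi> \<psi>) = (no_coll_quant \<phi> \<and> no_coll_quant \<psi>)"
| "no_coll_quant (All0 i \<phi>) = no_coll_quant \<phi>"
| "no_coll_quant (All1 i \<phi>) = no_coll_quant \<phi>"
| "no_coll_quant (All2 i \<phi>) = False"

primrec only_set_quant :: "fm \<Rightarrow> bool" where
  "only_set_quant (Eq0 i j) = True"
| "only_set_quant (Eq1 i j) = True"
| "only_set_quant (Eq2 i j) = True"
| "only_set_quant (Mem0 i j) = True"
| "only_set_quant (Mem1 i j) = True"
| "only_set_quant (Mem2 i j) = True"
| "only_set_quant (Neg \<phi>) = only_set_quant \<phi>"
| "only_set_quant (And \<phi> \<psi>) = (only_set_quant \<phi> \<and> only_set_quant \<psi>)"
| "only_set_quant (All0 i \<phi>) = only_set_quant \<phi>"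
| "only_set_quant (All1 i \<phi>) = False"
| "only_set_quant (All2 i \<phi>) = False"


section \<open>Categories\<close>

text \<open>
  Objects and arrows are classes of a structure for the language (type \<open>'c\<close>). Values outside
  \<open>Ob\<close> and \<open>Ar\<close> are irrelevant.
\<close>

record 'c category =
  Ob :: "'c \<Rightarrow> bool"
  Ar :: "'c \<Rightarrow> bool"
  Dom :: "'c \<Rightarrow> 'c"
  Cod :: "'c \<Rightarrow> 'c"
  Ident :: "'c \<Rightarrow> 'c"
  Comp :: "'c \<Rightarrow> 'c \<Rightarrow> 'c"  \<comment> \<open>\<open>Comp C g f\<close> is \<open>g\<close> after \<open>f\<close>\<close>

definition Hom :: "'c category \<Rightarrow> 'c \<Rightarrow> 'c \<Rightarrow> 'c \<Rightarrow> bool" where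
  "Hom C x y f \<longleftrightarrow> Ar C f \<and> Dom C f = x \<and> Cod C f = y"

definition is_category :: "'c category \<Rightarrow> bool" where
  "is_category C \<longleftrightarrow>
     (\<forall>f. Ar C f \<longrightarrow> Ob C (Dom C f) \<and> Ob C (Cod C f)) \<and>
     (\<forall>x. Ob C x \<longrightarrow> Hom C x x (Ident C x)) \<and>
     (\<forall>x y z f g. Hom C x y f \<and> Hom C y z g \<longrightarrow> Hom C x z (Comp C g f)) \<and>
     (\<forall>x y f. Hom C x y f \<longrightarrow> Comp C f (Ident C x) = f \<and> Comp C (Ident C y) f = f) \<and>
     (\<forall>w x y z f g h. Hom C w x f \<and> Hom C x y g \<and> Hom C y z h \<longrightarrow>
        Comp C h (Comp C g f) = Comp C (Comp C h g) f)"


section \<open>Structures for the language\<close>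

locale MTT_language =
  fixes mem0 :: "'s \<Rightarrow> 's \<Rightarrow> bool" (infix \<open>\<in>\<^sub>0\<close> 50)
    and mem1 :: "'s \<Rightarrow> 'c \<Rightarrow> bool" (infix \<open>\<in>\<^sub>1\<close> 50)
    and mem2 :: "'c \<Rightarrow> 'k \<Rightarrow> bool" (infix \<open>\<in>\<^sub>2\<close> 50)
begin

primrec sat :: "fm \<Rightarrow> (nat \<Rightarrow> 's) \<Rightarrow> (nat \<Rightarrow> 'c) \<Rightarrow> (nat \<Rightarrow> 'k) \<Rightarrow> bool" where
  "sat (Eq0 i j) e0 e1 e2 \<longleftrightarrow> e0 i = e0 j"
| "sat (Eq1 i j) e0 e1 e2 \<longleftrightarrow> e1 i = e1 j"
| "sat (Eq2 i j) e0 e1 e2 \<longleftrightarrow> e2 i = e2 j"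
| "sat (Mem0 i j) e0 e1 e2 \<longleftrightarrow> e0 i \<in>\<^sub>0 e0 j"
| "sat (Mem1 i j) e0 e1 e2 \<longleftrightarrow> e0 i \<in>\<^sub>1 e1 j"
| "sat (Mem2 i j) e0 e1 e2 \<longleftrightarrow> e1 i \<in>\<^sub>2 e2 j"
| "sat (Neg \<phi>) e0 e1 e2 \<longleftrightarrow> \<not> sat \<phi> e0 e1 e2"
| "sat (And \<phi> \<psi>) e0 e1 e2 \<longleftrightarrow> sat \<phi> e0 e1 e2 \<and> sat \<psi> e0 e1 e2"
| "sat (All0 i \<phi>) e0 e1 e2 \<longleftrightarrow> (\<forall>x. sat \<phi> (e0(i := x)) e1 e2)"
| "sat (All1 i \<phi>) e0 e1 e2 \<longleftrightarrow> (\<forall>X. sat \<phi> e0 (e1(i := X)) e2)"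
| "sat (All2 i \<phi>) e0 e1 e2 \<longleftrightarrow> (\<forall>K. sat \<phi> e0 e1 (e2(i := K)))"

text \<open>
  The following descriptions are meaningful only where the axioms below provide the set, class or
  collection described; it is then unique by extensionality.
\<close>

definition set_of :: "('s \<Rightarrow> bool) \<Rightarrow> 's" where
  "set_of P = (THE X. \<forall>x. x \<in>\<^sub>0 X \<longleftrightarrow> P x)"

definition class_of :: "('s \<Rightarrow> bool) \<Rightarrow> 'c" where
  "class_of P = (THE X. \<forall>x. x \<in>\<^sub>1 X \<longleftrightarrow> P x)"

definition coll_of :: "('c \<Rightarrow> bool) \<Rightarrow> 'k" where
  "coll_of P = (THE K. \<forall>X. X \<in>\<^sub>2 K \<longleftrightarrow> P X)"


subsection \<open>Sets\<close>

definition sub0 :: "'s \<Rightarrow> 's \<Rightarrow> bool" (infix \<open>\<subseteq>\<^sub>0\<close> 50) where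
  "x \<subseteq>\<^sub>0 y \<longleftrightarrow> (\<forall>z. z \<in>\<^sub>0 x \<longrightarrow> z \<in>\<^sub>0 y)"

definition empty0 :: 's where
  "empty0 = set_of (\<lambda>_. False)"

definition upair :: "'s \<Rightarrow> 's \<Rightarrow> 's" where
  "upair x y = set_of (\<lambda>z. z = x \<or> z = y)"

definition opair :: "'s \<Rightarrow> 's \<Rightarrow> 's" where
  "opair x y = upair (upair x x) (upair x y)"

definition suc0 :: "'s \<Rightarrow> 's" where
  "suc0 x = set_of (\<lambda>z. z \<in>\<^sub>0 x \<or> z = x)"

definition one0 :: 's where
  "one0 = suc0 empty0"

definition is_inductive :: "'s \<Rightarrow> bool" where
  "is_inductive I \<longleftrightarrow> empty0 \<in>\<^sub>0 I \<and> (\<forall>n. n \<in>\<^sub>0 I \<longrightarrow> suc0 n \<in>\<^sub>0 I)"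

definition omega :: 's where
  "omega = set_of (\<lambda>n. \<forall>I. is_inductive I \<longrightarrow> n \<in>\<^sub>0 I)"

definition transitive0 :: "'s \<Rightarrow> bool" where
  "transitive0 x \<longleftrightarrow> (\<forall>y. y \<in>\<^sub>0 x \<longrightarrow> y \<subseteq>\<^sub>0 x)"

text \<open>In the presence of foundation, this defines the von Neumann ordinals.\<close>

definition ordinal :: "'s \<Rightarrow> bool" where
  "ordinal x \<longleftrightarrow> transitive0 x \<and> (\<forall>y. y \<in>\<^sub>0 x \<longrightarrow> transitive0 y)"

definition set_fun :: "'s \<Rightarrow> 's \<Rightarrow> 's \<Rightarrow> bool" where
  "set_fun f a b \<longleftrightarrow>
     (\<forall>p. p \<in>\<^sub>0 f \<longrightarrow> (\<exists>x y. x \<in>\<^sub>0 a \<and> y \<in>\<^sub>0 b \<and> p = opair x y)) \<and>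
     (\<forall>x. x \<in>\<^sub>0 a \<longrightarrow> (\<exists>!y. opair x y \<in>\<^sub>0 f))"

definition app0 :: "'s \<Rightarrow> 's \<Rightarrow> 's" where
  "app0 f x = (THE y. opair x y \<in>\<^sub>0 f)"


subsection \<open>The constructible hierarchy\<close>

text \<open>
  Definability over a set \<open>a\<close> must be expressed inside the structure, since its \<open>omega\<close> need not be
  standard. The relations on assignments \<open>omega \<rightarrow> a\<close> which are defined by (internal) first-order
  formulas over \<open>(a, \<in>)\<close> form the least family containing those defined by the atomic formulas and
  closed under the operations interpreting negation, conjunction and existential quantification.
\<close>

definition assignment :: "'s \<Rightarrow> 's \<Rightarrow> bool" where
  "assignment a s \<longleftrightarrow> set_fun s omega a"

definition assign_upd :: "'s \<Rightarrow> 's \<Rightarrow> 's \<Rightarrow> 's" where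
  "assign_upd s n x =
     set_of (\<lambda>p. \<exists>m. m \<in>\<^sub>0 omega \<and> p = opair m (if m = n then x else app0 s m))"

definition formula_closed :: "'s \<Rightarrow> 's \<Rightarrow> bool" where
  "formula_closed a D \<longleftrightarrow>
     (\<forall>m n. m \<in>\<^sub>0 omega \<and> n \<in>\<^sub>0 omega \<longrightarrow>
        set_of (\<lambda>s. assignment a s \<and> app0 s m \<in>\<^sub>0 app0 s n) \<in>\<^sub>0 D \<and>
        set_of (\<lambda>s. assignment a s \<and> app0 s m = app0 s n) \<in>\<^sub>0 D) \<and>
     (\<forall>R. R \<in>\<^sub>0 D \<longrightarrow> set_of (\<lambda>s. assignment a s \<and> \<not> s \<in>\<^sub>0 R) \<in>\<^sub>0 D) \<and>
     (\<forall>R Q. R \<in>\<^sub>0 D \<and> Q \<in>\<^sub>0 D \<longrightarrow> set_of (\<lambda>s. s \<in>\<^sub>0 R \<and> s \<in>\<^sub>0 Q) \<in>\<^sub>0 D) \<and>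
     (\<forall>n R. n \<in>\<^sub>0 omega \<and> R \<in>\<^sub>0 D \<longrightarrow>
        set_of (\<lambda>s. assignment a s \<and> (\<exists>x. x \<in>\<^sub>0 a \<and> assign_upd s n x \<in>\<^sub>0 R)) \<in>\<^sub>0 D)"

definition definable_relation :: "'s \<Rightarrow> 's \<Rightarrow> bool" where
  "definable_relation a R \<longleftrightarrow> (\<forall>D. formula_closed a D \<longrightarrow> R \<in>\<^sub>0 D)"

text \<open>
  \<open>x\<close> is a subset of \<open>a\<close> definable over \<open>(a, \<in>)\<close> with parameters: variable 0 ranges over \<open>a\<close>
  and \<open>s\<close> supplies the parameters. If \<open>a\<close> is empty there are no assignments, and
  the empty set is its only (definable) subset.
\<close>

definition definable_subset :: "'s \<Rightarrow> 's \<Rightarrow> bool" where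
  "definable_subset a x \<longleftrightarrow> x \<subseteq>\<^sub>0 a \<and>
     (a = empty0 \<or>
      (\<exists>R s. definable_relation a R \<and> assignment a s \<and>
         (\<forall>z. z \<in>\<^sub>0 a \<longrightarrow> (z \<in>\<^sub>0 x \<longleftrightarrow> assign_upd s empty0 z \<in>\<^sub>0 R))))"

text \<open>\<open>f\<close> is the sequence of the \<open>L\<^sub>\<beta>\<close> for \<open>\<beta> \<le> \<alpha>\<close>.\<close>

definition L_hierarchy :: "'s \<Rightarrow> 's \<Rightarrow> bool" where
  "L_hierarchy \<alpha> f \<longleftrightarrow>
     (\<exists>b. set_fun f (suc0 \<alpha>) b) \<and>
     app0 f empty0 = empty0 \<and>
     (\<forall>\<gamma>. suc0 \<gamma> \<in>\<^sub>0 suc0 \<alpha> \<longrightarrow>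
        (\<forall>x. x \<in>\<^sub>0 app0 f (suc0 \<gamma>) \<longleftrightarrow> definable_subset (app0 f \<gamma>) x)) \<and>
     (\<forall>\<delta>. \<delta> \<in>\<^sub>0 suc0 \<alpha> \<and> \<delta> \<noteq> empty0 \<and> \<not> (\<exists>\<gamma>. \<delta> = suc0 \<gamma>) \<longrightarrow>
        (\<forall>x. x \<in>\<^sub>0 app0 f \<delta> \<longleftrightarrow> (\<exists>\<gamma>. \<gamma> \<in>\<^sub>0 \<delta> \<and> x \<in>\<^sub>0 app0 f \<gamma>)))"

definition constructible :: "'s \<Rightarrow> bool" where
  "constructible x \<longleftrightarrow> (\<exists>\<alpha> f. ordinal \<alpha> \<and> L_hierarchy \<alpha> f \<and> x \<in>\<^sub>0 app0 f \<alpha>)"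


subsection \<open>Class functions\<close>

definition sub01 :: "'s \<Rightarrow> 'c \<Rightarrow> bool" (infix \<open>\<subseteq>\<^sub>0\<^sub>1\<close> 50) where
  "S \<subseteq>\<^sub>0\<^sub>1 A \<longleftrightarrow> (\<forall>x. x \<in>\<^sub>0 S \<longrightarrow> x \<in>\<^sub>1 A)"

text \<open>In the following three definitions, \<open>\<Gamma>\<close> is the graph of the function.\<close>

definition class_fun :: "'c \<Rightarrow> 'c \<Rightarrow> 'c \<Rightarrow> bool" where
  "class_fun \<Gamma> A B \<longleftrightarrow>
     (\<forall>p. p \<in>\<^sub>1 \<Gamma> \<longrightarrow> (\<exists>x y. x \<in>\<^sub>1 A \<and> y \<in>\<^sub>1 B \<and> p = opair x y)) \<and>
     (\<forall>x. x \<in>\<^sub>1 A \<longrightarrow> (\<exists>!y. opair x y \<in>\<^sub>1 \<Gamma>))"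

definition bounded_class_fun :: "'c \<Rightarrow> 'c \<Rightarrow> 'c \<Rightarrow> bool" where
  "bounded_class_fun \<Gamma> A B \<longleftrightarrow> class_fun \<Gamma> A B \<and>
     (\<forall>S. S \<subseteq>\<^sub>0\<^sub>1 A \<longrightarrow>
        (\<exists>T G. T \<subseteq>\<^sub>0\<^sub>1 B \<and>
           (\<forall>y. y \<in>\<^sub>0 T \<longleftrightarrow> (\<exists>x. x \<in>\<^sub>0 S \<and> opair x y \<in>\<^sub>1 \<Gamma>)) \<and>
           (\<forall>p. p \<in>\<^sub>0 G \<longleftrightarrow>
              p \<in>\<^sub>1 \<Gamma> \<and> (\<exists>x y. x \<in>\<^sub>0 S \<and> y \<in>\<^sub>0 T \<and> p = opair x y))))"

definition locally_small_class_fun :: "'c \<Rightarrow> 'c \<Rightarrow> 'c \<Rightarrow> bool" where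
  "locally_small_class_fun \<Gamma> A B \<longleftrightarrow> class_fun \<Gamma> A B \<and>
     (\<forall>S. S \<subseteq>\<^sub>0\<^sub>1 B \<longrightarrow>
        (\<exists>T G. T \<subseteq>\<^sub>0\<^sub>1 A \<and>
           (\<forall>x. x \<in>\<^sub>0 T \<longleftrightarrow> (\<exists>y. y \<in>\<^sub>0 S \<and> opair x y \<in>\<^sub>1 \<Gamma>)) \<and>
           (\<forall>p. p \<in>\<^sub>0 G \<longleftrightarrow>
              p \<in>\<^sub>1 \<Gamma> \<and> (\<exists>x y. x \<in>\<^sub>0 T \<and> y \<in>\<^sub>0 S \<and> p = opair x y))))"


subsection \<open>Tuples of classes\<close>

text \<open>A pair of classes is coded as a single class, namely the disjoint union of the two.\<close>

definition cpair :: "'c \<Rightarrow> 'c \<Rightarrow> 'c" where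
  "cpair X Y = class_of (\<lambda>z. (\<exists>x. x \<in>\<^sub>1 X \<and> z = opair empty0 x) \<or>
                             (\<exists>y. y \<in>\<^sub>1 Y \<and> z = opair one0 y))"

definition cfst :: "'c \<Rightarrow> 'c" where
  "cfst Z = class_of (\<lambda>x. opair empty0 x \<in>\<^sub>1 Z)"

definition csnd :: "'c \<Rightarrow> 'c" where
  "csnd Z = class_of (\<lambda>y. opair one0 y \<in>\<^sub>1 Z)"

definition ctriple :: "'c \<Rightarrow> 'c \<Rightarrow> 'c \<Rightarrow> 'c" where
  "ctriple X Y Z = cpair X (cpair Y Z)"

definition c1 :: "'c \<Rightarrow> 'c" where "c1 Z = cfst Z"
definition c2 :: "'c \<Rightarrow> 'c" where "c2 Z = cfst (csnd Z)"
definition c3 :: "'c \<Rightarrow> 'c" where "c3 Z = csnd (csnd Z)"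


subsection \<open>The category of classes and bounded class functions, and slices\<close>

text \<open>An arrow is the triple of its domain, its graph and its codomain.\<close>

definition BClass :: "'c category" where
  "BClass = \<lparr>
     Ob = (\<lambda>A. True),
     Ar = (\<lambda>f. \<exists>A \<Gamma> B. f = ctriple A \<Gamma> B \<and> bounded_class_fun \<Gamma> A B),
     Dom = c1,
     Cod = c3,
     Ident = (\<lambda>A. ctriple A (class_of (\<lambda>p. \<exists>x. x \<in>\<^sub>1 A \<and> p = opair x x)) A),
     Comp = (\<lambda>g f. ctriple (c1 f)
       (class_of (\<lambda>p. \<exists>x y z. opair x y \<in>\<^sub>1 c2 f \<and> opair y z \<in>\<^sub>1 c2 g \<and> p = opair x z))
       (c3 g)) \<rparr>"

definition locally_small :: "'c \<Rightarrow> bool" where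
  "locally_small f \<longleftrightarrow> locally_small_class_fun (c2 f) (c1 f) (c3 f)"

text \<open>An arrow of the slice from \<open>g\<close> to \<open>g'\<close> is a triple \<open>(g, h, g')\<close> with \<open>g' \<circ> h = g\<close>.\<close>

definition slice :: "'c category \<Rightarrow> 'c \<Rightarrow> 'c category" where
  "slice C A = \<lparr>
     Ob = (\<lambda>g. Ar C g \<and> Cod C g = A),
     Ar = (\<lambda>t. \<exists>g h g'. t = ctriple g h g' \<and>
        Ar C g \<and> Cod C g = A \<and> Ar C g' \<and> Cod C g' = A \<and>
        Hom C (Dom C g) (Dom C g') h \<and> Comp C g' h = g),
     Dom = c1,
     Cod = c3,
     Ident = (\<lambda>g. ctriple g (Ident C (Dom C g)) g),
     Comp = (\<lambda>u t. ctriple (c1 t) (Comp C (c2 u) (c2 t)) (c3 u)) \<rparr>"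


subsection \<open>Functors and adjunctions\<close>

text \<open>
  Functors are objects of the theory: a functor is given by two collections of (codes of) pairs of
  classes, the graphs of its object part and its arrow part.
\<close>

definition coll_fun :: "'k \<Rightarrow> ('c \<Rightarrow> bool) \<Rightarrow> ('c \<Rightarrow> bool) \<Rightarrow> bool" where
  "coll_fun K P Q \<longleftrightarrow>
     (\<forall>Z. Z \<in>\<^sub>2 K \<longrightarrow> (\<exists>X Y. P X \<and> Q Y \<and> Z = cpair X Y)) \<and>
     (\<forall>X. P X \<longrightarrow> (\<exists>!Y. cpair X Y \<in>\<^sub>2 K))"

definition app2 :: "'k \<Rightarrow> 'c \<Rightarrow> 'c" where
  "app2 K X = (THE Y. cpair X Y \<in>\<^sub>2 K)"

abbreviation on_ob :: "'k \<times> 'k \<Rightarrow> 'c \<Rightarrow> 'c" where "on_ob T \<equiv> app2 (fst T)"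
abbreviation on_ar :: "'k \<times> 'k \<Rightarrow> 'c \<Rightarrow> 'c" where "on_ar T \<equiv> app2 (snd T)"

definition is_functor :: "'c category \<Rightarrow> 'c category \<Rightarrow> 'k \<times> 'k \<Rightarrow> bool" where
  "is_functor C D T \<longleftrightarrow> is_category C \<and> is_category D \<and>
     coll_fun (fst T) (Ob C) (Ob D) \<and> coll_fun (snd T) (Ar C) (Ar D) \<and>
     (\<forall>x y f. Hom C x y f \<longrightarrow> Hom D (on_ob T x) (on_ob T y) (on_ar T f)) \<and>
     (\<forall>x. Ob C x \<longrightarrow> on_ar T (Ident C x) = Ident D (on_ob T x)) \<and>
     (\<forall>x y z f g. Hom C x y f \<and> Hom C y z g \<longrightarrow>
        on_ar T (Comp C g f) = Comp D (on_ar T g) (on_ar T f))"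

text \<open>
  \<open>L: C \<rightarrow> D\<close> is left adjoint to \<open>R: D \<rightarrow> C\<close>: a collection \<open>\<Phi>\<close> is the graph of a family of
  bijections \<open>D(L x, y) \<cong> C(x, R y)\<close>, natural in \<open>x\<close> and \<open>y\<close>. The objects \<open>x\<close> and \<open>y\<close> are
  recorded in the graph because \<open>L x\<close> and \<open>R y\<close> do not determine them.
\<close>

definition left_adjoint ::
    "'c category \<Rightarrow> 'c category \<Rightarrow> 'k \<times> 'k \<Rightarrow> 'k \<times> 'k \<Rightarrow> bool" where
  "left_adjoint C D L R \<longleftrightarrow> is_functor C D L \<and> is_functor D C R \<and>
     (\<exists>\<Phi>.
        (\<forall>Z. Z \<in>\<^sub>2 \<Phi> \<longrightarrow> (\<exists>x y f g. Z = ctriple x y (cpair f g) \<and> Ob C x \<and> Ob D y \<and>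
            Hom D (on_ob L x) y f \<and> Hom C x (on_ob R y) g)) \<and>
        (\<forall>x y f. Ob C x \<and> Ob D y \<and> Hom D (on_ob L x) y f \<longrightarrow>
            (\<exists>!g. ctriple x y (cpair f g) \<in>\<^sub>2 \<Phi>)) \<and>
        (\<forall>x y g. Ob C x \<and> Ob D y \<and> Hom C x (on_ob R y) g \<longrightarrow>
            (\<exists>!f. ctriple x y (cpair f g) \<in>\<^sub>2 \<Phi>)) \<and>
        (\<forall>x x' y y' a b f g.
            Hom C x' x a \<and> Hom D y y' b \<and> ctriple x y (cpair f g) \<in>\<^sub>2 \<Phi> \<longrightarrow>
            ctriple x' y'
              (cpair (Comp D b (Comp D f (on_ar L a))) (Comp C (on_ar R b) (Comp C g a)))
              \<in>\<^sub>2 \<Phi>))"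


subsection \<open>The pullback functor\<close>

text \<open>
  For \<open>F: B \<rightarrow> A\<close> and \<open>g: C \<rightarrow> A\<close>, the canonical pullback is the class of the pairs \<open>(b, c)\<close> with
  \<open>F b = g c\<close>, with its projection to \<open>B\<close>; \<open>h\<close> over \<open>A\<close> is sent to the map \<open>(b, c) \<mapsto> (b, h c)\<close>.
\<close>

definition fibre_product :: "'c \<Rightarrow> 'c \<Rightarrow> 'c" where
  "fibre_product F g = class_of (\<lambda>p. \<exists>b c a. p = opair b c \<and>
     b \<in>\<^sub>1 c1 F \<and> c \<in>\<^sub>1 c1 g \<and> opair b a \<in>\<^sub>1 c2 F \<and> opair c a \<in>\<^sub>1 c2 g)"

definition pullback_ob :: "'c \<Rightarrow> 'c \<Rightarrow> 'c" where
  "pullback_ob F g = ctriple (fibre_product F g)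
     (class_of (\<lambda>p. \<exists>b c. opair b c \<in>\<^sub>1 fibre_product F g \<and> p = opair (opair b c) b))
     (c1 F)"

definition pullback_ar :: "'c \<Rightarrow> 'c \<Rightarrow> 'c" where
  "pullback_ar F t = ctriple (pullback_ob F (c1 t))
     (ctriple (fibre_product F (c1 t))
        (class_of (\<lambda>p. \<exists>b c c'. opair b c \<in>\<^sub>1 fibre_product F (c1 t) \<and>
           opair c c' \<in>\<^sub>1 c2 (c2 t) \<and> p = opair (opair b c) (opair b c')))
        (fibre_product F (c3 t)))
     (pullback_ob F (c3 t))"

definition pullback_functor :: "'c \<Rightarrow> 'k \<times> 'k" where
  "pullback_functor F =
     (coll_of (\<lambda>Z. \<exists>g. Ob (slice BClass (c3 F)) g \<and> Z = cpair g (pullback_ob F g)),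
      coll_of (\<lambda>Z. \<exists>t. Ar (slice BClass (c3 F)) t \<and> Z = cpair t (pullback_ar F t)))"

end


section \<open>The axioms of Mac Lane Type Theory\<close>

text \<open>
  The models of the theory. By the completeness theorem, being provable in it amounts to holding
  in all of them. Bounded separation is for formulas of pure set theory only: classes
  are not allowed as parameters there.
\<close>

locale MTT = MTT_language mem0 mem1 mem2
  for mem0 :: "'s \<Rightarrow> 's \<Rightarrow> bool" (infix \<open>\<in>\<^sub>0\<close> 50)
    and mem1 :: "'s \<Rightarrow> 'c \<Rightarrow> bool" (infix \<open>\<in>\<^sub>1\<close> 50)
    and mem2 :: "'c \<Rightarrow> 'k \<Rightarrow> bool" (infix \<open>\<in>\<^sub>2\<close> 50) +
  assumes set_ext: "(\<forall>z. z \<in>\<^sub>0 x \<longleftrightarrow> z \<in>\<^sub>0 y) \<Longrightarrow> x = y"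
    and empty_set: "\<exists>x. \<forall>z. \<not> z \<in>\<^sub>0 x"
    and pairing: "\<exists>p. \<forall>z. z \<in>\<^sub>0 p \<longleftrightarrow> z = x \<or> z = y"
    and union: "\<exists>u. \<forall>z. z \<in>\<^sub>0 u \<longleftrightarrow> (\<exists>y. y \<in>\<^sub>0 x \<and> z \<in>\<^sub>0 y)"
    and power_set: "\<exists>p. \<forall>z. z \<in>\<^sub>0 p \<longleftrightarrow> z \<subseteq>\<^sub>0 x"
    and infinity: "\<exists>I. is_inductive I"
    and foundation: "(\<exists>y. y \<in>\<^sub>0 x) \<Longrightarrow> \<exists>y. y \<in>\<^sub>0 x \<and> \<not> (\<exists>z. z \<in>\<^sub>0 y \<and> z \<in>\<^sub>0 x)"
    and bounded_separation:
      "delta0 \<phi> \<Longrightarrow> \<exists>y. \<forall>x. x \<in>\<^sub>0 y \<longleftrightarrow> x \<in>\<^sub>0 a \<and> sat \<phi> (e0(i := x)) e1 e2"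
    and choice:
      "\<lbrakk>\<forall>u. u \<in>\<^sub>0 x \<longrightarrow> (\<exists>z. z \<in>\<^sub>0 u);
        \<forall>u v. u \<in>\<^sub>0 x \<and> v \<in>\<^sub>0 x \<and> u \<noteq> v \<longrightarrow> \<not> (\<exists>z. z \<in>\<^sub>0 u \<and> z \<in>\<^sub>0 v)\<rbrakk>
       \<Longrightarrow> \<exists>c. \<forall>u. u \<in>\<^sub>0 x \<longrightarrow> (\<exists>!z. z \<in>\<^sub>0 u \<and> z \<in>\<^sub>0 c)"
    and transitive_containment: "\<exists>t. transitive0 t \<and> x \<subseteq>\<^sub>0 t"
    and V_eq_L: "constructible x"
    and class_ext: "(\<forall>z. z \<in>\<^sub>1 X \<longleftrightarrow> z \<in>\<^sub>1 Y) \<Longrightarrow> X = Y"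
    and class_comprehension:
      "only_set_quant \<phi> \<Longrightarrow> \<exists>X. \<forall>x. x \<in>\<^sub>1 X \<longleftrightarrow> sat \<phi> (e0(i := x)) e1 e2"
    and coll_ext: "(\<forall>Z. Z \<in>\<^sub>2 K \<longleftrightarrow> Z \<in>\<^sub>2 K') \<Longrightarrow> K = K'"
    and coll_comprehension:
      "no_coll_quant \<phi> \<Longrightarrow> \<exists>K. \<forall>X. X \<in>\<^sub>2 K \<longleftrightarrow> sat \<phi> e0 (e1(i := X)) e2"

end

theory Submission
  imports Defs
begin

text \<open>
  Classes and bounded functions are handled through their elements: an arrow of a slice is determined
  by the values of its underlying function, so all equations between arrows are checked pointwise.
  The left adjoint is composition with \<open>F\<close>, and a map \<open>f\<close> over \<open>A\<close> corresponds to
  \<open>c \<mapsto> (x c, f c)\<close>. If \<open>F\<close> is locally small, every fibre \<open>F\<inverse>(a)\<close> is a set, so a section of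
  \<open>g\<close> over it is again a set when \<open>g\<close> is in the slice over \<open>B\<close>; the right adjoint sends \<open>g\<close> to the
  class of all pairs \<open>(a, s)\<close> of a point and such a section, and transposition is currying.

  The comprehension schemes need formulas. Definability of a predicate by a formula of one of
  the three kinds is therefore proved to be closed under the logical operations and under
  definable terms, so that it can be established by following the shape of the predicate.
\<close>

section \<open>Definability\<close>

text \<open>There is no replacement, and separation only admits bounded formulas free of class
  parameters. So even the composite of two bounded functions has to be shown bounded by exhibiting a
  set that contains its values and a bounded formula for its graph. This is possible because the
  restrictions of the given functions to sets are sets themselves and may enter such a formula as
  parameters, in place of the classes. For the right adjoint, local smallness is used for whole sets
  of points and not just for single ones: it gathers the fibres over them into one set, so that the
  sections over them are subsets of one fixed product. A second constraint is that functors and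
  families of bijections are collections. Objects and arrows must therefore depend definably on
  classes that vary, also where a description fails to denote. Hence the constructions are built
  from descriptions with a fixed junk value, and the given pullback is first rewritten in that
  form.\<close>

primrec rename :: "(nat \<Rightarrow> nat) \<Rightarrow> (nat \<Rightarrow> nat) \<Rightarrow> fm \<Rightarrow> fm" where
  "rename r s (Eq0 i j) = Eq0 (r i) (r j)"
| "rename r s (Eq1 i j) = Eq1 (s i) (s j)"
| "rename r s (Eq2 i j) = Eq2 i j"
| "rename r s (Mem0 i j) = Mem0 (r i) (r j)"
| "rename r s (Mem1 i j) = Mem1 (r i) (s j)"
| "rename r s (Mem2 i j) = Mem2 (s i) j"
| "rename r s (Neg \<phi>) = Neg (rename r s \<phi>)"
| "rename r s (And \<phi> \<psi>) = And (rename r s \<phi>) (rename r s \<psi>)"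
| "rename r s (All0 i \<phi>) = All0 (r i) (rename r s \<phi>)"
| "rename r s (All1 i \<phi>) = All1 (s i) (rename r s \<phi>)"
| "rename r s (All2 i \<phi>) = All2 i (rename r s \<phi>)"

text \<open>Injectivity keeps the variable of a bounded quantifier distinct from its bound, as the
  last rule of \<open>delta0\<close> demands.\<close>

lemma delta0_rename: "delta0 \<phi> \<Longrightarrow> inj r \<Longrightarrow> delta0 (rename r s \<phi>)"
  by (induction rule: delta0.induct) (auto intro!: delta0.intros simp: inj_eq)

lemma only_set_quant_rename: "only_set_quant (rename r s \<phi>) = only_set_quant \<phi>"
  by (induction \<phi>) auto

lemma no_coll_quant_rename: "no_coll_quant (rename r s \<phi>) = no_coll_quant \<phi>"
  by (induction \<phi>) auto

lemma fun_upd_comp_inj: "inj r \<Longrightarrow> (e(r i := x)) \<circ> r = (e \<circ> r)(i := x)"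
  by (auto simp: fun_eq_iff inj_eq)

text \<open>Bound variables are renamed together with the free ones. Under an injective renaming no
  other variable lands on the updated one, so capture cannot occur and the environment is simply
  precomposed.\<close>

lemma (in MTT_language) sat_rename:
  "inj r \<Longrightarrow> inj s \<Longrightarrow> sat (rename r s \<phi>) e0 e1 e2 = sat \<phi> (e0 \<circ> r) (e1 \<circ> s) e2"
  by (induction \<phi> arbitrary: e0 e1 e2) (simp_all add: fun_upd_comp_inj)

text \<open>\<open>Bounded\<close> belongs to separation, \<open>Full False\<close> to class
  comprehension and \<open>Full True\<close> to collection comprehension. The flag only decides
  about class quantifiers, so most closure lemmas for the last two are stated once, for
  \<open>Full b\<close>.\<close>

datatype kind = Bounded | Full bool

fun formula_of :: "kind \<Rightarrow> fm \<Rightarrow> bool" where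
  "formula_of Bounded \<phi> = delta0 \<phi>"
| "formula_of (Full False) \<phi> = only_set_quant \<phi>"
| "formula_of (Full True) \<phi> = no_coll_quant \<phi>"

lemma formula_of_closed:
  "formula_of K \<phi> \<Longrightarrow> formula_of K (Neg \<phi>)"
  "formula_of K \<phi> \<Longrightarrow> formula_of K \<psi> \<Longrightarrow> formula_of K (And \<phi> \<psi>)"
  "formula_of K \<phi> \<Longrightarrow> inj r \<Longrightarrow> formula_of K (rename r s \<phi>)"
  "formula_of K (Eq0 i j)" "formula_of K (Mem0 i j)"
  "formula_of (Full b) (Mem1 i j)"
  "formula_of (Full b) \<phi> \<Longrightarrow> formula_of (Full b) (All0 i \<phi>)"
  "formula_of (Full True) \<phi> \<Longrightarrow> formula_of (Full True) (All1 i \<phi>)"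
         apply (cases "(K,\<phi>)" rule: formula_of.cases; auto intro: delta0.intros)
        apply (cases "(K,\<phi>)" rule: formula_of.cases; auto intro: delta0.intros)
       apply (cases "(K,\<phi>)" rule: formula_of.cases;
      auto intro: delta0_rename simp: only_set_quant_rename no_coll_quant_rename)
      apply (cases "(K,Eq0 i j)" rule: formula_of.cases; auto intro: delta0.intros)
     apply (cases "(K,Mem0 i j)" rule: formula_of.cases; auto intro: delta0.intros)
  by (cases b; simp)+

text \<open>
  The even variables of a formula hold the environment and the odd ones its parameters. The
  renamings below merge two parameter lists, and free the slot 1 for a quantified variable that is
  pushed onto the environment.
\<close>

definition interleave :: "(nat \<Rightarrow> 'a) \<Rightarrow> (nat \<Rightarrow> 'a) \<Rightarrow> nat \<Rightarrow> 'a" where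
  "interleave e p i = (if even i then e (i div 2) else p (i div 2))"

lemma interleave_simps [simp]:
  "interleave e p 0 = e 0"
  "interleave e p (2 * i) = e i"
  "interleave e p (Suc (2 * i)) = p i"
  by (auto simp: interleave_def)

lemma even_odd_split: "(\<And>i. P (2 * i)) \<Longrightarrow> (\<And>i. P (Suc (2 * i))) \<Longrightarrow> P (n::nat)"
  by (metis oddE evenE Suc_eq_plus1)

definition keep_left :: "nat \<Rightarrow> nat" where
  "keep_left i = (if even i then i else 2 * i - 1)"

definition keep_right :: "nat \<Rightarrow> nat" where
  "keep_right i = (if even i then i else 2 * i + 1)"

definition push :: "nat \<Rightarrow> nat" where
  "push i = (if i = 0 then 1 else if even i then i - 2 else i + 2)"

lemma inj_keep_left: "inj keep_left"
  by (rule injI) (auto simp: keep_left_def split: if_splits; presburger)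

lemma inj_keep_right: "inj keep_right"
  by (rule injI) (auto simp: keep_right_def split: if_splits; presburger)

lemma inj_push: "inj push"
  by (rule injI) (auto simp: push_def split: if_splits; presburger)

text \<open>Parameter n is variable 2n+1. It moves to 4n+1, which is entry 2n of the merged list and
  so comes from \<open>p\<close>; \<open>keep_right\<close> moves it to 4n+3, entry 2n+1, for
  \<open>q\<close>.\<close>

lemma interleave_keep_left: "interleave e (interleave p q) \<circ> keep_left = interleave e p"
proof
  fix n show "(interleave e (interleave p q) \<circ> keep_left) n = interleave e p n"
    by (rule even_odd_split[of _ n]) (auto simp: keep_left_def interleave_def)
qed

lemma interleave_keep_right: "interleave e (interleave p q) \<circ> keep_right = interleave e q"
proof
  fix n show "(interleave e (interleave p q) \<circ> keep_right) n = interleave e q n"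
    by (rule even_odd_split[of _ n]) (auto simp: keep_right_def interleave_def)
qed

text \<open>Variable 1 is parameter 0 and holds the dummy \<open>u\<close>. Overwriting it with
  \<open>x\<close> provides the new top of the stack, to which \<open>push\<close> sends variable 0;
  the older stack entries move back by one place and the parameters forward by one.\<close>

lemma interleave_push:
  "(interleave e (case_nat u p))(1 := x) \<circ> push = interleave (case_nat x e) p"
proof
  fix n
  show "((interleave e (case_nat u p))(1 := x) \<circ> push) n = interleave (case_nat x e) p n"
  proof (rule even_odd_split[of _ n])
    fix i show "((interleave e (case_nat u p))(1 := x) \<circ> push) (2 * i) = interleave (case_nat x e) p (2 * i)"
      by (cases i) (auto simp: push_def interleave_def)
  next
    fix i show "((interleave e (case_nat u p))(1 := x) \<circ> push) (Suc (2 * i)) = interleave (case_nat x e) p (Suc (2 * i))"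
      by (auto simp: push_def interleave_def)
  qed
qed

section \<open>Definable predicates and their closure under logical operations\<close>

context MTT
begin

text \<open>
  Environments are read as stacks: the innermost quantified variable is number 0 and the others
  are shifted by one.
\<close>

definition definable :: "kind \<Rightarrow> ((nat \<Rightarrow> 's) \<Rightarrow> (nat \<Rightarrow> 'c) \<Rightarrow> bool) \<Rightarrow> bool" where
  "definable K Q \<longleftrightarrow> (\<exists>\<phi> p c. formula_of K \<phi> \<and>
     (\<forall>e E. Q e E \<longleftrightarrow> sat \<phi> (interleave e p) (interleave E c) undefined))"

lemma definableI:
  "formula_of K \<phi> \<Longrightarrow> (\<And>e E. Q e E \<longleftrightarrow> sat \<phi> (interleave e p) (interleave E c) undefined)
   \<Longrightarrow> definable K Q"
  unfolding definable_def by blast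

lemma definable_Not: "definable K Q \<Longrightarrow> definable K (\<lambda>e E. \<not> Q e E)"
  unfolding definable_def by (metis formula_of_closed(1) sat.simps(7))

lemma definable_conj:
  assumes "definable K Q" "definable K R"
  shows "definable K (\<lambda>e E. Q e E \<and> R e E)"
proof -
  obtain \<phi> p c where \<phi>: "formula_of K \<phi>"
    "\<And>e E. Q e E \<longleftrightarrow> sat \<phi> (interleave e p) (interleave E c) undefined"
    using assms(1) unfolding definable_def by blast
  obtain \<psi> q d where \<psi>: "formula_of K \<psi>"
    "\<And>e E. R e E \<longleftrightarrow> sat \<psi> (interleave e q) (interleave E d) undefined"
    using assms(2) unfolding definable_def by blast
  show ?thesis
    by (rule definableI[of K "And (rename keep_left keep_left \<phi>) (rename keep_right keep_right \<psi>)"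
          _ "interleave p q" "interleave c d"])
      (auto intro!: formula_of_closed \<phi>(1) \<psi>(1) inj_keep_left inj_keep_right
        simp: sat_rename inj_keep_left inj_keep_right interleave_keep_left interleave_keep_right \<phi>(2) \<psi>(2))
qed

lemma definable_disj:
  assumes "definable K Q" "definable K R"
  shows "definable K (\<lambda>e E. Q e E \<or> R e E)"
  using definable_Not[OF definable_conj[OF assms[THEN definable_Not]]] by simp

lemma definable_imp:
  assumes "definable K Q" "definable K R"
  shows "definable K (\<lambda>e E. Q e E \<longrightarrow> R e E)"
  using definable_disj[OF definable_Not[OF assms(1)] assms(2)] by (simp only: imp_conv_disj)

lemma definable_iff:
  assumes "definable K Q" "definable K R"
  shows "definable K (\<lambda>e E. Q e E = R e E)"
  using definable_conj[OF definable_imp[OF assms] definable_imp[OF assms(2,1)]]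
  by (simp only: iff_conv_conj_imp)

text \<open>The premise reads the quantified value at position 0 and shifts everything else. In this
  form the rule can be applied backwards by higher-order unification, so that \<open>intro\<close>
  descends through nested quantifiers unaided.\<close>

lemma definable_all:
  assumes "definable (Full b) (\<lambda>e E. Q (e 0) (\<lambda>i. e (Suc i)) E)"
  shows "definable (Full b) (\<lambda>e E. \<forall>x. Q x e E)"
proof -
  obtain \<phi> p c where \<phi>: "formula_of (Full b) \<phi>"
    "\<And>e E. Q (e 0) (\<lambda>i. e (Suc i)) E \<longleftrightarrow> sat \<phi> (interleave e p) (interleave E c) undefined"
    using assms unfolding definable_def by blast
  have eq: "Q x e E \<longleftrightarrow> sat \<phi> (interleave (case_nat x e) p) (interleave E c) undefined" for x e E
    using \<phi>(2)[of "case_nat x e" E] by simp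
  show ?thesis
    by (rule definableI[of _ "All0 1 (rename push id \<phi>)" _ "case_nat undefined p" c])
      (auto intro!: formula_of_closed \<phi>(1) inj_push simp: sat_rename inj_push interleave_push[simplified] eq)
qed

lemma definable_ex:
  assumes "definable (Full b) (\<lambda>e E. Q (e 0) (\<lambda>i. e (Suc i)) E)"
  shows "definable (Full b) (\<lambda>e E. \<exists>x. Q x e E)"
  using definable_Not[OF definable_all[where Q = "\<lambda>x e E. \<not> Q x e E", OF definable_Not[OF assms]]]
  by simp

lemma definable_all_class:
  assumes "definable (Full True) (\<lambda>e E. Q (E 0) e (\<lambda>i. E (Suc i)))"
  shows "definable (Full True) (\<lambda>e E. \<forall>X. Q X e E)"
proof -
  obtain \<phi> p c where \<phi>: "formula_of (Full True) \<phi>"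
    "\<And>e E. Q (E 0) e (\<lambda>i. E (Suc i)) \<longleftrightarrow> sat \<phi> (interleave e p) (interleave E c) undefined"
    using assms unfolding definable_def by blast
  have eq: "Q x e E \<longleftrightarrow> sat \<phi> (interleave e p) (interleave (case_nat x E) c) undefined" for x e E
    using \<phi>(2)[of "case_nat x E" e] by simp
  show ?thesis
    by (rule definableI[of _ "All1 1 (rename id push \<phi>)" _ p "case_nat undefined c"])
      (auto intro!: formula_of_closed \<phi>(1) simp del: formula_of.simps simp: sat_rename inj_push interleave_push[simplified] eq)
qed

lemma definable_ex_class:
  assumes "definable (Full True) (\<lambda>e E. Q (E 0) e (\<lambda>i. E (Suc i)))"
  shows "definable (Full True) (\<lambda>e E. \<exists>X. Q X e E)"
  using definable_Not[OF definable_all_class[where Q = "\<lambda>x e E. \<not> Q x e E", OF definable_Not[OF assms]]]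
  by simp

text \<open>Bounded formulas only get variables and constants as terms: a compound term would have
  to be eliminated by an unbounded quantifier, and the range of a bounded quantifier must be a
  variable.\<close>

definition atom :: "((nat \<Rightarrow> 's) \<Rightarrow> (nat \<Rightarrow> 'c) \<Rightarrow> 's) \<Rightarrow> bool" where
  "atom t \<longleftrightarrow> (\<exists>n. t = (\<lambda>e E. e n)) \<or> (\<exists>c. t = (\<lambda>e E. c))"

lemma atom_var: "atom (\<lambda>e E. e n)" and atom_const: "atom (\<lambda>e E. c)"
  unfolding atom_def by blast+

lemma atoms_index:
  assumes "atom t" "atom u"
  obtains i j p where "\<And>e E. t e E = interleave e p i" "\<And>e E. u e E = interleave e p j"
proof -
  \<comment> \<open>A constant is stored as parameter \<open>n\<close>; taking 0 for
    \<open>t\<close> and 1 for \<open>u\<close> lets both share one parameter list.\<close>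
  have *: "\<exists>i c. \<forall>e p E. p n = c \<longrightarrow> t e E = interleave e p i" if t: "atom t" for t n
  proof -
    from t consider m where "t = (\<lambda>e E. e m)" | c where "t = (\<lambda>e E. c)"
      unfolding atom_def by blast
    then show ?thesis
    proof cases
      case 1 then show ?thesis by (intro exI[of _ "2 * m"]) simp
    next
      case 2 then show ?thesis by (intro exI[of _ "Suc (2 * n)"] exI[of _ c]) simp
    qed
  qed
  obtain i c where i: "\<forall>e p E. p (0::nat) = c \<longrightarrow> t e E = interleave e p i"
    using *[OF assms(1)] by blast
  obtain j d where j: "\<forall>e p E. p (1::nat) = d \<longrightarrow> u e E = interleave e p j"
    using *[OF assms(2)] by blast
  show ?thesis
    by (rule that[where i = i and j = j and p = "case_nat c (\<lambda>_. d)"])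
      (rule i[rule_format], simp, rule j[rule_format], simp)
qed

lemma definable_mem0_atom: "atom t \<Longrightarrow> atom u \<Longrightarrow> definable K (\<lambda>e E. t e E \<in>\<^sub>0 u e E)"
  by (rule atoms_index[of t u], assumption+)
    (rule definableI, rule formula_of_closed(5), simp)

lemma definable_eq_atom: "atom t \<Longrightarrow> atom u \<Longrightarrow> definable K (\<lambda>e E. t e E = u e E)"
  by (rule atoms_index[of t u], assumption+)
    (rule definableI, rule formula_of_closed(4), simp)

text \<open>A proposition that does not depend on the environment is equivalent to a tautology or to
  its negation, so no formula expressing it has to be found.\<close>

lemma definable_const: "definable K (\<lambda>e E. P)"
proof -
  have "definable K (\<lambda>e E. e 0 = e 0)"
    by (rule definable_eq_atom; rule atom_var)
  then have "definable K (\<lambda>e E. True)" by simp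
  moreover from definable_Not[OF this] have "definable K (\<lambda>e E. False)" by simp
  ultimately show ?thesis by (cases P) simp_all
qed

lemma definable_ball:
  assumes t: "atom t" and Q: "definable Bounded (\<lambda>e E. Q (e 0) (\<lambda>i. e (Suc i)) E)"
  shows "definable Bounded (\<lambda>e E. \<forall>x. x \<in>\<^sub>0 t e E \<longrightarrow> Q x e E)"
proof -
  obtain \<phi> p c where \<phi>: "delta0 \<phi>"
    "\<And>e E. Q (e 0) (\<lambda>i. e (Suc i)) E \<longleftrightarrow> sat \<phi> (interleave e p) (interleave E c) undefined"
    using Q unfolding definable_def by auto
  have eq: "Q x e E \<longleftrightarrow> sat \<phi> (interleave (case_nat x e) p) (interleave E c) undefined" for x e E
    using \<phi>(2)[of "case_nat x e" E] by simp
  show ?thesis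
  proof (cases "\<exists>n. t = (\<lambda>e E. e n)")
    case True
    then obtain n where n: "t = (\<lambda>e E. e n)" by blast
    \<comment> \<open>The range \<open>2 * n\<close> is even and hence differs from the quantified
      variable 1. It lies outside the renamed body, so it is read in the outer environment.\<close>
    show ?thesis
      by (rule definableI[of _ "All0 1 (Neg (And (Mem0 1 (2 * n)) (Neg (rename push id \<phi>))))"
            _ "case_nat undefined p" c])
        (auto intro!: delta0.intros delta0_rename \<phi>(1) inj_push
          simp: sat_rename inj_push interleave_push[simplified] eq n)
  next
    case False
    then obtain a where a: "t = (\<lambda>e E. a)" using t unfolding atom_def by blast
    have *: "(interleave e (case_nat u (case_nat a p)))(1 := x) \<circ> push
      = interleave (case_nat x e) (case_nat a p)" for u e x
      using interleave_push by simp
    \<comment> \<open>\<open>r\<close> shifts the parameters of the body to make room for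
      \<open>a\<close> as parameter 0. Since \<open>push\<close> needs one more slot in front,
      \<open>a\<close> ends up as parameter 1, which is variable 3.\<close>
    define r where "r = (\<lambda>i::nat. if even i then i else i + 2)"
    have r: "inj r" by (rule injI) (auto simp: r_def split: if_splits; presburger)
    have **: "interleave e (case_nat a p) \<circ> r = interleave e p" for e
    proof
      fix n show "(interleave e (case_nat a p) \<circ> r) n = interleave e p n"
        by (rule even_odd_split[of _ n]) (auto simp: r_def interleave_def)
    qed
    have 3: "interleave e (case_nat u (case_nat a p)) 3 = a" for e u
      by (simp add: interleave_def)
    show ?thesis
      by (rule definableI[of _ "All0 1 (Neg (And (Mem0 1 3) (Neg (rename push id (rename r id \<phi>)))))"
            _ "case_nat undefined (case_nat a p)" c])
        (auto intro!: delta0.intros delta0_rename \<phi>(1) inj_push r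
          simp: sat_rename inj_push r *[simplified] ** eq a 3)
  qed
qed

lemma definable_bex:
  assumes "atom t" "definable Bounded (\<lambda>e E. Q (e 0) (\<lambda>i. e (Suc i)) E)"
  shows "definable Bounded (\<lambda>e E. \<exists>x. x \<in>\<^sub>0 t e E \<and> Q x e E)"
  using definable_Not[OF definable_ball[where Q = "\<lambda>x e E. \<not> Q x e E", OF assms(1) definable_Not[OF assms(2)]]]
  by simp

lemma definable_mem1_atom: "definable (Full b) (\<lambda>e E. e n \<in>\<^sub>1 E m)"
   "definable (Full b) (\<lambda>e E. e n \<in>\<^sub>1 X)"
   apply (rule definableI[of _ "Mem1 (2 * n) (2 * m)"], rule formula_of_closed(6), simp)
  apply (rule definableI[of _ "Mem1 (2 * n) 1" _ _ "\<lambda>_. X"], rule formula_of_closed(6))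
  by (simp add: interleave_def)

section \<open>The axiom schemes, restated for definable predicates\<close>

lemma separation:
  assumes "definable Bounded (\<lambda>e E. P (e 0))"
  shows "\<exists>y. \<forall>x. x \<in>\<^sub>0 y \<longleftrightarrow> x \<in>\<^sub>0 a \<and> P x"
proof -
  obtain \<phi> p c where \<phi>: "delta0 \<phi>"
    "\<And>e E. P (e 0) \<longleftrightarrow> sat \<phi> (interleave e p) (interleave E c) undefined"
    using assms unfolding definable_def by auto
  \<comment> \<open>\<open>P\<close> looks only at position 0 of the environment, so the other
    positions may hold anything; \<open>a\<close> serves as filler.\<close>
  have eq: "(interleave (\<lambda>_. a) p)(0 := x) = interleave (\<lambda>i. if i = 0 then x else a) p" for x
    by (auto simp: fun_eq_iff interleave_def)
  show ?thesis
    using bounded_separation[OF \<phi>(1), of a "interleave (\<lambda>_. a) p" 0 "interleave undefined c" undefined]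
    unfolding eq \<phi>(2)[symmetric] by simp
qed

lemma class_exists:
  assumes "definable (Full False) (\<lambda>e E. P (e 0))"
  shows "\<exists>X. \<forall>x. x \<in>\<^sub>1 X \<longleftrightarrow> P x"
proof -
  obtain \<phi> p c where \<phi>: "only_set_quant \<phi>"
    "\<And>e E. P (e 0) \<longleftrightarrow> sat \<phi> (interleave e p) (interleave E c) undefined"
    using assms unfolding definable_def by auto
  have eq: "(interleave (\<lambda>_. a) p)(0 := x) = interleave (\<lambda>i. if i = 0 then x else a) p" for x a
    by (auto simp: fun_eq_iff interleave_def)
  show ?thesis
    using class_comprehension[OF \<phi>(1), of "interleave (\<lambda>_. undefined) p" 0 "interleave undefined c" undefined]
    unfolding eq \<phi>(2)[symmetric] by simp
qed

lemma coll_exists: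
  assumes "definable (Full True) (\<lambda>e E. P (E 0))"
  shows "\<exists>K. \<forall>X. X \<in>\<^sub>2 K \<longleftrightarrow> P X"
proof -
  obtain \<phi> p c where \<phi>: "no_coll_quant \<phi>"
    "\<And>e E. P (E 0) \<longleftrightarrow> sat \<phi> (interleave e p) (interleave E c) undefined"
    using assms unfolding definable_def by auto
  have eq: "(interleave (\<lambda>_. a) c)(0 := x) = interleave (\<lambda>i. if i = 0 then x else a) c" for x a
    by (auto simp: fun_eq_iff interleave_def)
  show ?thesis
    using coll_comprehension[OF \<phi>(1), of "interleave undefined p" "interleave (\<lambda>_. undefined) c" 0 undefined]
    unfolding eq \<phi>(2)[symmetric] by simp
qed

lemma definable_Full:
  assumes "definable Bounded Q" shows "definable (Full b) Q"
proof -
  have "delta0 \<phi> \<Longrightarrow> only_set_quant \<phi> \<and> no_coll_quant \<phi>" for \<phi>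
    by (induction rule: delta0.induct) auto
  then have "delta0 \<phi> \<Longrightarrow> formula_of (Full b) \<phi>" for \<phi>
    by (cases b) auto
  then show ?thesis using assms unfolding definable_def by fastforce
qed

lemma definable_reindex:
  assumes "definable K Q" "inj f" "inj g"
  shows "definable K (\<lambda>e E. Q (\<lambda>i. e (f i)) (\<lambda>i. E (g i)))"
proof -
  obtain \<phi> p c where \<phi>: "formula_of K \<phi>"
    "\<And>e E. Q e E \<longleftrightarrow> sat \<phi> (interleave e p) (interleave E c) undefined"
    using assms unfolding definable_def by blast
  define r where "r h i = (if even i then 2 * h (i div 2) else i)" for h :: "nat \<Rightarrow> nat" and i
  have inj: "inj (r h)" if "inj h" for h
    using that by (intro injI) (auto simp: r_def inj_eq split: if_splits; presburger)
  have comp: "interleave e p \<circ> r h = interleave (\<lambda>i. e (h i)) p" for e p :: "nat \<Rightarrow> 'x" and h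
  proof
    fix n show "(interleave e p \<circ> r h) n = interleave (\<lambda>i. e (h i)) p n"
      by (rule even_odd_split[of _ n]) (auto simp: r_def interleave_def)
  qed
  show ?thesis
    by (rule definableI[of _ "rename (r f) (r g) \<phi>" _ p c])
      (auto intro!: formula_of_closed \<phi>(1) inj assms simp: sat_rename inj assms comp \<phi>(2))
qed

text \<open>Inserts an ignored entry just below the top of the stack. This is the situation when a
  predicate is applied to its own variable under a further quantifier, as in the uniqueness half of
  \<open>definable_ex1\<close>.\<close>

lemma definable_weaken:
  assumes "definable K (\<lambda>e E. Q (e 0) (\<lambda>i. e (Suc i)) E)"
  shows "definable K (\<lambda>e E. Q (e 0) (\<lambda>i. e (Suc (Suc i))) E)"
proof -
  have "inj (case_nat 0 (\<lambda>i. Suc (Suc i)))"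
    by (rule injI) (auto split: nat.splits)
  from definable_reindex[OF assms this inj_on_id] show ?thesis
    by (simp only: nat.case id_apply)
qed

lemma definable_weaken_class:
  assumes "definable K (\<lambda>e E. Q e E)"
  shows "definable K (\<lambda>e E. Q e (\<lambda>i. E (Suc i)))"
  using definable_reindex[OF assms inj_on_id inj_Suc] by (simp only: id_apply)

lemma definable_ex1:
  assumes "definable (Full b) (\<lambda>e E. Q (e 0) (\<lambda>i. e (Suc i)) E)"
  shows "definable (Full b) (\<lambda>e E. \<exists>!x. Q x e E)"
  unfolding Ex1_def
  by (intro definable_ex definable_conj definable_all definable_imp definable_eq_atom atom_var
      definable_weaken[OF assms] assms)

text \<open>The language has no compound terms, so a set-valued term is represented by its graph. A
  class-valued one is represented by its elements, which avoids quantifying over its value.\<close>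

definition definable_set :: "kind \<Rightarrow> ((nat \<Rightarrow> 's) \<Rightarrow> (nat \<Rightarrow> 'c) \<Rightarrow> 's) \<Rightarrow> bool" where
  "definable_set K t \<longleftrightarrow> definable K (\<lambda>e E. e 0 = t (\<lambda>i. e (Suc i)) E)"

definition definable_class :: "kind \<Rightarrow> ((nat \<Rightarrow> 's) \<Rightarrow> (nat \<Rightarrow> 'c) \<Rightarrow> 'c) \<Rightarrow> bool" where
  "definable_class K T \<longleftrightarrow> definable K (\<lambda>e E. e 0 \<in>\<^sub>1 T (\<lambda>i. e (Suc i)) E)"

lemma definable_set_var: "definable_set K (\<lambda>e E. e n)"
  and definable_set_const: "definable_set K (\<lambda>e E. a)"
  unfolding definable_set_def by (intro definable_eq_atom atom_var atom_const)+

lemma definable_class_var: "definable_class (Full b) (\<lambda>e E. E n)"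
  and definable_class_const: "definable_class (Full b) (\<lambda>e E. X)"
  unfolding definable_class_def by (rule definable_mem1_atom)+

text \<open>The term is replaced by an unbounded existential quantifier over its value, which is why
  substitution is restricted to \<open>Full b\<close>.\<close>

lemma definable_subst:
  assumes "definable_set (Full b) t" "definable (Full b) (\<lambda>e E. Q (e 0) (\<lambda>i. e (Suc i)) E)"
  shows "definable (Full b) (\<lambda>e E. Q (t e E) e E)"
proof -
  have "definable (Full b) (\<lambda>e E. \<exists>x. x = t e E \<and> Q x e E)"
    by (intro definable_ex definable_conj assms assms(1)[unfolded definable_set_def])
  then show ?thesis by simp
qed

lemma definable_set_weaken:
  "definable_set K t \<Longrightarrow> definable_set K (\<lambda>e E. t (\<lambda>i. e (Suc i)) E)"
  unfolding definable_set_def by (rule definable_weaken)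

lemma definable_eq:
  assumes "definable_set (Full b) t" "definable_set (Full b) u"
  shows "definable (Full b) (\<lambda>e E. t e E = u e E)"
  using assms(1) by (rule definable_subst) (use assms(2) in \<open>simp add: definable_set_def\<close>)

lemma definable_mem0:
  assumes t: "definable_set (Full b) t" and u: "definable_set (Full b) u"
  shows "definable (Full b) (\<lambda>e E. t e E \<in>\<^sub>0 u e E)"
  by (rule definable_subst[OF t], rule definable_subst[OF definable_set_weaken[OF u]])
    (intro definable_mem0_atom atom_var)

lemma definable_mem1:
  assumes "definable_set (Full b) t" "definable_class (Full b) T"
  shows "definable (Full b) (\<lambda>e E. t e E \<in>\<^sub>1 T e E)"
  using assms(1) by (rule definable_subst) (use assms(2) in \<open>simp add: definable_class_def\<close>)

text \<open>Extensionality reduces the equation to a quantifier over sets, so it may also occur in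
  class comprehension.\<close>

lemma definable_class_eq:
  assumes "definable_class (Full b) T" "definable_class (Full b) U"
  shows "definable (Full b) (\<lambda>e E. T e E = U e E)"
proof -
  have "definable (Full b) (\<lambda>e E. \<forall>z. z \<in>\<^sub>1 T e E \<longleftrightarrow> z \<in>\<^sub>1 U e E)"
    by (intro definable_all definable_iff assms[unfolded definable_class_def])
  moreover have "(\<forall>z. z \<in>\<^sub>1 X \<longleftrightarrow> z \<in>\<^sub>1 Y) \<longleftrightarrow> X = Y" for X Y
    using class_ext by blast
  ultimately show ?thesis by simp
qed

text \<open>
  In contrast to \<open>THE\<close>, the junk value does not depend on the predicate, which makes the
  description definable without any assumption of unique existence.
\<close>

definition the_or_undefined :: "('a \<Rightarrow> bool) \<Rightarrow> 'a" where
  "the_or_undefined P = (if \<exists>!x. P x then THE x. P x else undefined)"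

lemma the_or_undefined_eq:
  assumes "P x" "\<And>y. P y \<Longrightarrow> y = x"
  shows "the_or_undefined P = x"
proof -
  have "\<exists>!y. P y" using assms by (rule ex1I)
  then show ?thesis
    unfolding the_or_undefined_def using the_equality[of P, OF assms] by simp
qed

lemma the_or_undefined_iff:
  assumes "\<exists>!x. P x" shows "x = the_or_undefined P \<longleftrightarrow> P x"
proof -
  obtain y where y: "P y" "\<And>w. P w \<Longrightarrow> w = y" using assms by (rule ex1E) blast
  then have "the_or_undefined P = y" by (rule the_or_undefined_eq)
  with y show ?thesis by blast
qed

lemma eq_the_or_undefined:
  "z = the_or_undefined P \<longleftrightarrow> P z \<and> (\<forall>y. P y \<longrightarrow> y = z) \<or> \<not> (\<exists>!y. P y) \<and> z = undefined"
proof (cases "\<exists>!y. P y")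
  case True
  then obtain y where y: "P y" "\<And>w. P w \<Longrightarrow> w = y" by (rule ex1E) blast
  then have "the_or_undefined P = y" by (rule the_or_undefined_eq)
  with y True show ?thesis by metis
next
  case False
  then have "the_or_undefined P = undefined" unfolding the_or_undefined_def by (rule if_not_P)
  with False show ?thesis by (simp only:) blast
qed

lemma definable_set_the:
  assumes "definable (Full b) (\<lambda>e E. P (e 0) (\<lambda>i. e (Suc i)) E)"
  shows "definable_set (Full b) (\<lambda>e E. the_or_undefined (\<lambda>x. P x e E))"
  unfolding definable_set_def eq_the_or_undefined
  by (intro definable_disj definable_conj definable_all definable_imp definable_Not definable_ex1
      definable_eq_atom atom_var atom_const definable_weaken[OF assms] assms)

definition set_or :: "('s \<Rightarrow> bool) \<Rightarrow> 's" where
  "set_or P = the_or_undefined (\<lambda>y. \<forall>x. x \<in>\<^sub>0 y \<longleftrightarrow> P x)"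

lemma set_or_eq: "(\<And>x. x \<in>\<^sub>0 y \<longleftrightarrow> P x) \<Longrightarrow> set_or P = y"
  unfolding set_or_def by (rule the_or_undefined_eq) (auto intro: set_ext)

lemma definable_set_or:
  assumes "definable (Full b) (\<lambda>e E. P (e 0) (\<lambda>i. e (Suc i)) E)"
  shows "definable_set (Full b) (\<lambda>e E. set_or (\<lambda>x. P x e E))"
  unfolding set_or_def
  by (intro definable_set_the definable_all definable_iff definable_mem0_atom atom_var
      definable_weaken[OF assms] assms)

definition class_or :: "('s \<Rightarrow> bool) \<Rightarrow> 'c" where
  "class_or P = the_or_undefined (\<lambda>X. \<forall>x. x \<in>\<^sub>1 X \<longleftrightarrow> P x)"

lemma class_or_eq: "(\<And>x. x \<in>\<^sub>1 X \<longleftrightarrow> P x) \<Longrightarrow> class_or P = X"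
  unfolding class_or_def by (rule the_or_undefined_eq) (auto intro: class_ext)

lemma definable_class_or:
  assumes "definable (Full True) (\<lambda>e E. P (e 0) (\<lambda>i. e (Suc i)) E)"
  shows "definable_class (Full True) (\<lambda>e E. class_or (\<lambda>x. P x e E))"
proof -
  \<comment> \<open>\<open>Q\<close> may involve class quantifiers, so comprehension need not
    provide a class for it. The formula distinguishes the two cases by a class quantifier, which
    forces \<open>Full True\<close>.\<close>
  have *: "z \<in>\<^sub>1 class_or Q \<longleftrightarrow> (\<exists>X. (\<forall>x. x \<in>\<^sub>1 X \<longleftrightarrow> Q x) \<and> z \<in>\<^sub>1 X) \<or>
      \<not> (\<exists>X. (\<forall>x. x \<in>\<^sub>1 X \<longleftrightarrow> Q x)) \<and> z \<in>\<^sub>1 undefined" for z Q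
  proof (cases "\<exists>X. \<forall>x. x \<in>\<^sub>1 X \<longleftrightarrow> Q x")
    case True
    then obtain X where X: "\<And>x. x \<in>\<^sub>1 X \<longleftrightarrow> Q x" by blast
    then have "class_or Q = X" by (rule class_or_eq)
    with X True show ?thesis by auto
  next
    case False
    then have "class_or Q = undefined"
      unfolding class_or_def the_or_undefined_def by auto
    with False show ?thesis by auto
  qed
  note w = definable_weaken[OF assms]
  show ?thesis
    unfolding definable_class_def *
    by (intro definable_disj definable_ex_class definable_conj definable_all definable_iff
        definable_mem1_atom definable_mem1 definable_set_var definable_class_const definable_Not
        definable_weaken_class[OF w] w)
qed

section \<open>Sets, classes and bounded functions\<close>

lemma set_of_eq: "(\<And>x. x \<in>\<^sub>0 y \<longleftrightarrow> P x) \<Longrightarrow> set_of P = y"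
  unfolding set_of_def by (rule the_equality) (auto intro: set_ext)

lemma class_of_eq: "(\<And>x. x \<in>\<^sub>1 y \<longleftrightarrow> P x) \<Longrightarrow> class_of P = y"
  unfolding class_of_def by (rule the_equality) (auto intro: class_ext)

lemma coll_of_eq: "(\<And>x. x \<in>\<^sub>2 y \<longleftrightarrow> P x) \<Longrightarrow> coll_of P = y"
  unfolding coll_of_def by (rule the_equality) (auto intro: coll_ext)

lemma mem_set_of: "\<exists>y. \<forall>x. x \<in>\<^sub>0 y \<longleftrightarrow> P x \<Longrightarrow> x \<in>\<^sub>0 set_of P \<longleftrightarrow> P x"
  using set_of_eq by metis

lemma mem_class_of:
  "definable (Full False) (\<lambda>e E. P (e 0)) \<Longrightarrow> x \<in>\<^sub>1 class_of P \<longleftrightarrow> P x"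
  using class_exists class_of_eq by metis

lemma mem_class_or:
  "definable (Full False) (\<lambda>e E. P (e 0)) \<Longrightarrow> x \<in>\<^sub>1 class_or P \<longleftrightarrow> P x"
  using class_exists class_or_eq by metis

lemma mem_coll_of:
  "definable (Full True) (\<lambda>e E. P (E 0)) \<Longrightarrow> X \<in>\<^sub>2 coll_of P \<longleftrightarrow> P X"
  using coll_exists coll_of_eq by metis

section \<open>Ordered pairs and sets of pairs\<close>

lemma mem_empty0 [simp]: "\<not> x \<in>\<^sub>0 empty0"
  unfolding empty0_def using mem_set_of[of "\<lambda>_. False"] empty_set by blast

lemma mem_upair [simp]: "z \<in>\<^sub>0 upair x y \<longleftrightarrow> z = x \<or> z = y"
  unfolding upair_def by (rule mem_set_of[OF pairing])

lemma upair_eq: "t = upair u v \<longleftrightarrow> u \<in>\<^sub>0 t \<and> v \<in>\<^sub>0 t \<and> (\<forall>z. z \<in>\<^sub>0 t \<longrightarrow> z = u \<or> z = v)"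
  by (auto intro!: set_ext)

lemma opair_inject [simp]: "opair a b = opair c d \<longleftrightarrow> a = c \<and> b = d"
  unfolding opair_def by (metis mem_upair)

text \<open>Keeps apart the two tags in the disjoint union that codes a pair of classes.\<close>

lemma empty0_not_one0 [simp]: "empty0 \<noteq> one0" "one0 \<noteq> empty0"
proof -
  have "\<exists>y. \<forall>z. z \<in>\<^sub>0 y \<longleftrightarrow> z \<in>\<^sub>0 empty0 \<or> z = empty0"
    using pairing[of empty0 empty0] by auto
  then have "empty0 \<in>\<^sub>0 one0"
    unfolding one0_def suc0_def by (subst mem_set_of) auto
  then show "empty0 \<noteq> one0" "one0 \<noteq> empty0" by (metis mem_empty0)+
qed

text \<open>Every quantifier ranges over \<open>t\<close> or over an element of \<open>t\<close>, as
  separation requires. The repeated conjunct and disjunct come from unfolding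
  \<open>upair u u\<close>.\<close>

lemma opair_eq:
  "t = opair u v \<longleftrightarrow> (\<exists>a. a \<in>\<^sub>0 t \<and> (\<exists>b. b \<in>\<^sub>0 t \<and>
    (u \<in>\<^sub>0 a \<and> u \<in>\<^sub>0 a \<and> (\<forall>z. z \<in>\<^sub>0 a \<longrightarrow> z = u \<or> z = u)) \<and>
    (u \<in>\<^sub>0 b \<and> v \<in>\<^sub>0 b \<and> (\<forall>z. z \<in>\<^sub>0 b \<longrightarrow> z = u \<or> z = v)) \<and>
    (\<forall>z. z \<in>\<^sub>0 t \<longrightarrow> z = a \<or> z = b)))"
proof -
  have "t = opair u v \<longleftrightarrow> (\<exists>a. a \<in>\<^sub>0 t \<and> (\<exists>b. b \<in>\<^sub>0 t \<and>
    a = upair u u \<and> b = upair u v \<and> (\<forall>z. z \<in>\<^sub>0 t \<longrightarrow> z = a \<or> z = b)))"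
    unfolding opair_def upair_eq[of t] by blast
  then show ?thesis by (simp only: upair_eq)
qed

lemma atom_weaken: "atom t \<Longrightarrow> atom (\<lambda>e E. t (\<lambda>i. e (Suc i)) E)"
  unfolding atom_def by blast

lemmas bounded_rules =
  definable_const definable_mem0_atom definable_eq_atom atom_var atom_const
  definable_Not definable_conj definable_disj definable_imp definable_iff
  definable_ball definable_bex

lemma definable_opair_atom:
  assumes "atom t" "atom u" "atom v"
  shows "definable Bounded (\<lambda>e E. t e E = opair (u e E) (v e E))"
  unfolding opair_eq
  by (intro bounded_rules assms assms[THEN atom_weaken] assms[THEN atom_weaken, THEN atom_weaken]
      assms[THEN atom_weaken, THEN atom_weaken, THEN atom_weaken])

text \<open>The pair is not an atom, but as a possible element of \<open>v\<close> it can be named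
  by a quantifier bounded by \<open>v\<close>.\<close>

lemma definable_opair_mem:
  assumes "atom t" "atom u" "atom v"
  shows "definable Bounded (\<lambda>e E. opair (t e E) (u e E) \<in>\<^sub>0 v e E)"
proof -
  have "definable Bounded (\<lambda>e E. \<exists>q. q \<in>\<^sub>0 v e E \<and> q = opair (t e E) (u e E))"
    by (intro bounded_rules definable_opair_atom assms assms[THEN atom_weaken] assms[THEN atom_weaken, THEN atom_weaken]
      assms[THEN atom_weaken, THEN atom_weaken, THEN atom_weaken])
  moreover have "(\<exists>q. q \<in>\<^sub>0 w \<and> q = z) \<longleftrightarrow> z \<in>\<^sub>0 w" for w z by blast
  ultimately show ?thesis by (simp only:)
qed

lemma definable_set_opair:
  assumes "definable_set (Full b) t" "definable_set (Full b) u"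
  shows "definable_set (Full b) (\<lambda>e E. opair (t e E) (u e E))"
  unfolding definable_set_def
  by (rule definable_subst[OF definable_set_weaken[OF assms(1)]],
      rule definable_subst[OF definable_set_weaken[OF definable_set_weaken[OF assms(2)]]])
    (intro definable_Full definable_opair_atom atom_var)

lemmas separation_rules = definable_opair_atom definable_opair_mem bounded_rules

definition fst0 :: "'s \<Rightarrow> 's" where
  "fst0 p = the_or_undefined (\<lambda>x. \<exists>y. p = opair x y)"

definition snd0 :: "'s \<Rightarrow> 's" where
  "snd0 p = the_or_undefined (\<lambda>y. \<exists>x. p = opair x y)"

lemma fst0_opair [simp]: "fst0 (opair x y) = x"
  unfolding fst0_def by (rule the_or_undefined_eq) auto

lemma snd0_opair [simp]: "snd0 (opair x y) = y"
  unfolding snd0_def by (rule the_or_undefined_eq) auto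

definition apply0 :: "'s \<Rightarrow> 's \<Rightarrow> 's" where
  "apply0 s x = the_or_undefined (\<lambda>y. opair x y \<in>\<^sub>0 s)"

lemmas full_logic_rules =
  definable_const definable_Not definable_conj definable_disj definable_imp definable_iff
  definable_ex1 definable_all definable_ex definable_all_class definable_ex_class
  definable_eq definable_class_eq definable_mem0 definable_mem1
  definable_set_var definable_set_const definable_set_opair definable_set_the definable_set_or
  definable_class_var definable_class_const definable_class_or

lemma definable_set_fst0:
  assumes "definable_set (Full b) t" shows "definable_set (Full b) (\<lambda>e E. fst0 (t e E))"
  unfolding fst0_def by (intro full_logic_rules assms[THEN definable_set_weaken] assms[THEN definable_set_weaken, THEN definable_set_weaken])

lemma definable_set_snd0:
  assumes "definable_set (Full b) t" shows "definable_set (Full b) (\<lambda>e E. snd0 (t e E))"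
  unfolding snd0_def by (intro full_logic_rules assms[THEN definable_set_weaken] assms[THEN definable_set_weaken, THEN definable_set_weaken])

lemma definable_set_apply0:
  assumes "definable_set (Full b) t" "definable_set (Full b) u"
  shows "definable_set (Full b) (\<lambda>e E. apply0 (t e E) (u e E))"
  unfolding apply0_def by (intro full_logic_rules assms[THEN definable_set_weaken] assms[THEN definable_set_weaken, THEN definable_set_weaken])

lemma union0_exists: "\<exists>V. \<forall>z. z \<in>\<^sub>0 V \<longleftrightarrow> z \<in>\<^sub>0 S \<or> z \<in>\<^sub>0 T"
  using union[of "upair S T"] by auto

lemma product_exists: "\<exists>P. \<forall>p. p \<in>\<^sub>0 P \<longleftrightarrow> (\<exists>x. x \<in>\<^sub>0 S \<and> (\<exists>y. y \<in>\<^sub>0 T \<and> p = opair x y))"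
proof -
  obtain V where V: "\<And>z. z \<in>\<^sub>0 V \<longleftrightarrow> z \<in>\<^sub>0 S \<or> z \<in>\<^sub>0 T" using union0_exists by blast
  \<comment> \<open>A Kuratowski pair of elements of \<open>V\<close> is a set of subsets of
    \<open>V\<close>, so two power sets bound the product.\<close>
  obtain W where W: "\<And>z. z \<in>\<^sub>0 W \<longleftrightarrow> z \<subseteq>\<^sub>0 V" using power_set by blast
  obtain X where X: "\<And>z. z \<in>\<^sub>0 X \<longleftrightarrow> z \<subseteq>\<^sub>0 W" using power_set by blast
  have in_X: "opair x y \<in>\<^sub>0 X" if "x \<in>\<^sub>0 S" "y \<in>\<^sub>0 T" for x y
    using that by (auto simp: X W V sub0_def opair_def)
  have "definable Bounded (\<lambda>e E. \<exists>x. x \<in>\<^sub>0 S \<and> (\<exists>y. y \<in>\<^sub>0 T \<and> e 0 = opair x y))"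
    by (intro separation_rules)
  from separation[OF this, of X] show ?thesis
    using in_X by blast
qed

text \<open>Two unions strip the two layers of a Kuratowski pair. This is how a range obtains a
  bounding set without replacement.\<close>

lemma field_exists: "\<exists>V. \<forall>x y. opair x y \<in>\<^sub>0 S \<longrightarrow> x \<in>\<^sub>0 V \<and> y \<in>\<^sub>0 V"
proof -
  obtain U where U: "\<And>z. z \<in>\<^sub>0 U \<longleftrightarrow> (\<exists>y. y \<in>\<^sub>0 S \<and> z \<in>\<^sub>0 y)" using union by blast
  obtain V where V: "\<And>z. z \<in>\<^sub>0 V \<longleftrightarrow> (\<exists>y. y \<in>\<^sub>0 U \<and> z \<in>\<^sub>0 y)" using union by blast
  have "x \<in>\<^sub>0 V \<and> y \<in>\<^sub>0 V" if "opair x y \<in>\<^sub>0 S" for x y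
  proof -
    have "upair x y \<in>\<^sub>0 U" using that by (auto simp: U opair_def)
    then show ?thesis by (auto simp: V)
  qed
  then show ?thesis by blast
qed

section \<open>Coded pairs and triples of classes\<close>

lemma mem_cpair: "z \<in>\<^sub>1 cpair X Y \<longleftrightarrow>
  (\<exists>x. x \<in>\<^sub>1 X \<and> z = opair empty0 x) \<or> (\<exists>y. y \<in>\<^sub>1 Y \<and> z = opair one0 y)"
  unfolding cpair_def by (rule mem_class_of) (intro full_logic_rules)

lemma mem_cfst: "x \<in>\<^sub>1 cfst Z \<longleftrightarrow> opair empty0 x \<in>\<^sub>1 Z"
  unfolding cfst_def by (rule mem_class_of) (intro full_logic_rules)

lemma mem_csnd: "x \<in>\<^sub>1 csnd Z \<longleftrightarrow> opair one0 x \<in>\<^sub>1 Z"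
  unfolding csnd_def by (rule mem_class_of) (intro full_logic_rules)

lemma cfst_cpair [simp]: "cfst (cpair X Y) = X"
  by (rule class_ext) (simp add: mem_cfst mem_cpair)

lemma csnd_cpair [simp]: "csnd (cpair X Y) = Y"
  by (rule class_ext) (simp add: mem_csnd mem_cpair)

lemma cpair_inject [simp]: "cpair X Y = cpair X' Y' \<longleftrightarrow> X = X' \<and> Y = Y'"
  by (metis cfst_cpair csnd_cpair)

lemma ctriple_simps [simp]:
  "c1 (ctriple X Y Z) = X" "c2 (ctriple X Y Z) = Y" "c3 (ctriple X Y Z) = Z"
  "ctriple X Y Z = ctriple X' Y' Z' \<longleftrightarrow> X = X' \<and> Y = Y' \<and> Z = Z'"
  by (auto simp: c1_def c2_def c3_def ctriple_def)

lemma definable_class_cpair: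
  assumes "definable_class (Full b) T" "definable_class (Full b) U"
  shows "definable_class (Full b) (\<lambda>e E. cpair (T e E) (U e E))"
  unfolding definable_class_def mem_cpair
  by (intro full_logic_rules assms[unfolded definable_class_def]
      assms[unfolded definable_class_def, THEN definable_weaken])

lemma definable_set_reindex:
  assumes "definable_set K t" "inj f"
  shows "definable_set K (\<lambda>e E. t (\<lambda>i. e (f i)) E)"
proof -
  have "inj (case_nat 0 (\<lambda>i. Suc (f i)))"
    using assms(2) by (intro injI) (auto simp: inj_eq split: nat.splits)
  from definable_reindex[OF assms(1)[unfolded definable_set_def] this inj_on_id] show ?thesis
    unfolding definable_set_def by (simp only: nat.case id_apply)
qed

lemma definable_class_weaken:
  "definable_class K T \<Longrightarrow> definable_class K (\<lambda>e E. T (\<lambda>i. e (Suc i)) E)"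
  unfolding definable_class_def by (rule definable_weaken)

lemma definable_class_cfst:
  assumes "definable_class (Full b) T" shows "definable_class (Full b) (\<lambda>e E. cfst (T e E))"
  unfolding definable_class_def mem_cfst
  by (intro full_logic_rules definable_class_weaken[OF assms])

lemma definable_class_csnd:
  assumes "definable_class (Full b) T" shows "definable_class (Full b) (\<lambda>e E. csnd (T e E))"
  unfolding definable_class_def mem_csnd
  by (intro full_logic_rules definable_class_weaken[OF assms])

lemma definable_class_components:
  assumes "definable_class (Full b) T"
  shows "definable_class (Full b) (\<lambda>e E. c1 (T e E))"
    and "definable_class (Full b) (\<lambda>e E. c2 (T e E))"
    and "definable_class (Full b) (\<lambda>e E. c3 (T e E))"
  unfolding c1_def c2_def c3_def
  by (intro definable_class_cfst definable_class_csnd assms)+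

lemma definable_class_ctriple:
  assumes "definable_class (Full b) T" "definable_class (Full b) U" "definable_class (Full b) V"
  shows "definable_class (Full b) (\<lambda>e E. ctriple (T e E) (U e E) (V e E))"
  unfolding ctriple_def by (intro definable_class_cpair assms)

section \<open>Arrows described by their values\<close>

definition apply1 :: "'c \<Rightarrow> 's \<Rightarrow> 's" where
  "apply1 f x = the_or_undefined (\<lambda>y. opair x y \<in>\<^sub>1 c2 f)"

text \<open>Built with \<open>class_or\<close> in place of \<open>class_of\<close>, so that it
  depends definably on class variables in \<open>A\<close>, \<open>B\<close> and the function
  without any proof that the graph exists.\<close>

definition arrow_of :: "'c \<Rightarrow> ('s \<Rightarrow> 's) \<Rightarrow> 'c \<Rightarrow> 'c" where
  "arrow_of A \<phi> B = ctriple A (class_or (\<lambda>p. \<exists>x. x \<in>\<^sub>1 A \<and> p = opair x (\<phi> x))) B"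

lemma arrow_of_simps [simp]: "c1 (arrow_of A \<phi> B) = A" "c3 (arrow_of A \<phi> B) = B"
  by (simp_all add: arrow_of_def)

lemma definable_set_apply1:
  assumes "definable_class (Full b) T" "definable_set (Full b) t"
  shows "definable_set (Full b) (\<lambda>e E. apply1 (T e E) (t e E))"
  unfolding apply1_def
  by (intro full_logic_rules definable_set_weaken[OF assms(2)] definable_class_weaken[OF assms(1)]
      definable_class_components)

lemma definable_class_arrow_of:
  assumes A: "definable_class (Full True) A" and B: "definable_class (Full True) B"
    and \<phi>: "definable_set (Full True) (\<lambda>e E. \<phi> (e 0) (\<lambda>i. e (Suc i)) E)"
  shows "definable_class (Full True) (\<lambda>e E. arrow_of (A e E) (\<lambda>x. \<phi> x e E) (B e E))"
proof -
  have "inj (case_nat 0 (\<lambda>i. Suc (Suc i)))"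
    by (rule injI) (auto split: nat.splits)
  from definable_set_reindex[OF \<phi> this]
  have *: "definable_set (Full True) (\<lambda>e E. \<phi> (e 0) (\<lambda>i. e (Suc (Suc i))) E)"
    by (simp only: nat.case)
  show ?thesis
    unfolding arrow_of_def
    by (intro definable_class_ctriple full_logic_rules A B
        definable_class_weaken[OF definable_class_weaken[OF A]] *)
qed

lemmas full_rules = full_logic_rules definable_set_fst0 definable_set_snd0 definable_set_apply0
  definable_set_apply1 definable_class_cfst definable_class_csnd definable_class_components
  definable_class_cpair definable_class_ctriple definable_class_arrow_of

section \<open>Closure properties of bounded functions\<close>

definition bounded_on :: "'c \<Rightarrow> ('s \<Rightarrow> 's) \<Rightarrow> bool" where
  "bounded_on A \<phi> \<longleftrightarrow>
     (\<forall>S. S \<subseteq>\<^sub>0\<^sub>1 A \<longrightarrow> (\<exists>G. \<forall>p. p \<in>\<^sub>0 G \<longleftrightarrow> (\<exists>x. x \<in>\<^sub>0 S \<and> p = opair x (\<phi> x))))"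

text \<open>The range of a graph that is a set can be separated from the field of that graph, so
  asking \<open>bounded_on\<close> for the graph alone is enough.\<close>

lemma bounded_on_graph:
  assumes "bounded_on A \<phi>" "S \<subseteq>\<^sub>0\<^sub>1 A"
  shows "\<exists>G T. (\<forall>x y. opair x y \<in>\<^sub>0 G \<longleftrightarrow> x \<in>\<^sub>0 S \<and> y = \<phi> x)
    \<and> (\<forall>y. y \<in>\<^sub>0 T \<longleftrightarrow> (\<exists>x. x \<in>\<^sub>0 S \<and> y = \<phi> x))"
proof -
  obtain G where G: "\<And>p. p \<in>\<^sub>0 G \<longleftrightarrow> (\<exists>x. x \<in>\<^sub>0 S \<and> p = opair x (\<phi> x))"
    using assms unfolding bounded_on_def by blast
  obtain V where V: "\<And>x y. opair x y \<in>\<^sub>0 G \<Longrightarrow> x \<in>\<^sub>0 V \<and> y \<in>\<^sub>0 V" using field_exists by metis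
  have GG: "opair x y \<in>\<^sub>0 G \<longleftrightarrow> x \<in>\<^sub>0 S \<and> y = \<phi> x" for x y
    using G by auto
  have "definable Bounded (\<lambda>e E. \<exists>x. x \<in>\<^sub>0 S \<and> opair x (e 0) \<in>\<^sub>0 G)"
    by (intro separation_rules)
  from separation[OF this, of V] obtain T where
    "\<And>y. y \<in>\<^sub>0 T \<longleftrightarrow> y \<in>\<^sub>0 V \<and> (\<exists>x. x \<in>\<^sub>0 S \<and> opair x y \<in>\<^sub>0 G)" by blast
  then have "y \<in>\<^sub>0 T \<longleftrightarrow> (\<exists>x. x \<in>\<^sub>0 S \<and> y = \<phi> x)" for y
    using V GG by blast
  with GG show ?thesis by blast
qed

text \<open>The substitute for replacement: once a set \<open>V\<close> bounds the values, the graph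
  is separated from the product of \<open>S\<close> and \<open>V\<close>. The bounded predicate
  \<open>P\<close> may depend on \<open>S\<close> and needs to be correct only inside that product,
  so it can have graphs of restrictions as parameters.\<close>

lemma bounded_onI:
  assumes "\<And>S. S \<subseteq>\<^sub>0\<^sub>1 A \<Longrightarrow> \<exists>V P. (\<forall>x. x \<in>\<^sub>0 S \<longrightarrow> \<phi> x \<in>\<^sub>0 V)
      \<and> definable Bounded (\<lambda>e E. P (e (Suc 0)) (e 0))
      \<and> (\<forall>x y. x \<in>\<^sub>0 S \<and> y \<in>\<^sub>0 V \<longrightarrow> (P x y \<longleftrightarrow> y = \<phi> x))"
  shows "bounded_on A \<phi>"
  unfolding bounded_on_def
proof (intro allI impI)
  fix S assume "S \<subseteq>\<^sub>0\<^sub>1 A"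
  from assms[OF this] obtain V P where V: "\<And>x. x \<in>\<^sub>0 S \<Longrightarrow> \<phi> x \<in>\<^sub>0 V"
    and P: "definable Bounded (\<lambda>e E. P (e (Suc 0)) (e 0))"
    and eq: "\<And>x y. x \<in>\<^sub>0 S \<Longrightarrow> y \<in>\<^sub>0 V \<Longrightarrow> P x y \<longleftrightarrow> y = \<phi> x" by blast
  obtain X where X: "\<And>p. p \<in>\<^sub>0 X \<longleftrightarrow> (\<exists>x. x \<in>\<^sub>0 S \<and> (\<exists>y. y \<in>\<^sub>0 V \<and> p = opair x y))"
    using product_exists by metis
  have "definable Bounded (\<lambda>e E. \<exists>x. x \<in>\<^sub>0 S \<and> (\<exists>y. y \<in>\<^sub>0 V \<and> e 0 = opair x y \<and> P x y))"
    by (intro separation_rules P)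
  from separation[OF this, of X] obtain G where
    G: "\<And>p. p \<in>\<^sub>0 G \<longleftrightarrow> p \<in>\<^sub>0 X \<and> (\<exists>x. x \<in>\<^sub>0 S \<and> (\<exists>y. y \<in>\<^sub>0 V \<and> p = opair x y \<and> P x y))"
    by blast
  have "p \<in>\<^sub>0 G \<longleftrightarrow> (\<exists>x. x \<in>\<^sub>0 S \<and> p = opair x (\<phi> x))" for p
    unfolding G X using V eq by blast
  then show "\<exists>G. \<forall>p. p \<in>\<^sub>0 G \<longleftrightarrow> (\<exists>x. x \<in>\<^sub>0 S \<and> p = opair x (\<phi> x))" by blast
qed

lemma bounded_on_cong:
  "bounded_on A \<phi> \<Longrightarrow> (\<And>x. x \<in>\<^sub>1 A \<Longrightarrow> \<phi> x = \<psi> x) \<Longrightarrow> bounded_on A \<psi>"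
  unfolding bounded_on_def sub01_def by metis

lemma bounded_on_id: "bounded_on A (\<lambda>x. x)"
proof (rule bounded_onI)
  fix S
  have "definable Bounded (\<lambda>e E. e (Suc 0) = e 0)" by (intro separation_rules)
  then show "\<exists>V P. (\<forall>x. x \<in>\<^sub>0 S \<longrightarrow> x \<in>\<^sub>0 V) \<and> definable Bounded (\<lambda>e E. P (e (Suc 0)) (e 0)) \<and>
      (\<forall>x y. x \<in>\<^sub>0 S \<and> y \<in>\<^sub>0 V \<longrightarrow> P x y = (y = x))"
    by (intro exI[of _ S] exI[of _ "\<lambda>x y. x = y"]) auto
qed

lemma bounded_on_comp:
  assumes "bounded_on A \<phi>" "\<And>x. x \<in>\<^sub>1 A \<Longrightarrow> \<phi> x \<in>\<^sub>1 B" "bounded_on B \<psi>"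
  shows "bounded_on A (\<lambda>x. \<psi> (\<phi> x))"
proof (rule bounded_onI)
  fix S assume S: "S \<subseteq>\<^sub>0\<^sub>1 A"
  obtain G T where G: "\<And>x y. opair x y \<in>\<^sub>0 G \<longleftrightarrow> x \<in>\<^sub>0 S \<and> y = \<phi> x"
    and T: "\<And>y. y \<in>\<^sub>0 T \<longleftrightarrow> (\<exists>x. x \<in>\<^sub>0 S \<and> y = \<phi> x)"
    using bounded_on_graph[OF assms(1) S] by blast
  have "T \<subseteq>\<^sub>0\<^sub>1 B" using S T assms(2) unfolding sub01_def by metis
  then obtain H U where H: "\<And>x y. opair x y \<in>\<^sub>0 H \<longleftrightarrow> x \<in>\<^sub>0 T \<and> y = \<psi> x"
    and U: "\<And>y. y \<in>\<^sub>0 U \<longleftrightarrow> (\<exists>x. x \<in>\<^sub>0 T \<and> y = \<psi> x)"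
    using bounded_on_graph[OF assms(3)] by blast
  show "\<exists>V P. (\<forall>x. x \<in>\<^sub>0 S \<longrightarrow> \<psi> (\<phi> x) \<in>\<^sub>0 V) \<and> definable Bounded (\<lambda>e E. P (e (Suc 0)) (e 0)) \<and>
      (\<forall>x y. x \<in>\<^sub>0 S \<and> y \<in>\<^sub>0 V \<longrightarrow> P x y = (y = \<psi> (\<phi> x)))"
  proof (intro exI conjI)
    \<comment> \<open>The class functions cannot occur in a bounded formula; their restrictions
      \<open>G\<close> to \<open>S\<close> and \<open>H\<close> to the image \<open>T\<close> are
      sets and can.\<close>
    show "definable Bounded (\<lambda>e E. \<exists>y. y \<in>\<^sub>0 T \<and> opair (e (Suc 0)) y \<in>\<^sub>0 G \<and> opair y (e 0) \<in>\<^sub>0 H)"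
      by (intro separation_rules)
    show "\<forall>x. x \<in>\<^sub>0 S \<longrightarrow> \<psi> (\<phi> x) \<in>\<^sub>0 U" using T U by blast
  qed (auto simp: G H T U)
qed

lemma bounded_on_opair:
  assumes "bounded_on A \<phi>" "bounded_on A \<psi>"
  shows "bounded_on A (\<lambda>x. opair (\<phi> x) (\<psi> x))"
proof (rule bounded_onI)
  fix S assume S: "S \<subseteq>\<^sub>0\<^sub>1 A"
  obtain G T where G: "\<And>x y. opair x y \<in>\<^sub>0 G \<longleftrightarrow> x \<in>\<^sub>0 S \<and> y = \<phi> x"
    and T: "\<And>y. y \<in>\<^sub>0 T \<longleftrightarrow> (\<exists>x. x \<in>\<^sub>0 S \<and> y = \<phi> x)"
    using bounded_on_graph[OF assms(1) S] by blast
  obtain H U where H: "\<And>x y. opair x y \<in>\<^sub>0 H \<longleftrightarrow> x \<in>\<^sub>0 S \<and> y = \<psi> x"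
    and U: "\<And>y. y \<in>\<^sub>0 U \<longleftrightarrow> (\<exists>x. x \<in>\<^sub>0 S \<and> y = \<psi> x)"
    using bounded_on_graph[OF assms(2) S] by blast
  obtain X where X: "\<And>p. p \<in>\<^sub>0 X \<longleftrightarrow> (\<exists>x. x \<in>\<^sub>0 T \<and> (\<exists>y. y \<in>\<^sub>0 U \<and> p = opair x y))"
    using product_exists by metis
  show "\<exists>V P. (\<forall>x. x \<in>\<^sub>0 S \<longrightarrow> opair (\<phi> x) (\<psi> x) \<in>\<^sub>0 V) \<and>
      definable Bounded (\<lambda>e E. P (e (Suc 0)) (e 0)) \<and>
      (\<forall>x y. x \<in>\<^sub>0 S \<and> y \<in>\<^sub>0 V \<longrightarrow> P x y = (y = opair (\<phi> x) (\<psi> x)))"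
  proof (intro exI conjI)
    show "definable Bounded (\<lambda>e E. \<exists>y. y \<in>\<^sub>0 T \<and> (\<exists>z. z \<in>\<^sub>0 U \<and>
        opair (e (Suc 0)) y \<in>\<^sub>0 G \<and> opair (e (Suc 0)) z \<in>\<^sub>0 H \<and> e 0 = opair y z))"
      by (intro separation_rules)
    show "\<forall>x. x \<in>\<^sub>0 S \<longrightarrow> opair (\<phi> x) (\<psi> x) \<in>\<^sub>0 X" using X T U by blast
  qed (auto simp: G H T U)
qed

lemma bounded_on_fst0:
  assumes "bounded_on A \<phi>" "\<And>x. x \<in>\<^sub>1 A \<Longrightarrow> \<exists>u v. \<phi> x = opair u v"
  shows "bounded_on A (\<lambda>x. fst0 (\<phi> x))"
proof (rule bounded_onI)
  fix S assume S: "S \<subseteq>\<^sub>0\<^sub>1 A"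
  obtain G T where G: "\<And>x y. opair x y \<in>\<^sub>0 G \<longleftrightarrow> x \<in>\<^sub>0 S \<and> y = \<phi> x"
    and T: "\<And>y. y \<in>\<^sub>0 T \<longleftrightarrow> (\<exists>x. x \<in>\<^sub>0 S \<and> y = \<phi> x)"
    using bounded_on_graph[OF assms(1) S] by blast
  \<comment> \<open>The image \<open>T\<close> consists of pairs, so its field bounds both the
    values of the projection and the discarded component \<open>v\<close> in the formula
    below.\<close>
  obtain X where X: "\<And>x y. opair x y \<in>\<^sub>0 T \<Longrightarrow> x \<in>\<^sub>0 X \<and> y \<in>\<^sub>0 X" using field_exists by metis
  have eq: "\<exists>u v. \<phi> x = opair u v \<and> u \<in>\<^sub>0 X \<and> v \<in>\<^sub>0 X" if "x \<in>\<^sub>0 S" for x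
    using that S assms(2) X T unfolding sub01_def by metis
  show "\<exists>V P. (\<forall>x. x \<in>\<^sub>0 S \<longrightarrow> fst0 (\<phi> x) \<in>\<^sub>0 V) \<and>
      definable Bounded (\<lambda>e E. P (e (Suc 0)) (e 0)) \<and>
      (\<forall>x y. x \<in>\<^sub>0 S \<and> y \<in>\<^sub>0 V \<longrightarrow> P x y = (y = fst0 (\<phi> x)))"
  proof (intro exI conjI)
    show "definable Bounded (\<lambda>e E. \<exists>t. t \<in>\<^sub>0 T \<and> (\<exists>v. v \<in>\<^sub>0 X \<and>
        opair (e (Suc 0)) t \<in>\<^sub>0 G \<and> t = opair (e 0) v))"
      by (intro separation_rules)
    show "\<forall>x. x \<in>\<^sub>0 S \<longrightarrow> fst0 (\<phi> x) \<in>\<^sub>0 X" using eq by fastforce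
    show "\<forall>x y. x \<in>\<^sub>0 S \<and> y \<in>\<^sub>0 X \<longrightarrow> (\<exists>t. t \<in>\<^sub>0 T \<and> (\<exists>v. v \<in>\<^sub>0 X \<and>
        opair x t \<in>\<^sub>0 G \<and> t = opair y v)) = (y = fst0 (\<phi> x))"
      using eq G T by (metis fst0_opair)
  qed
qed

lemma bounded_on_snd0:
  assumes "bounded_on A \<phi>" "\<And>x. x \<in>\<^sub>1 A \<Longrightarrow> \<exists>u v. \<phi> x = opair u v"
  shows "bounded_on A (\<lambda>x. snd0 (\<phi> x))"
proof (rule bounded_onI)
  fix S assume S: "S \<subseteq>\<^sub>0\<^sub>1 A"
  obtain G T where G: "\<And>x y. opair x y \<in>\<^sub>0 G \<longleftrightarrow> x \<in>\<^sub>0 S \<and> y = \<phi> x"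
    and T: "\<And>y. y \<in>\<^sub>0 T \<longleftrightarrow> (\<exists>x. x \<in>\<^sub>0 S \<and> y = \<phi> x)"
    using bounded_on_graph[OF assms(1) S] by blast
  obtain X where X: "\<And>x y. opair x y \<in>\<^sub>0 T \<Longrightarrow> x \<in>\<^sub>0 X \<and> y \<in>\<^sub>0 X" using field_exists by metis
  have eq: "\<exists>u v. \<phi> x = opair u v \<and> u \<in>\<^sub>0 X \<and> v \<in>\<^sub>0 X" if "x \<in>\<^sub>0 S" for x
    using that S assms(2) X T unfolding sub01_def by metis
  show "\<exists>V P. (\<forall>x. x \<in>\<^sub>0 S \<longrightarrow> snd0 (\<phi> x) \<in>\<^sub>0 V) \<and>
      definable Bounded (\<lambda>e E. P (e (Suc 0)) (e 0)) \<and>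
      (\<forall>x y. x \<in>\<^sub>0 S \<and> y \<in>\<^sub>0 V \<longrightarrow> P x y = (y = snd0 (\<phi> x)))"
  proof (intro exI conjI)
    show "definable Bounded (\<lambda>e E. \<exists>t. t \<in>\<^sub>0 T \<and> (\<exists>v. v \<in>\<^sub>0 X \<and>
        opair (e (Suc 0)) t \<in>\<^sub>0 G \<and> t = opair v (e 0)))"
      by (intro separation_rules)
    show "\<forall>x. x \<in>\<^sub>0 S \<longrightarrow> snd0 (\<phi> x) \<in>\<^sub>0 X" using eq by fastforce
    show "\<forall>x y. x \<in>\<^sub>0 S \<and> y \<in>\<^sub>0 X \<longrightarrow> (\<exists>t. t \<in>\<^sub>0 T \<and> (\<exists>v. v \<in>\<^sub>0 X \<and>
        opair x t \<in>\<^sub>0 G \<and> t = opair v y)) = (y = snd0 (\<phi> x))"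
      using eq G T by (metis snd0_opair)
  qed
qed

lemma apply0_eq: "\<exists>!c. opair b c \<in>\<^sub>0 s \<Longrightarrow> c = apply0 s b \<longleftrightarrow> opair b c \<in>\<^sub>0 s"
  unfolding apply0_def by (rule the_or_undefined_iff)

lemma bounded_on_apply0:
  assumes "bounded_on A \<phi>" "bounded_on A \<beta>"
    and ex1: "\<And>x. x \<in>\<^sub>1 A \<Longrightarrow> \<exists>!c. opair (\<beta> x) c \<in>\<^sub>0 \<phi> x"
  shows "bounded_on A (\<lambda>x. apply0 (\<phi> x) (\<beta> x))"
proof (rule bounded_onI)
  fix S assume S: "S \<subseteq>\<^sub>0\<^sub>1 A"
  obtain G T where G: "\<And>x y. opair x y \<in>\<^sub>0 G \<longleftrightarrow> x \<in>\<^sub>0 S \<and> y = \<phi> x"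
    and T: "\<And>y. y \<in>\<^sub>0 T \<longleftrightarrow> (\<exists>x. x \<in>\<^sub>0 S \<and> y = \<phi> x)"
    using bounded_on_graph[OF assms(1) S] by blast
  obtain H U where H: "\<And>x y. opair x y \<in>\<^sub>0 H \<longleftrightarrow> x \<in>\<^sub>0 S \<and> y = \<beta> x"
    and U: "\<And>y. y \<in>\<^sub>0 U \<longleftrightarrow> (\<exists>x. x \<in>\<^sub>0 S \<and> y = \<beta> x)"
    using bounded_on_graph[OF assms(2) S] by blast
  \<comment> \<open>A value \<open>c\<close> occurs in a pair that is an element of some
    \<open>\<phi> x\<close>, hence of the union \<open>Y\<close> of the image; the field of
    \<open>Y\<close> bounds all values.\<close>
  obtain Y where Y: "\<And>z. z \<in>\<^sub>0 Y \<longleftrightarrow> (\<exists>y. y \<in>\<^sub>0 T \<and> z \<in>\<^sub>0 y)" using union by metis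
  obtain X where X: "\<And>x y. opair x y \<in>\<^sub>0 Y \<Longrightarrow> x \<in>\<^sub>0 X \<and> y \<in>\<^sub>0 X" using field_exists by metis
  have eq: "c = apply0 (\<phi> x) (\<beta> x) \<longleftrightarrow> opair (\<beta> x) c \<in>\<^sub>0 \<phi> x" if "x \<in>\<^sub>0 S" for x c
    using apply0_eq ex1 that S unfolding sub01_def by metis
  show "\<exists>V P. (\<forall>x. x \<in>\<^sub>0 S \<longrightarrow> apply0 (\<phi> x) (\<beta> x) \<in>\<^sub>0 V) \<and>
      definable Bounded (\<lambda>e E. P (e (Suc 0)) (e 0)) \<and>
      (\<forall>x y. x \<in>\<^sub>0 S \<and> y \<in>\<^sub>0 V \<longrightarrow> P x y = (y = apply0 (\<phi> x) (\<beta> x)))"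
  proof (intro exI conjI)
    show "definable Bounded (\<lambda>e E. \<exists>t. t \<in>\<^sub>0 T \<and> (\<exists>u. u \<in>\<^sub>0 U \<and>
        opair (e (Suc 0)) t \<in>\<^sub>0 G \<and> opair (e (Suc 0)) u \<in>\<^sub>0 H \<and> opair u (e 0) \<in>\<^sub>0 t))"
      by (intro separation_rules)
    show "\<forall>x. x \<in>\<^sub>0 S \<longrightarrow> apply0 (\<phi> x) (\<beta> x) \<in>\<^sub>0 X"
      using eq X Y T by metis
    show "\<forall>x y. x \<in>\<^sub>0 S \<and> y \<in>\<^sub>0 X \<longrightarrow> (\<exists>t. t \<in>\<^sub>0 T \<and> (\<exists>u. u \<in>\<^sub>0 U \<and>
        opair x t \<in>\<^sub>0 G \<and> opair x u \<in>\<^sub>0 H \<and> opair u y \<in>\<^sub>0 t)) = (y = apply0 (\<phi> x) (\<beta> x))"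
      using eq G H T U by metis
  qed
qed

section \<open>The category of classes and its slices\<close>

abbreviation arr :: "'c \<Rightarrow> bool" where "arr \<equiv> Ar BClass"

lemma arr_iff: "arr f \<longleftrightarrow> f = ctriple (c1 f) (c2 f) (c3 f) \<and> bounded_class_fun (c2 f) (c1 f) (c3 f)"
proof -
  have "arr f \<longleftrightarrow> (\<exists>A \<Gamma> B. f = ctriple A \<Gamma> B \<and> bounded_class_fun \<Gamma> A B)"
    by (simp add: BClass_def)
  then show ?thesis by (metis ctriple_simps(1-3))
qed

lemma arr_class_fun: "arr f \<Longrightarrow> class_fun (c2 f) (c1 f) (c3 f)"
  by (simp only: arr_iff bounded_class_fun_def)

lemma arr_graph: "arr f \<Longrightarrow> opair x y \<in>\<^sub>1 c2 f \<longleftrightarrow> x \<in>\<^sub>1 c1 f \<and> y = apply1 f x"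
proof -
  assume "arr f"
  then have 1: "\<And>p. p \<in>\<^sub>1 c2 f \<Longrightarrow> \<exists>x y. x \<in>\<^sub>1 c1 f \<and> y \<in>\<^sub>1 c3 f \<and> p = opair x y"
    and 2: "\<And>x. x \<in>\<^sub>1 c1 f \<Longrightarrow> \<exists>!y. opair x y \<in>\<^sub>1 c2 f"
    using arr_class_fun unfolding class_fun_def by blast+
  have "x \<in>\<^sub>1 c1 f" if "opair x y \<in>\<^sub>1 c2 f" using 1[OF that] by auto
  moreover have "y = apply1 f x \<longleftrightarrow> opair x y \<in>\<^sub>1 c2 f" if "x \<in>\<^sub>1 c1 f"
    unfolding apply1_def by (rule the_or_undefined_iff[OF 2[OF that]])
  ultimately show ?thesis by blast
qed

lemma arr_graph_mem:
  assumes "arr f" shows "p \<in>\<^sub>1 c2 f \<longleftrightarrow> (\<exists>x. x \<in>\<^sub>1 c1 f \<and> p = opair x (apply1 f x))"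
proof -
  have "p \<in>\<^sub>1 c2 f \<Longrightarrow> \<exists>x y. p = opair x y"
    using arr_class_fun[OF assms] unfolding class_fun_def by blast
  then show ?thesis using arr_graph[OF assms] by metis
qed

lemma arr_apply1:
  assumes "arr f" "x \<in>\<^sub>1 c1 f" shows "apply1 f x \<in>\<^sub>1 c3 f"
proof -
  have "opair x (apply1 f x) \<in>\<^sub>1 c2 f" using arr_graph assms by blast
  then show ?thesis
    using arr_class_fun[OF assms(1)] unfolding class_fun_def by fastforce
qed

lemma arr_ext:
  assumes "arr f" "arr g" "c1 f = c1 g" "c3 f = c3 g"
    and "\<And>x. x \<in>\<^sub>1 c1 f \<Longrightarrow> apply1 f x = apply1 g x"
  shows "f = g"
proof -
  have "c2 f = c2 g"
    by (rule class_ext) (use assms in \<open>auto simp: arr_graph_mem\<close>)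
  moreover have "f = ctriple (c1 f) (c2 f) (c3 f)" "g = ctriple (c1 g) (c2 g) (c3 g)"
    using assms(1,2) by (simp_all only: arr_iff)
  ultimately show ?thesis using assms(3,4) by simp
qed

lemma arr_bounded_on:
  assumes "arr f" shows "bounded_on (c1 f) (apply1 f)"
  unfolding bounded_on_def
proof (intro allI impI)
  fix S assume S: "S \<subseteq>\<^sub>0\<^sub>1 c1 f"
  have "bounded_class_fun (c2 f) (c1 f) (c3 f)"
    using assms by (simp only: arr_iff)
  from this[unfolded bounded_class_fun_def, THEN conjunct2, THEN spec, THEN mp, OF S]
  obtain T G where T: "\<forall>y. y \<in>\<^sub>0 T \<longleftrightarrow> (\<exists>x. x \<in>\<^sub>0 S \<and> opair x y \<in>\<^sub>1 c2 f)"
    and G: "\<forall>p. p \<in>\<^sub>0 G \<longleftrightarrow> p \<in>\<^sub>1 c2 f \<and> (\<exists>x y. x \<in>\<^sub>0 S \<and> y \<in>\<^sub>0 T \<and> p = opair x y)"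
    by (elim exE conjE) (rule that)
  have "p \<in>\<^sub>0 G \<longleftrightarrow> (\<exists>x. x \<in>\<^sub>0 S \<and> p = opair x (apply1 f x))" for p
  proof
    assume "p \<in>\<^sub>0 G"
    then obtain x y where "x \<in>\<^sub>0 S" "p = opair x y" "p \<in>\<^sub>1 c2 f" using G by blast
    then show "\<exists>x. x \<in>\<^sub>0 S \<and> p = opair x (apply1 f x)" using arr_graph[OF assms] by auto
  next
    assume "\<exists>x. x \<in>\<^sub>0 S \<and> p = opair x (apply1 f x)"
    then obtain x where x: "x \<in>\<^sub>0 S" "p = opair x (apply1 f x)" by blast
    then have "p \<in>\<^sub>1 c2 f" using S arr_graph[OF assms] unfolding sub01_def by blast
    with x G T show "p \<in>\<^sub>0 G" by blast
  qed
  then show "\<exists>G. \<forall>p. p \<in>\<^sub>0 G \<longleftrightarrow> (\<exists>x. x \<in>\<^sub>0 S \<and> p = opair x (apply1 f x))" by blast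
qed

lemma bounded_on_apply1:
  assumes "arr f" "bounded_on A \<phi>" "\<And>x. x \<in>\<^sub>1 A \<Longrightarrow> \<phi> x \<in>\<^sub>1 c1 f"
  shows "bounded_on A (\<lambda>x. apply1 f (\<phi> x))"
  using bounded_on_comp[OF assms(2,3) arr_bounded_on[OF assms(1)]] .

text \<open>Gives the graph its existence: class comprehension tolerates no class quantifiers,
  whence \<open>Full False\<close>. Fixed classes inside the function are harmless, because they
  count as parameters.\<close>

lemma arrow_of:
  assumes "definable_set (Full False) (\<lambda>e E. \<phi> (e 0))" "bounded_on A \<phi>"
    and maps: "\<And>x. x \<in>\<^sub>1 A \<Longrightarrow> \<phi> x \<in>\<^sub>1 B"
  shows arr_arrow_of: "arr (arrow_of A \<phi> B)"
    and apply1_arrow_of: "x \<in>\<^sub>1 A \<Longrightarrow> apply1 (arrow_of A \<phi> B) x = \<phi> x"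
proof -
  have \<Gamma>: "p \<in>\<^sub>1 c2 (arrow_of A \<phi> B) \<longleftrightarrow> (\<exists>x. x \<in>\<^sub>1 A \<and> p = opair x (\<phi> x))" for p
    unfolding arrow_of_def ctriple_simps
    by (rule mem_class_or) (intro full_rules assms(1))
  then have op: "opair x y \<in>\<^sub>1 c2 (arrow_of A \<phi> B) \<longleftrightarrow> x \<in>\<^sub>1 A \<and> y = \<phi> x" for x y
    by auto
  show "x \<in>\<^sub>1 A \<Longrightarrow> apply1 (arrow_of A \<phi> B) x = \<phi> x"
    unfolding apply1_def op by (rule the_or_undefined_eq) auto
  have "\<exists>T G. T \<subseteq>\<^sub>0\<^sub>1 B \<and>
     (\<forall>y. y \<in>\<^sub>0 T \<longleftrightarrow> (\<exists>x. x \<in>\<^sub>0 S \<and> opair x y \<in>\<^sub>1 c2 (arrow_of A \<phi> B))) \<and>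
     (\<forall>p. p \<in>\<^sub>0 G \<longleftrightarrow> p \<in>\<^sub>1 c2 (arrow_of A \<phi> B) \<and> (\<exists>x y. x \<in>\<^sub>0 S \<and> y \<in>\<^sub>0 T \<and> p = opair x y))"
    if S: "S \<subseteq>\<^sub>0\<^sub>1 A" for S
  proof -
    obtain G where G: "\<And>p. p \<in>\<^sub>0 G \<longleftrightarrow> (\<exists>x. x \<in>\<^sub>0 S \<and> p = opair x (\<phi> x))"
      using assms(2) S unfolding bounded_on_def by blast
    obtain T where T: "\<forall>y. y \<in>\<^sub>0 T \<longleftrightarrow> (\<exists>x. x \<in>\<^sub>0 S \<and> y = \<phi> x)"
      using bounded_on_graph[OF assms(2) S] by (elim exE conjE) (rule that)
    show ?thesis
    proof (intro exI conjI allI)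
      show "T \<subseteq>\<^sub>0\<^sub>1 B" using T S maps unfolding sub01_def by metis
      fix y show "y \<in>\<^sub>0 T \<longleftrightarrow> (\<exists>x. x \<in>\<^sub>0 S \<and> opair x y \<in>\<^sub>1 c2 (arrow_of A \<phi> B))"
        using T S unfolding op sub01_def by blast
    next
      fix p show "p \<in>\<^sub>0 G \<longleftrightarrow> p \<in>\<^sub>1 c2 (arrow_of A \<phi> B) \<and> (\<exists>x y. x \<in>\<^sub>0 S \<and> y \<in>\<^sub>0 T \<and> p = opair x y)"
        unfolding \<Gamma> G using S T unfolding sub01_def by auto
    qed
  qed
  moreover have "class_fun (c2 (arrow_of A \<phi> B)) A B"
    unfolding class_fun_def op unfolding \<Gamma> using maps by blast
  ultimately have "bounded_class_fun (c2 (arrow_of A \<phi> B)) A B"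
    unfolding bounded_class_fun_def by blast
  then show "arr (arrow_of A \<phi> B)"
    unfolding arr_iff by (simp add: arrow_of_def)
qed

lemma BClass_simps [simp]: "Ob BClass A" "Dom BClass = c1" "Cod BClass = c3"
  by (simp_all add: BClass_def)

lemma Ident_BClass: "Ident BClass A = arrow_of A (\<lambda>x. x) A"
  unfolding BClass_def arrow_of_def
  by (auto intro!: class_of_eq mem_class_or full_rules)

text \<open>Brings composition into the form \<open>arrow_of\<close>, where the intermediate point
  is a term and no longer quantified.\<close>

lemma Comp_BClass:
  assumes "arr f" "arr g" "c3 f = c1 g"
  shows "Comp BClass g f = arrow_of (c1 f) (\<lambda>x. apply1 g (apply1 f x)) (c3 g)"
proof -
  have "class_of (\<lambda>p. \<exists>x y z. opair x y \<in>\<^sub>1 c2 f \<and> opair y z \<in>\<^sub>1 c2 g \<and> p = opair x z) =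
    class_or (\<lambda>p. \<exists>x. x \<in>\<^sub>1 c1 f \<and> p = opair x (apply1 g (apply1 f x)))"
  proof (rule class_of_eq)
    fix p
    have "p \<in>\<^sub>1 class_or (\<lambda>p. \<exists>x. x \<in>\<^sub>1 c1 f \<and> p = opair x (apply1 g (apply1 f x))) \<longleftrightarrow>
      (\<exists>x. x \<in>\<^sub>1 c1 f \<and> p = opair x (apply1 g (apply1 f x)))"
      by (rule mem_class_or) (intro full_rules)
    then show "p \<in>\<^sub>1 class_or (\<lambda>p. \<exists>x. x \<in>\<^sub>1 c1 f \<and> p = opair x (apply1 g (apply1 f x))) \<longleftrightarrow>
      (\<exists>x y z. opair x y \<in>\<^sub>1 c2 f \<and> opair y z \<in>\<^sub>1 c2 g \<and> p = opair x z)"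
      using arr_apply1[OF assms(1)] assms by (auto simp: arr_graph)
  qed
  then show ?thesis by (simp add: BClass_def arrow_of_def)
qed

lemma Ident_arr: "arr (Ident BClass A)" "x \<in>\<^sub>1 A \<Longrightarrow> apply1 (Ident BClass A) x = x"
  "c1 (Ident BClass A) = A" "c3 (Ident BClass A) = A"
  unfolding Ident_BClass
  by (auto intro!: arr_arrow_of apply1_arrow_of full_rules bounded_on_id)

lemma Comp_arr:
  assumes "arr f" "arr g" "c3 f = c1 g"
  shows "arr (Comp BClass g f)" "x \<in>\<^sub>1 c1 f \<Longrightarrow> apply1 (Comp BClass g f) x = apply1 g (apply1 f x)"
    "c1 (Comp BClass g f) = c1 f" "c3 (Comp BClass g f) = c3 g"
proof -
  have *: "bounded_on (c1 f) (\<lambda>x. apply1 g (apply1 f x))"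
    "definable_set (Full False) (\<lambda>e E. apply1 g (apply1 f (e 0)))"
    "\<And>x. x \<in>\<^sub>1 c1 f \<Longrightarrow> apply1 g (apply1 f x) \<in>\<^sub>1 c3 g"
    using arr_apply1[OF assms(1)] arr_apply1[OF assms(2)] assms
    by (auto intro!: bounded_on_apply1 full_rules arr_bounded_on)
  show "arr (Comp BClass g f)" "x \<in>\<^sub>1 c1 f \<Longrightarrow> apply1 (Comp BClass g f) x = apply1 g (apply1 f x)"
    "c1 (Comp BClass g f) = c1 f" "c3 (Comp BClass g f) = c3 g"
    unfolding Comp_BClass[OF assms]
    by (auto intro!: arr_arrow_of apply1_arrow_of *)
qed

text \<open>Boundedness speaks of classes but quantifies only over sets, so it is available for
  every \<open>Full b\<close>. The iterated weakenings supply the three classes at the different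
  depths of quantifier nesting.\<close>

lemma definable_bounded_class_fun:
  assumes "definable_class (Full b) T" "definable_class (Full b) U" "definable_class (Full b) V"
  shows "definable (Full b) (\<lambda>e E. bounded_class_fun (T e E) (U e E) (V e E))"
  unfolding bounded_class_fun_def class_fun_def sub01_def
  by (intro full_rules assms assms[THEN definable_class_weaken]
      assms[THEN definable_class_weaken, THEN definable_class_weaken]
      assms[THEN definable_class_weaken, THEN definable_class_weaken, THEN definable_class_weaken]
      assms[THEN definable_class_weaken, THEN definable_class_weaken, THEN definable_class_weaken,
        THEN definable_class_weaken]
      assms[THEN definable_class_weaken, THEN definable_class_weaken, THEN definable_class_weaken,
        THEN definable_class_weaken, THEN definable_class_weaken]
      assms[THEN definable_class_weaken, THEN definable_class_weaken, THEN definable_class_weaken,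
        THEN definable_class_weaken, THEN definable_class_weaken, THEN definable_class_weaken])

lemma definable_arr:
  assumes "definable_class (Full b) T" shows "definable (Full b) (\<lambda>e E. arr (T e E))"
  unfolding arr_iff by (intro full_rules definable_bounded_class_fun assms)

section \<open>Slice categories\<close>

abbreviation over :: "'c \<Rightarrow> 'c category" where "over A \<equiv> slice BClass A"

definition over_arrow :: "'c \<Rightarrow> ('s \<Rightarrow> 's) \<Rightarrow> 'c \<Rightarrow> 'c" where
  "over_arrow g \<phi> g' = ctriple g (arrow_of (c1 g) \<phi> (c1 g')) g'"

lemma over_simps [simp]:
  "Ob (over A) g \<longleftrightarrow> arr g \<and> c3 g = A" "Dom (over A) = c1" "Cod (over A) = c3"
  by (simp_all add: slice_def)

lemma Hom_over: "Hom (over A) g g' t \<longleftrightarrow> arr g \<and> c3 g = A \<and> arr g' \<and> c3 g' = A \<and>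
   t = ctriple g (c2 t) g' \<and> arr (c2 t) \<and> c1 (c2 t) = c1 g \<and> c3 (c2 t) = c1 g' \<and>
   (\<forall>x. x \<in>\<^sub>1 c1 g \<longrightarrow> apply1 g' (apply1 (c2 t) x) = apply1 g x)"
proof -
  have comp: "Comp BClass g' h = g \<longleftrightarrow> (\<forall>x. x \<in>\<^sub>1 c1 g \<longrightarrow> apply1 g' (apply1 h x) = apply1 g x)"
    if "arr g" "arr g'" "arr h" "c3 g = A" "c3 g' = A" "c1 h = c1 g" "c3 h = c1 g'" for h
    using that by (auto intro!: arr_ext[of _ g] simp: Comp_arr)
  have "Hom (over A) g g' t \<longleftrightarrow> (\<exists>h. t = ctriple g h g' \<and> arr g \<and> c3 g = A \<and> arr g' \<and> c3 g' = A \<and>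
     arr h \<and> c1 h = c1 g \<and> c3 h = c1 g' \<and> Comp BClass g' h = g)"
    unfolding Hom_def slice_def by auto
  \<comment> \<open>\<open>comp\<close> is valid only for arrows with matching ends;
    \<open>conj_cong\<close> lets the simplifier take those facts from the earlier
    conjuncts.\<close>
  also have "\<dots> \<longleftrightarrow> (\<exists>h. t = ctriple g h g' \<and> arr g \<and> c3 g = A \<and> arr g' \<and> c3 g' = A \<and>
     arr h \<and> c1 h = c1 g \<and> c3 h = c1 g' \<and>
     (\<forall>x. x \<in>\<^sub>1 c1 g \<longrightarrow> apply1 g' (apply1 h x) = apply1 g x))"
    by (rule ex_cong1) (simp only: comp cong: conj_cong)
  finally show ?thesis by (metis ctriple_simps(2))
qed

lemma Ar_over: "Ar (over A) t \<longleftrightarrow> Hom (over A) (c1 t) (c3 t) t"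
  by (simp add: Hom_def)

lemma Hom_overD:
  assumes "Hom (over A) g g' t"
  shows "c1 t = g" "c3 t = g'" "arr g" "arr g'" "c3 g = A" "c3 g' = A"
    "arr (c2 t)" "c1 (c2 t) = c1 g" "c3 (c2 t) = c1 g'"
    "x \<in>\<^sub>1 c1 g \<Longrightarrow> apply1 (c2 t) x \<in>\<^sub>1 c1 g'"
    "x \<in>\<^sub>1 c1 g \<Longrightarrow> apply1 g' (apply1 (c2 t) x) = apply1 g x"
proof -
  note t = assms[unfolded Hom_over]
  have "t = ctriple g (c2 t) g'" using t by blast
  then show "c1 t = g" "c3 t = g'" by (metis ctriple_simps(1), metis ctriple_simps(3))
  show "arr g" "arr g'" "c3 g = A" "c3 g' = A" and h: "arr (c2 t)" "c1 (c2 t) = c1 g" "c3 (c2 t) = c1 g'"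
    using t by blast+
  show "x \<in>\<^sub>1 c1 g \<Longrightarrow> apply1 g' (apply1 (c2 t) x) = apply1 g x" using t by blast
  show "x \<in>\<^sub>1 c1 g \<Longrightarrow> apply1 (c2 t) x \<in>\<^sub>1 c1 g'" using arr_apply1[OF h(1), of x] h(2,3) by simp
qed

lemma Hom_over_ext:
  assumes "Hom (over A) g g' t" "Hom (over A) g g' u"
    and "\<And>x. x \<in>\<^sub>1 c1 g \<Longrightarrow> apply1 (c2 t) x = apply1 (c2 u) x"
  shows "t = u"
proof -
  have "c2 t = c2 u"
    by (rule arr_ext)
      (simp_all only: Hom_overD(7-9)[OF assms(1)] Hom_overD(7-9)[OF assms(2)] assms(3))
  moreover have "t = ctriple g (c2 t) g'" "u = ctriple g (c2 u) g'"
    using assms(1,2) unfolding Hom_over by blast+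
  ultimately show ?thesis by metis
qed

lemma Hom_over_ident: "arr g \<Longrightarrow> c3 g = A \<Longrightarrow> Hom (over A) g g (Ident (over A) g)"
  and apply_ident: "x \<in>\<^sub>1 c1 g \<Longrightarrow> apply1 (c2 (Ident (over A) g)) x = x"
proof -
  have id: "Ident (over A) g = ctriple g (Ident BClass (c1 g)) g" by (simp add: slice_def)
  show "arr g \<Longrightarrow> c3 g = A \<Longrightarrow> Hom (over A) g g (Ident (over A) g)"
    unfolding Hom_over id by (simp add: Ident_arr)
  show "x \<in>\<^sub>1 c1 g \<Longrightarrow> apply1 (c2 (Ident (over A) g)) x = x"
    unfolding id by (simp add: Ident_arr)
qed

lemma comp_over:
  assumes t: "Hom (over A) g g' t" and u: "Hom (over A) g' g'' u"
  shows Hom_over_comp: "Hom (over A) g g'' (Comp (over A) u t)"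
    and apply_comp: "x \<in>\<^sub>1 c1 g \<Longrightarrow> apply1 (c2 (Comp (over A) u t)) x = apply1 (c2 u) (apply1 (c2 t) x)"
proof -
  have comp: "Comp (over A) u t = ctriple g (Comp BClass (c2 u) (c2 t)) g''"
    using Hom_overD(1-9)[OF t] Hom_overD(1-9)[OF u] by (simp add: slice_def)
  have *: "arr (c2 t)" "arr (c2 u)" "c3 (c2 t) = c1 (c2 u)"
    using Hom_overD(1-9)[OF t] Hom_overD(1-9)[OF u] by simp_all
  show "Hom (over A) g g'' (Comp (over A) u t)"
    unfolding Hom_over comp
    by (simp add: Comp_arr[OF *] Hom_overD[OF t] Hom_overD[OF u])
  show "x \<in>\<^sub>1 c1 g \<Longrightarrow> apply1 (c2 (Comp (over A) u t)) x = apply1 (c2 u) (apply1 (c2 t) x)"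
    unfolding comp by (simp add: Comp_arr[OF *] Hom_overD(8)[OF t])
qed

lemma is_category_over: "is_category (over A)"
  unfolding is_category_def
proof (intro conjI allI impI; (elim conjE)?)
  fix f assume "Ar (over A) f"
  then show "Ob (over A) (Dom (over A) f)" "Ob (over A) (Cod (over A) f)"
    unfolding Ar_over by (simp_all add: Hom_overD(3-6))
next
  fix x assume "Ob (over A) x"
  then show "Hom (over A) x x (Ident (over A) x)" by (simp add: Hom_over_ident)
next
  fix x y z f g assume "Hom (over A) x y f" "Hom (over A) y z g"
  then show "Hom (over A) x z (Comp (over A) g f)" by (rule Hom_over_comp)
next
  fix x y f assume f: "Hom (over A) x y f"
  note x = Hom_over_ident[OF Hom_overD(3,5)[OF f]] and y = Hom_over_ident[OF Hom_overD(4,6)[OF f]]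
  show "Comp (over A) f (Ident (over A) x) = f"
    by (rule Hom_over_ext[OF Hom_over_comp[OF x f] f]) (simp add: apply_comp[OF x f] apply_ident)
  show "Comp (over A) (Ident (over A) y) f = f"
    by (rule Hom_over_ext[OF Hom_over_comp[OF f y] f])
      (simp add: apply_comp[OF f y] apply_ident Hom_overD(10)[OF f])
next
  fix w x y z f g h
  assume f: "Hom (over A) w x f" and g: "Hom (over A) x y g" and h: "Hom (over A) y z h"
  note fg = Hom_over_comp[OF f g] and gh = Hom_over_comp[OF g h]
  show "Comp (over A) h (Comp (over A) g f) = Comp (over A) (Comp (over A) h g) f"
    by (rule Hom_over_ext[OF Hom_over_comp[OF fg h] Hom_over_comp[OF f gh]])
      (simp add: apply_comp[OF fg h] apply_comp[OF f gh] apply_comp[OF f g] apply_comp[OF g h]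
        Hom_overD(10)[OF f])
qed

lemma over_arrow:
  assumes "arr g" "c3 g = A" "arr g'" "c3 g' = A"
    and "definable_set (Full False) (\<lambda>e E. \<phi> (e 0))" "bounded_on (c1 g) \<phi>"
    and maps: "\<And>x. x \<in>\<^sub>1 c1 g \<Longrightarrow> \<phi> x \<in>\<^sub>1 c1 g'"
    and "\<And>x. x \<in>\<^sub>1 c1 g \<Longrightarrow> apply1 g' (\<phi> x) = apply1 g x"
  shows Hom_over_arrow: "Hom (over A) g g' (over_arrow g \<phi> g')"
    and apply_over_arrow: "x \<in>\<^sub>1 c1 g \<Longrightarrow> apply1 (c2 (over_arrow g \<phi> g')) x = \<phi> x"
proof -
  note * = arrow_of[where A = "c1 g" and B = "c1 g'", OF assms(5,6) maps]
  show "x \<in>\<^sub>1 c1 g \<Longrightarrow> apply1 (c2 (over_arrow g \<phi> g')) x = \<phi> x"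
    by (simp add: over_arrow_def *)
  show "Hom (over A) g g' (over_arrow g \<phi> g')"
    unfolding Hom_over by (simp add: over_arrow_def * assms)
qed

lemma definable_Hom_over:
  assumes "definable_class (Full b) T" "definable_class (Full b) U" "definable_class (Full b) V"
  shows "definable (Full b) (\<lambda>e E. Hom (over A) (T e E) (U e E) (V e E))"
  unfolding Hom_over
  by (intro full_rules definable_arr assms assms[THEN definable_class_weaken])

section \<open>Functors and adjunctions given by definable maps\<close>

lemma definable_class_reindex:
  assumes "definable_class K (\<lambda>e E. T E)" "inj f"
  shows "definable_class K (\<lambda>e E. T (\<lambda>i. E (f i)))"
  using definable_reindex[OF assms(1)[unfolded definable_class_def] inj_on_id assms(2)]
  unfolding definable_class_def by (simp only: id_apply)

lemma coll_fun_coll_of: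
  assumes P: "definable (Full True) (\<lambda>e E. P (E 0))"
    and T: "definable_class (Full True) (\<lambda>e E. T (E 0))"
    and maps: "\<And>X. P X \<Longrightarrow> Q (T X)"
  shows "coll_fun (coll_of (\<lambda>Z. \<exists>X. P X \<and> Z = cpair X (T X))) P Q"
    and "P X \<Longrightarrow> app2 (coll_of (\<lambda>Z. \<exists>X. P X \<and> Z = cpair X (T X))) X = T X"
proof -
  have mem: "Z \<in>\<^sub>2 coll_of (\<lambda>Z. \<exists>X. P X \<and> Z = cpair X (T X)) \<longleftrightarrow> (\<exists>X. P X \<and> Z = cpair X (T X))" for Z
    by (rule mem_coll_of) (intro full_rules P T)
  show "coll_fun (coll_of (\<lambda>Z. \<exists>X. P X \<and> Z = cpair X (T X))) P Q"
    unfolding coll_fun_def mem using maps by auto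
  show "P X \<Longrightarrow> app2 (coll_of (\<lambda>Z. \<exists>X. P X \<and> Z = cpair X (T X))) X = T X"
    unfolding app2_def mem by auto
qed

text \<open>Follows the shape of \<open>pullback_functor\<close>, which becomes an instance. The
  guards make the behaviour of \<open>Lo\<close> and \<open>La\<close> away from objects and arrows
  irrelevant.\<close>

definition functor_of :: "'c \<Rightarrow> ('c \<Rightarrow> 'c) \<Rightarrow> ('c \<Rightarrow> 'c) \<Rightarrow> 'k \<times> 'k" where
  "functor_of A Lo La =
     (coll_of (\<lambda>Z. \<exists>g. Ob (over A) g \<and> Z = cpair g (Lo g)),
      coll_of (\<lambda>Z. \<exists>t. Ar (over A) t \<and> Z = cpair t (La t)))"

lemma definable_Ob_over: "definable (Full True) (\<lambda>e E. Ob (over A) (E 0))"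
  unfolding over_simps by (intro full_rules definable_arr)

lemma definable_Ar_over: "definable (Full True) (\<lambda>e E. Ar (over A) (E 0))"
  unfolding Ar_over by (intro full_rules definable_Hom_over)

lemma functor_of:
  assumes Lo: "definable_class (Full True) (\<lambda>e E. Lo (E 0))"
    and La: "definable_class (Full True) (\<lambda>e E. La (E 0))"
    and ob: "\<And>g. Ob (over A) g \<Longrightarrow> Ob (over B) (Lo g)"
    and ar: "\<And>g g' t. Hom (over A) g g' t \<Longrightarrow> Hom (over B) (Lo g) (Lo g') (La t)"
    and ident: "\<And>g. Ob (over A) g \<Longrightarrow> La (Ident (over A) g) = Ident (over B) (Lo g)"
    and comp: "\<And>g g' g'' t u. Hom (over A) g g' t \<Longrightarrow> Hom (over A) g' g'' u \<Longrightarrow>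
      La (Comp (over A) u t) = Comp (over B) (La u) (La t)"
  shows is_functor_functor_of: "is_functor (over A) (over B) (functor_of A Lo La)"
    and on_ob_functor_of: "Ob (over A) g \<Longrightarrow> on_ob (functor_of A Lo La) g = Lo g"
    and on_ar_functor_of: "Hom (over A) g g' t \<Longrightarrow> on_ar (functor_of A Lo La) t = La t"
proof -
  have ar': "Ar (over B) (La t)" if "Ar (over A) t" for t
    using ar[OF that[unfolded Ar_over]] by (simp add: Hom_def)
  show on_ob: "Ob (over A) g \<Longrightarrow> on_ob (functor_of A Lo La) g = Lo g" for g
    unfolding functor_of_def fst_conv by (rule coll_fun_coll_of(2)[where P = "Ob (over A)" and T = Lo and Q = "Ob (over B)", OF definable_Ob_over Lo ob])
  have "Ar (over A) t \<Longrightarrow> on_ar (functor_of A Lo La) t = La t" for t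
    unfolding functor_of_def snd_conv by (rule coll_fun_coll_of(2)[where P = "Ar (over A)" and T = La and Q = "Ar (over B)", OF definable_Ar_over La ar'])
  then show on_ar: "Hom (over A) g g' t \<Longrightarrow> on_ar (functor_of A Lo La) t = La t" for g g' t
    by (simp add: Hom_def)
  show "is_functor (over A) (over B) (functor_of A Lo La)"
    unfolding is_functor_def
  proof (intro conjI allI impI; (elim conjE)?)
    show "coll_fun (fst (functor_of A Lo La)) (Ob (over A)) (Ob (over B))"
      unfolding functor_of_def fst_conv by (rule coll_fun_coll_of(1)[where P = "Ob (over A)" and T = Lo and Q = "Ob (over B)", OF definable_Ob_over Lo ob])
    show "coll_fun (snd (functor_of A Lo La)) (Ar (over A)) (Ar (over B))"
      unfolding functor_of_def snd_conv by (rule coll_fun_coll_of(1)[where P = "Ar (over A)" and T = La and Q = "Ar (over B)", OF definable_Ar_over La ar'])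
  next
    fix x y f assume f: "Hom (over A) x y f"
    then have "Ob (over A) x" "Ob (over A) y" by (simp_all add: Hom_overD(3-6))
    with f show "Hom (over B) (on_ob (functor_of A Lo La) x) (on_ob (functor_of A Lo La) y)
        (on_ar (functor_of A Lo La) f)"
      by (simp only: on_ob on_ar ar)
  next
    fix x assume x: "Ob (over A) x"
    then have "Hom (over A) x x (Ident (over A) x)" by (simp add: Hom_over_ident)
    with x show "on_ar (functor_of A Lo La) (Ident (over A) x)
        = Ident (over B) (on_ob (functor_of A Lo La) x)"
      by (simp only: on_ob on_ar ident)
  next
    fix x y z f g assume f: "Hom (over A) x y f" and g: "Hom (over A) y z g"
    show "on_ar (functor_of A Lo La) (Comp (over A) g f)
        = Comp (over B) (on_ar (functor_of A Lo La) g) (on_ar (functor_of A Lo La) f)"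
      unfolding on_ar[OF f] on_ar[OF g] on_ar[OF Hom_over_comp[OF f g]] by (rule comp[OF f g])
  qed (rule is_category_over)+
qed

text \<open>The collection of bijections is the graph of the transposition \<open>tr\<close> alone.
  Therefore only \<open>tr\<close> has to be definable and natural; its inverse \<open>rt\<close>
  merely witnesses bijectivity. In the premise on \<open>tr\<close>, positions 2, 1 and 0 hold
  \<open>x\<close>, \<open>y\<close> and \<open>f\<close>, the order in which \<open>P\<close> below
  quantifies them.\<close>

lemma left_adjointI:
  assumes L: "is_functor (over A) (over B) L"
    and on_L: "\<And>x. Ob (over A) x \<Longrightarrow> on_ob L x = Lo x"
      "\<And>x x' a. Hom (over A) x x' a \<Longrightarrow> on_ar L a = La a"
    and R: "is_functor (over B) (over A) R"
    and on_R: "\<And>y. Ob (over B) y \<Longrightarrow> on_ob R y = Ro y"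
      "\<And>y y' b. Hom (over B) y y' b \<Longrightarrow> on_ar R b = Ra b"
    and Lo: "definable_class (Full True) (\<lambda>e E. Lo (E 0))"
    and tr: "definable_class (Full True) (\<lambda>e E. tr (E (Suc (Suc 0))) (E (Suc 0)) (E 0))"
    and Hom_tr: "\<And>x y f. Ob (over A) x \<Longrightarrow> Ob (over B) y \<Longrightarrow> Hom (over B) (Lo x) y f
      \<Longrightarrow> Hom (over A) x (Ro y) (tr x y f)"
    and Hom_rt: "\<And>x y g. Ob (over A) x \<Longrightarrow> Ob (over B) y \<Longrightarrow> Hom (over A) x (Ro y) g
      \<Longrightarrow> Hom (over B) (Lo x) y (rt x y g)"
    and rt_tr: "\<And>x y f. Ob (over A) x \<Longrightarrow> Ob (over B) y \<Longrightarrow> Hom (over B) (Lo x) y f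
      \<Longrightarrow> rt x y (tr x y f) = f"
    and tr_rt: "\<And>x y g. Ob (over A) x \<Longrightarrow> Ob (over B) y \<Longrightarrow> Hom (over A) x (Ro y) g
      \<Longrightarrow> tr x y (rt x y g) = g"
    and natural: "\<And>x x' y y' a b f. Hom (over A) x' x a \<Longrightarrow> Hom (over B) y y' b \<Longrightarrow>
      Hom (over B) (Lo x) y f \<Longrightarrow>
      tr x' y' (Comp (over B) b (Comp (over B) f (La a))) = Comp (over A) (Ra b) (Comp (over A) (tr x y f) a)"
  shows "left_adjoint (over A) (over B) L R"
proof -
  define P where "P Z \<longleftrightarrow> (\<exists>x y f. Ob (over A) x \<and> Ob (over B) y \<and> Hom (over B) (Lo x) y f \<and>
    Z = ctriple x y (cpair f (tr x y f)))" for Z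
  \<comment> \<open>\<open>P\<close> quantifies over the classes \<open>x\<close>, \<open>y\<close>
    and \<open>f\<close>, which collection comprehension permits. The reindexing moves
    \<open>Lo\<close> past \<open>y\<close> and \<open>f\<close> to reach \<open>x\<close>.\<close>
  have "definable (Full True) (\<lambda>e E. P (E 0))"
    unfolding P_def over_simps
    by (intro full_rules definable_arr definable_Hom_over tr
        definable_class_reindex[where T = "\<lambda>E. Lo (E 0)" and f = "\<lambda>i. Suc (Suc i)", OF Lo])
      (simp add: inj_def)
  from coll_exists[OF this] obtain \<Phi> where \<Phi>: "\<And>Z. Z \<in>\<^sub>2 \<Phi> \<longleftrightarrow> P Z" by blast
  have mem: "ctriple x y (cpair f g) \<in>\<^sub>2 \<Phi> \<longleftrightarrow>
      Ob (over A) x \<and> Ob (over B) y \<and> Hom (over B) (Lo x) y f \<and> g = tr x y f" for x y f g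
    unfolding \<Phi> P_def by auto
  show ?thesis
    unfolding left_adjoint_def
  proof (intro conjI exI[of _ \<Phi>] allI impI; (elim conjE)?)
    fix Z assume "Z \<in>\<^sub>2 \<Phi>"
    then obtain x y f where "Ob (over A) x" "Ob (over B) y" "Hom (over B) (Lo x) y f"
      "Z = ctriple x y (cpair f (tr x y f))" unfolding \<Phi> P_def by blast
    then show "\<exists>x y f g. Z = ctriple x y (cpair f g) \<and> Ob (over A) x \<and> Ob (over B) y \<and>
        Hom (over B) (on_ob L x) y f \<and> Hom (over A) x (on_ob R y) g"
      using Hom_tr on_L(1) on_R(1) by metis
  next
    fix x y f assume "Ob (over A) x" "Ob (over B) y" "Hom (over B) (on_ob L x) y f"
    then show "\<exists>!g. ctriple x y (cpair f g) \<in>\<^sub>2 \<Phi>"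
      unfolding mem by (simp only: on_L(1)) blast
  next
    fix x y g assume x: "Ob (over A) x" and y: "Ob (over B) y" and g: "Hom (over A) x (on_ob R y) g"
    from g have g: "Hom (over A) x (Ro y) g" by (simp only: on_R(1)[OF y])
    show "\<exists>!f. ctriple x y (cpair f g) \<in>\<^sub>2 \<Phi>"
      unfolding mem
    proof (rule ex1I[of _ "rt x y g"])
      show "Ob (over A) x \<and> Ob (over B) y \<and> Hom (over B) (Lo x) y (rt x y g) \<and> g = tr x y (rt x y g)"
        using x y Hom_rt[OF x y g] tr_rt[OF x y g] by metis
    next
      fix f assume "Ob (over A) x \<and> Ob (over B) y \<and> Hom (over B) (Lo x) y f \<and> g = tr x y f"
      then show "f = rt x y g" using rt_tr by metis
    qed
  next
    fix x x' y y' a b f g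
    assume a: "Hom (over A) x' x a" and b: "Hom (over B) y y' b"
      and fg: "ctriple x y (cpair f g) \<in>\<^sub>2 \<Phi>"
    from fg have f: "Hom (over B) (Lo x) y f" and g: "g = tr x y f" unfolding mem by blast+
    have obs: "Ob (over A) x'" "Ob (over B) y'" "Ob (over A) x"
      by (simp_all add: Hom_overD(3-6)[OF a] Hom_overD(3-6)[OF b])
    have "Hom (over B) (Lo x') (Lo x) (La a)"
      using L a unfolding is_functor_def by (metis on_L obs(1,3))
    from Hom_over_comp[OF Hom_over_comp[OF this f] b]
    show "ctriple x' y' (cpair (Comp (over B) b (Comp (over B) f (on_ar L a)))
        (Comp (over A) (on_ar R b) (Comp (over A) g a))) \<in>\<^sub>2 \<Phi>"
      unfolding mem on_L(2)[OF a] on_R(2)[OF b] g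
      using natural[OF a b f] obs by metis
  qed (rule L R)+
qed

section \<open>The adjoints of pullback\<close>

lemma mem_fibre_product: "p \<in>\<^sub>1 fibre_product F g \<longleftrightarrow> (\<exists>b c a. p = opair b c \<and>
     b \<in>\<^sub>1 c1 F \<and> c \<in>\<^sub>1 c1 g \<and> opair b a \<in>\<^sub>1 c2 F \<and> opair c a \<in>\<^sub>1 c2 g)"
  unfolding fibre_product_def by (rule mem_class_of) (intro full_rules)

lemma opair_mem_fibre_product:
  assumes "arr F" "arr g"
  shows "opair b c \<in>\<^sub>1 fibre_product F g \<longleftrightarrow> b \<in>\<^sub>1 c1 F \<and> c \<in>\<^sub>1 c1 g \<and> apply1 F b = apply1 g c"
  unfolding mem_fibre_product arr_graph[OF assms(1)] arr_graph[OF assms(2)] by auto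

lemma fibre_productE:
  assumes "p \<in>\<^sub>1 fibre_product F g" "arr F" "arr g"
  obtains b c where "p = opair b c" "b \<in>\<^sub>1 c1 F" "c \<in>\<^sub>1 c1 g" "apply1 F b = apply1 g c"
proof -
  obtain b c where p: "p = opair b c" using assms(1) unfolding mem_fibre_product by blast
  then show ?thesis using that assms opair_mem_fibre_product[OF assms(2,3)] by blast
qed

lemma definable_class_fibre_product:
  assumes "definable_class (Full b) T"
  shows "definable_class (Full b) (\<lambda>e E. fibre_product F (T e E))"
proof -
  note w1 = definable_class_weaken[OF assms]
  note w2 = definable_class_weaken[OF w1]
  note w3 = definable_class_weaken[OF w2]
  note w4 = definable_class_weaken[OF w3]
  show ?thesis
    unfolding definable_class_def mem_fibre_product
    by (intro full_rules w4)
qed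

text \<open>In terms of \<open>arrow_of\<close> the projection falls under the general results on
  arrows and on definability.\<close>

lemma pullback_ob_eq: "pullback_ob F g = arrow_of (fibre_product F g) fst0 (c1 F)"
proof -
  have "class_of (\<lambda>p. \<exists>b c. opair b c \<in>\<^sub>1 fibre_product F g \<and> p = opair (opair b c) b) =
    class_or (\<lambda>p. \<exists>x. x \<in>\<^sub>1 fibre_product F g \<and> p = opair x (fst0 x))"
  proof (rule class_of_eq)
    fix p
    have "p \<in>\<^sub>1 class_or (\<lambda>p. \<exists>x. x \<in>\<^sub>1 fibre_product F g \<and> p = opair x (fst0 x)) \<longleftrightarrow>
      (\<exists>x. x \<in>\<^sub>1 fibre_product F g \<and> p = opair x (fst0 x))"
      by (rule mem_class_or) (intro full_rules)
    also have "\<dots> \<longleftrightarrow> (\<exists>b c. opair b c \<in>\<^sub>1 fibre_product F g \<and> p = opair (opair b c) b)"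
      unfolding mem_fibre_product by force
    finally show "p \<in>\<^sub>1 class_or (\<lambda>p. \<exists>x. x \<in>\<^sub>1 fibre_product F g \<and> p = opair x (fst0 x)) \<longleftrightarrow>
      (\<exists>b c. opair b c \<in>\<^sub>1 fibre_product F g \<and> p = opair (opair b c) b)" .
  qed
  then show ?thesis by (simp add: pullback_ob_def arrow_of_def)
qed

lemma pullback_ob_simps [simp]: "c1 (pullback_ob F g) = fibre_product F g" "c3 (pullback_ob F g) = c1 F"
  by (simp_all add: pullback_ob_eq)

lemma bounded_on_fst0_id:
  "(\<And>p. p \<in>\<^sub>1 X \<Longrightarrow> \<exists>u v. p = opair u v) \<Longrightarrow> bounded_on X fst0"
  by (rule bounded_on_fst0[OF bounded_on_id])

lemma bounded_on_snd0_id: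
  "(\<And>p. p \<in>\<^sub>1 X \<Longrightarrow> \<exists>u v. p = opair u v) \<Longrightarrow> bounded_on X snd0"
  by (rule bounded_on_snd0[OF bounded_on_id])

lemma fibre_product_pairs: "p \<in>\<^sub>1 fibre_product F g \<Longrightarrow> \<exists>u v. p = opair u v"
  unfolding mem_fibre_product by blast

lemma
  shows arr_pullback_ob: "arr (pullback_ob F g)"
    and apply_pullback_ob: "p \<in>\<^sub>1 fibre_product F g \<Longrightarrow> apply1 (pullback_ob F g) p = fst0 p"
proof -
  have *: "definable_set (Full False) (\<lambda>e E. fst0 (e 0))" by (intro full_rules)
  have **: "bounded_on (fibre_product F g) fst0"
    by (intro bounded_on_fst0_id fibre_product_pairs)
  have ***: "p \<in>\<^sub>1 fibre_product F g \<Longrightarrow> fst0 p \<in>\<^sub>1 c1 F" for p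
    unfolding mem_fibre_product by auto
  show "arr (pullback_ob F g)"
    and "p \<in>\<^sub>1 fibre_product F g \<Longrightarrow> apply1 (pullback_ob F g) p = fst0 p"
    unfolding pullback_ob_eq using arrow_of[OF * ** ***] by simp_all
qed

definition pullback_map :: "'c \<Rightarrow> 'c \<Rightarrow> 'c" where
  "pullback_map F t = over_arrow (pullback_ob F (c1 t))
     (\<lambda>p. opair (fst0 p) (apply1 (c2 t) (snd0 p))) (pullback_ob F (c3 t))"

text \<open>The assumption that \<open>t\<close> is an arrow makes the graph of \<open>c2 t\<close>
  expressible by \<open>apply1\<close>. It costs nothing later, since
  \<open>pullback_functor\<close> admits only arrows to its graph.\<close>

lemma pullback_ar_eq:
  assumes t: "Hom (over A) g g' t"
  shows "pullback_ar F t = pullback_map F t"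
proof -
  have h: "arr (c2 t)" "c1 (c2 t) = c1 (c1 t)" using Hom_overD(1-9)[OF t] by simp_all
  have "class_of (\<lambda>p. \<exists>b c c'. opair b c \<in>\<^sub>1 fibre_product F (c1 t) \<and>
      opair c c' \<in>\<^sub>1 c2 (c2 t) \<and> p = opair (opair b c) (opair b c')) =
    class_or (\<lambda>p. \<exists>x. x \<in>\<^sub>1 fibre_product F (c1 t) \<and>
      p = opair x (opair (fst0 x) (apply1 (c2 t) (snd0 x))))" (is "_ = class_or ?R")
  proof (rule class_of_eq)
    fix p
    have "p \<in>\<^sub>1 class_or ?R \<longleftrightarrow> ?R p"
      by (rule mem_class_or) (intro full_rules)
    also have "\<dots> \<longleftrightarrow> (\<exists>b c. opair b c \<in>\<^sub>1 fibre_product F (c1 t) \<and>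
        p = opair (opair b c) (opair b (apply1 (c2 t) c)))"
      using fibre_product_pairs[of _ F "c1 t"] by (metis fst0_opair snd0_opair)
    also have "\<dots> \<longleftrightarrow> (\<exists>b c c'. opair b c \<in>\<^sub>1 fibre_product F (c1 t) \<and>
      opair c c' \<in>\<^sub>1 c2 (c2 t) \<and> p = opair (opair b c) (opair b c'))"
    proof -
      have "c \<in>\<^sub>1 c1 (c1 t)" if "opair b c \<in>\<^sub>1 fibre_product F (c1 t)" for b c
        using that unfolding mem_fibre_product by auto
      then show ?thesis unfolding arr_graph[OF h(1)] h(2) by metis
    qed
    finally show "p \<in>\<^sub>1 class_or ?R \<longleftrightarrow> (\<exists>b c c'. opair b c \<in>\<^sub>1 fibre_product F (c1 t) \<and>
      opair c c' \<in>\<^sub>1 c2 (c2 t) \<and> p = opair (opair b c) (opair b c'))" .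
  qed
  then show ?thesis
    by (simp add: pullback_ar_def pullback_map_def over_arrow_def arrow_of_def)
qed

lemma pullback_map:
  assumes F: "arr F" and t: "Hom (over (c3 F)) g g' t"
  shows Hom_pullback_map: "Hom (over (c1 F)) (pullback_ob F g) (pullback_ob F g') (pullback_map F t)"
    and apply_pullback_map: "opair b c \<in>\<^sub>1 fibre_product F g \<Longrightarrow>
      apply1 (c2 (pullback_map F t)) (opair b c) = opair b (apply1 (c2 t) c)"
proof -
  note T = Hom_overD[OF t]
  let ?\<phi> = "\<lambda>p. opair (fst0 p) (apply1 (c2 t) (snd0 p))"
  have def: "definable_set (Full False) (\<lambda>e E. ?\<phi> (e 0))" by (intro full_rules)
  have snd: "snd0 p \<in>\<^sub>1 c1 (c2 t)" if "p \<in>\<^sub>1 fibre_product F g" for p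
    using that F T(3) by (rule fibre_productE) (simp add: T(8))
  have bd: "bounded_on (c1 (pullback_ob F g)) ?\<phi>"
    unfolding pullback_ob_simps
    by (intro bounded_on_opair bounded_on_fst0_id bounded_on_snd0_id bounded_on_apply1 T(7)
        fibre_product_pairs snd)
  have maps: "?\<phi> p \<in>\<^sub>1 c1 (pullback_ob F g')" if "p \<in>\<^sub>1 c1 (pullback_ob F g)" for p
    using that[unfolded pullback_ob_simps] F T(3)
    by (rule fibre_productE) (simp add: opair_mem_fibre_product[OF F T(4)] T(10,11))
  have comm: "apply1 (pullback_ob F g') (?\<phi> p) = apply1 (pullback_ob F g) p"
    if "p \<in>\<^sub>1 c1 (pullback_ob F g)" for p
    using that maps[OF that] by (simp add: apply_pullback_ob)
  note * = over_arrow[where g = "pullback_ob F g" and g' = "pullback_ob F g'" and A = "c1 F",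
      OF arr_pullback_ob _ arr_pullback_ob _ def bd maps comm, simplified pullback_ob_simps]
  show "Hom (over (c1 F)) (pullback_ob F g) (pullback_ob F g') (pullback_map F t)"
    unfolding pullback_map_def T(1,2) by (rule *(1)) simp_all
  show "opair b c \<in>\<^sub>1 fibre_product F g \<Longrightarrow>
      apply1 (c2 (pullback_map F t)) (opair b c) = opair b (apply1 (c2 t) c)"
    unfolding pullback_map_def T(1,2) by (subst *(2)) simp_all
qed

lemma pullback_functor_eq:
  "pullback_functor F = functor_of (c3 F) (pullback_ob F) (pullback_map F)"
proof -
  have "Ar (over A) t \<and> Z = cpair t (pullback_ar F t) \<longleftrightarrow> Ar (over A) t \<and> Z = cpair t (pullback_map F t)"
    for A t Z
    unfolding Ar_over using pullback_ar_eq by metis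
  then show ?thesis unfolding pullback_functor_def functor_of_def by simp
qed

lemma definable_pullback_ob: "definable_class (Full True) (\<lambda>e E. pullback_ob F (E 0))"
  unfolding pullback_ob_eq by (intro full_rules definable_class_fibre_product)

lemma definable_pullback_map: "definable_class (Full True) (\<lambda>e E. pullback_map F (E 0))"
  unfolding pullback_map_def over_arrow_def pullback_ob_eq
  by (intro full_rules definable_class_fibre_product)

lemma pullback_functor:
  assumes F: "arr F"
  shows is_functor_pullback: "is_functor (over (c3 F)) (over (c1 F)) (pullback_functor F)"
    and on_ob_pullback: "Ob (over (c3 F)) g \<Longrightarrow> on_ob (pullback_functor F) g = pullback_ob F g"
    and on_ar_pullback: "Hom (over (c3 F)) g g' t \<Longrightarrow> on_ar (pullback_functor F) t = pullback_map F t"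
proof -
  have ident: "pullback_map F (Ident (over (c3 F)) g) = Ident (over (c1 F)) (pullback_ob F g)"
    if g: "Ob (over (c3 F)) g" for g
  proof (rule Hom_over_ext)
    have i: "Hom (over (c3 F)) g g (Ident (over (c3 F)) g)" using g by (simp add: Hom_over_ident)
    show "Hom (over (c1 F)) (pullback_ob F g) (pullback_ob F g) (pullback_map F (Ident (over (c3 F)) g))"
      by (rule Hom_pullback_map[OF F i])
    show "Hom (over (c1 F)) (pullback_ob F g) (pullback_ob F g) (Ident (over (c1 F)) (pullback_ob F g))"
      by (simp add: Hom_over_ident arr_pullback_ob)
    fix p assume p: "p \<in>\<^sub>1 c1 (pullback_ob F g)"
    with g F show "apply1 (c2 (pullback_map F (Ident (over (c3 F)) g))) p =
      apply1 (c2 (Ident (over (c1 F)) (pullback_ob F g))) p"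
      by (simp, elim fibre_productE[OF _ F])
        (simp_all add: apply_pullback_map[OF F i] apply_ident opair_mem_fibre_product)
  qed
  have comp: "pullback_map F (Comp (over (c3 F)) u t) =
      Comp (over (c1 F)) (pullback_map F u) (pullback_map F t)"
    if t: "Hom (over (c3 F)) g g' t" and u: "Hom (over (c3 F)) g' g'' u" for g g' g'' t u
  proof (rule Hom_over_ext)
    note tu = Hom_over_comp[OF t u]
    note t' = Hom_pullback_map[OF F t] and u' = Hom_pullback_map[OF F u]
    show "Hom (over (c1 F)) (pullback_ob F g) (pullback_ob F g'') (pullback_map F (Comp (over (c3 F)) u t))"
      by (rule Hom_pullback_map[OF F tu])
    show "Hom (over (c1 F)) (pullback_ob F g) (pullback_ob F g'')
        (Comp (over (c1 F)) (pullback_map F u) (pullback_map F t))"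
      by (rule Hom_over_comp[OF t' u'])
    fix p assume p: "p \<in>\<^sub>1 c1 (pullback_ob F g)"
    then have "p \<in>\<^sub>1 fibre_product F g" by simp
    then obtain b c where pc: "p = opair b c" "b \<in>\<^sub>1 c1 F" "c \<in>\<^sub>1 c1 g" "apply1 F b = apply1 g c"
      using F Hom_overD(3)[OF t] by (rule fibre_productE)
    have fp: "opair b c \<in>\<^sub>1 fibre_product F g" "opair b (apply1 (c2 t) c) \<in>\<^sub>1 fibre_product F g'"
      using pc Hom_overD(1-9)[OF t] Hom_overD(10,11)[OF t, of c] F by (simp_all add: opair_mem_fibre_product)
    show "apply1 (c2 (pullback_map F (Comp (over (c3 F)) u t))) p =
        apply1 (c2 (Comp (over (c1 F)) (pullback_map F u) (pullback_map F t))) p"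
      unfolding pc(1) apply_pullback_map[OF F tu fp(1)] apply_comp[OF t u pc(3)]
      by (subst apply_comp[OF t' u'])
        (simp_all add: fp apply_pullback_map[OF F t fp(1)] apply_pullback_map[OF F u fp(2)])
  qed
  note * = functor_of[where A = "c3 F" and B = "c1 F", OF definable_pullback_ob definable_pullback_map
      _ Hom_pullback_map[OF F] ident comp, folded pullback_functor_eq]
  show "is_functor (over (c3 F)) (over (c1 F)) (pullback_functor F)"
    by (rule *(1)) (simp_all add: arr_pullback_ob)
  show "Ob (over (c3 F)) g \<Longrightarrow> on_ob (pullback_functor F) g = pullback_ob F g"
    by (rule *(2)) (simp_all add: arr_pullback_ob)
  show "Hom (over (c3 F)) g g' t \<Longrightarrow> on_ar (pullback_functor F) t = pullback_map F t"
    by (rule *(3)) (simp_all add: arr_pullback_ob)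
qed

section \<open>The left adjoint: composition with \<open>F\<close>\<close>

definition sigma_ob :: "'c \<Rightarrow> 'c \<Rightarrow> 'c" where
  "sigma_ob F g = arrow_of (c1 g) (\<lambda>x. apply1 F (apply1 g x)) (c3 F)"

definition sigma_map :: "'c \<Rightarrow> 'c \<Rightarrow> 'c" where
  "sigma_map F t = over_arrow (sigma_ob F (c1 t)) (\<lambda>x. apply1 (c2 t) x) (sigma_ob F (c3 t))"

definition sigma_transpose :: "'c \<Rightarrow> 'c \<Rightarrow> 'c \<Rightarrow> 'c \<Rightarrow> 'c" where
  "sigma_transpose F x y f =
     over_arrow x (\<lambda>c. opair (apply1 x c) (apply1 (c2 f) c)) (pullback_ob F y)"

definition sigma_untranspose :: "'c \<Rightarrow> 'c \<Rightarrow> 'c \<Rightarrow> 'c \<Rightarrow> 'c" where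
  "sigma_untranspose F x y g = over_arrow (sigma_ob F x) (\<lambda>c. snd0 (apply1 (c2 g) c)) y"

lemma sigma_ob_simps [simp]: "c1 (sigma_ob F g) = c1 g" "c3 (sigma_ob F g) = c3 F"
  by (simp_all add: sigma_ob_def)

lemma sigma_ob:
  assumes F: "arr F" and g: "arr g" "c3 g = c1 F"
  shows arr_sigma_ob: "arr (sigma_ob F g)"
    and apply_sigma_ob: "x \<in>\<^sub>1 c1 g \<Longrightarrow> apply1 (sigma_ob F g) x = apply1 F (apply1 g x)"
proof -
  have maps: "x \<in>\<^sub>1 c1 g \<Longrightarrow> apply1 g x \<in>\<^sub>1 c1 F" for x using arr_apply1[OF g(1)] g(2) by simp
  have def: "definable_set (Full False) (\<lambda>e E. apply1 F (apply1 g (e 0)))" by (intro full_rules)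
  have bd: "bounded_on (c1 g) (\<lambda>x. apply1 F (apply1 g x))"
    by (intro bounded_on_apply1 F arr_bounded_on g(1) maps)
  note * = arrow_of[where A = "c1 g" and B = "c3 F", OF def bd arr_apply1[OF F maps]]
  show "arr (sigma_ob F g)"
    and "x \<in>\<^sub>1 c1 g \<Longrightarrow> apply1 (sigma_ob F g) x = apply1 F (apply1 g x)"
    unfolding sigma_ob_def by (rule *, assumption?)+
qed

lemma sigma_map:
  assumes F: "arr F" and t: "Hom (over (c1 F)) g g' t"
  shows Hom_sigma_map: "Hom (over (c3 F)) (sigma_ob F g) (sigma_ob F g') (sigma_map F t)"
    and apply_sigma_map: "x \<in>\<^sub>1 c1 g \<Longrightarrow> apply1 (c2 (sigma_map F t)) x = apply1 (c2 t) x"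
proof -
  note T = Hom_overD[OF t]
  have def: "definable_set (Full False) (\<lambda>e E. apply1 (c2 t) (e 0))" by (intro full_rules)
  have bd: "bounded_on (c1 (sigma_ob F g)) (\<lambda>x. apply1 (c2 t) x)"
    using arr_bounded_on[OF T(7)] by (simp add: T(8))
  note * = over_arrow[where g = "sigma_ob F g" and g' = "sigma_ob F g'" and A = "c3 F",
      OF arr_sigma_ob[OF F T(3,5)] _ arr_sigma_ob[OF F T(4,6)] _ def bd]
  show "Hom (over (c3 F)) (sigma_ob F g) (sigma_ob F g') (sigma_map F t)"
    unfolding sigma_map_def T(1,2)
    by (rule *(1)) (simp_all add: apply_sigma_ob[OF F T(3,5)] apply_sigma_ob[OF F T(4,6)] T(10,11))
  show "x \<in>\<^sub>1 c1 g \<Longrightarrow> apply1 (c2 (sigma_map F t)) x = apply1 (c2 t) x"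
    unfolding sigma_map_def T(1,2)
    by (rule *(2)) (simp_all add: apply_sigma_ob[OF F T(3,5)] apply_sigma_ob[OF F T(4,6)] T(10,11))
qed

lemma sigma_functor:
  assumes F: "arr F"
  defines "S \<equiv> functor_of (c1 F) (sigma_ob F) (sigma_map F)"
  shows "is_functor (over (c1 F)) (over (c3 F)) S"
    and "Ob (over (c1 F)) g \<Longrightarrow> on_ob S g = sigma_ob F g"
    and "Hom (over (c1 F)) g g' t \<Longrightarrow> on_ar S t = sigma_map F t"
proof -
  have ob: "Ob (over (c3 F)) (sigma_ob F g)" if "Ob (over (c1 F)) g" for g
    using that F by (simp add: arr_sigma_ob)
  have ident: "sigma_map F (Ident (over (c1 F)) g) = Ident (over (c3 F)) (sigma_ob F g)"
    if g: "Ob (over (c1 F)) g" for g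
  proof (rule Hom_over_ext)
    have i: "Hom (over (c1 F)) g g (Ident (over (c1 F)) g)" using g by (simp add: Hom_over_ident)
    show "Hom (over (c3 F)) (sigma_ob F g) (sigma_ob F g) (sigma_map F (Ident (over (c1 F)) g))"
      by (rule Hom_sigma_map[OF F i])
    show "Hom (over (c3 F)) (sigma_ob F g) (sigma_ob F g) (Ident (over (c3 F)) (sigma_ob F g))"
      using ob[OF g] by (simp add: Hom_over_ident)
    fix p assume p: "p \<in>\<^sub>1 c1 (sigma_ob F g)"
    then show "apply1 (c2 (sigma_map F (Ident (over (c1 F)) g))) p =
      apply1 (c2 (Ident (over (c3 F)) (sigma_ob F g))) p"
      by (simp add: apply_sigma_map[OF F i] apply_ident)
  qed
  have comp: "sigma_map F (Comp (over (c1 F)) u t) =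
      Comp (over (c3 F)) (sigma_map F u) (sigma_map F t)"
    if t: "Hom (over (c1 F)) g g' t" and u: "Hom (over (c1 F)) g' g'' u" for g g' g'' t u
  proof (rule Hom_over_ext)
    note tu = Hom_over_comp[OF t u]
    note t' = Hom_sigma_map[OF F t] and u' = Hom_sigma_map[OF F u]
    show "Hom (over (c3 F)) (sigma_ob F g) (sigma_ob F g'') (sigma_map F (Comp (over (c1 F)) u t))"
      by (rule Hom_sigma_map[OF F tu])
    show "Hom (over (c3 F)) (sigma_ob F g) (sigma_ob F g'')
        (Comp (over (c3 F)) (sigma_map F u) (sigma_map F t))"
      by (rule Hom_over_comp[OF t' u'])
    fix p assume p: "p \<in>\<^sub>1 c1 (sigma_ob F g)"
    then show "apply1 (c2 (sigma_map F (Comp (over (c1 F)) u t))) p =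
        apply1 (c2 (Comp (over (c3 F)) (sigma_map F u) (sigma_map F t))) p"
      by (simp add: apply_comp[OF t' u'] apply_comp[OF t u] apply_sigma_map[OF F tu]
          apply_sigma_map[OF F t] apply_sigma_map[OF F u] Hom_overD(10)[OF t])
  qed
  have def: "definable_class (Full True) (\<lambda>e E. sigma_ob F (E 0))"
    "definable_class (Full True) (\<lambda>e E. sigma_map F (E 0))"
    unfolding sigma_map_def over_arrow_def sigma_ob_def by (intro full_rules)+
  show "is_functor (over (c1 F)) (over (c3 F)) S"
    unfolding S_def by (rule functor_of(1)[OF def ob Hom_sigma_map[OF F] ident comp])
  show "Ob (over (c1 F)) g \<Longrightarrow> on_ob S g = sigma_ob F g"
    unfolding S_def by (rule functor_of(2)[OF def ob Hom_sigma_map[OF F] ident comp])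
  show "Hom (over (c1 F)) g g' t \<Longrightarrow> on_ar S t = sigma_map F t"
    unfolding S_def by (rule functor_of(3)[OF def ob Hom_sigma_map[OF F] ident comp])
qed

lemma sigma_transpose:
  assumes F: "arr F" and x: "Ob (over (c1 F)) x" and y: "Ob (over (c3 F)) y"
    and f: "Hom (over (c3 F)) (sigma_ob F x) y f"
  shows Hom_sigma_transpose: "Hom (over (c1 F)) x (pullback_ob F y) (sigma_transpose F x y f)"
    and apply_sigma_transpose: "c \<in>\<^sub>1 c1 x \<Longrightarrow>
      apply1 (c2 (sigma_transpose F x y f)) c = opair (apply1 x c) (apply1 (c2 f) c)"
proof -
  note f' = Hom_overD[OF f, unfolded sigma_ob_simps]
  have x': "arr x" "c3 x = c1 F" and y': "arr y" "c3 y = c3 F" using x y by simp_all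
  let ?\<phi> = "\<lambda>c. opair (apply1 x c) (apply1 (c2 f) c)"
  have def: "definable_set (Full False) (\<lambda>e E. ?\<phi> (e 0))" by (intro full_rules)
  have bd: "bounded_on (c1 x) ?\<phi>"
    using arr_bounded_on[OF x'(1)] arr_bounded_on[OF f'(7)]
    by (intro bounded_on_opair) (simp_all add: f'(8))
  \<comment> \<open>Membership in the fibre product says that \<open>F\<close> after
    \<open>x\<close> agrees with \<open>y\<close> after \<open>f\<close>. This is the condition for
    \<open>f\<close> to be a map over the codomain of \<open>F\<close>.\<close>
  have maps: "?\<phi> c \<in>\<^sub>1 fibre_product F y" if "c \<in>\<^sub>1 c1 x" for c
    using that arr_apply1[OF x'(1) that]
    by (simp add: opair_mem_fibre_product[OF F y'(1)] x' f'(10,11) apply_sigma_ob[OF F x'])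
  note * = over_arrow[where g = x and g' = "pullback_ob F y" and A = "c1 F",
      OF x' arr_pullback_ob _ def bd, unfolded pullback_ob_simps, OF refl maps]
  show "Hom (over (c1 F)) x (pullback_ob F y) (sigma_transpose F x y f)"
    unfolding sigma_transpose_def by (rule *(1)) (simp_all add: apply_pullback_ob[OF maps])
  show "c \<in>\<^sub>1 c1 x \<Longrightarrow>
      apply1 (c2 (sigma_transpose F x y f)) c = opair (apply1 x c) (apply1 (c2 f) c)"
    unfolding sigma_transpose_def by (rule *(2)) (simp_all add: apply_pullback_ob[OF maps])
qed

text \<open>A map into the pullback over the domain of \<open>F\<close> has its first coordinate
  prescribed by \<open>x\<close>. Hence keeping only the second coordinate loses nothing, and
  \<open>sigma_untranspose\<close> inverts the transposition.\<close>

lemma Hom_pullback_apply: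
  assumes F: "arr F" and y: "arr y" and g: "Hom (over (c1 F)) x (pullback_ob F y) g" and c: "c \<in>\<^sub>1 c1 x"
  obtains d where "apply1 (c2 g) c = opair (apply1 x c) d" "d \<in>\<^sub>1 c1 y"
    "apply1 F (apply1 x c) = apply1 y d"
proof -
  have m: "apply1 (c2 g) c \<in>\<^sub>1 fibre_product F y" using Hom_overD(10)[OF g c] by simp
  then obtain b d where bd: "apply1 (c2 g) c = opair b d" "d \<in>\<^sub>1 c1 y" "apply1 F b = apply1 y d"
    using F y by (rule fibre_productE)
  have "apply1 x c = b"
    using Hom_overD(11)[OF g c] apply_pullback_ob[OF m] bd(1) by simp
  with bd that show ?thesis by blast
qed

lemma sigma_untranspose:
  assumes F: "arr F" and x: "Ob (over (c1 F)) x" and y: "Ob (over (c3 F)) y"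
    and g: "Hom (over (c1 F)) x (pullback_ob F y) g"
  shows Hom_sigma_untranspose: "Hom (over (c3 F)) (sigma_ob F x) y (sigma_untranspose F x y g)"
    and apply_sigma_untranspose: "c \<in>\<^sub>1 c1 x \<Longrightarrow>
      apply1 (c2 (sigma_untranspose F x y g)) c = snd0 (apply1 (c2 g) c)"
proof -
  note g' = Hom_overD[OF g]
  have x': "arr x" "c3 x = c1 F" and y': "arr y" "c3 y = c3 F" using x y by simp_all
  let ?\<phi> = "\<lambda>c. snd0 (apply1 (c2 g) c)"
  have def: "definable_set (Full False) (\<lambda>e E. ?\<phi> (e 0))" by (intro full_rules)
  have "bounded_on (c1 x) (apply1 (c2 g))" using arr_bounded_on[OF g'(7)] by (simp add: g'(8))
  then have bd: "bounded_on (c1 (sigma_ob F x)) ?\<phi>"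
    unfolding sigma_ob_simps
    by (rule bounded_on_snd0) (use Hom_pullback_apply[OF F y'(1) g] in metis)
  have *: "?\<phi> c \<in>\<^sub>1 c1 y \<and> apply1 y (?\<phi> c) = apply1 (sigma_ob F x) c" if c: "c \<in>\<^sub>1 c1 x" for c
    using F y'(1) g c by (rule Hom_pullback_apply) (simp add: apply_sigma_ob[OF F x' c])
  note ** = over_arrow[where g = "sigma_ob F x" and g' = y and A = "c3 F",
      OF arr_sigma_ob[OF F x'] _ y' def bd, unfolded sigma_ob_simps, OF refl]
  show "Hom (over (c3 F)) (sigma_ob F x) y (sigma_untranspose F x y g)"
    unfolding sigma_untranspose_def by (rule **(1)) (use * in blast)+
  show "c \<in>\<^sub>1 c1 x \<Longrightarrow> apply1 (c2 (sigma_untranspose F x y g)) c = snd0 (apply1 (c2 g) c)"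
    unfolding sigma_untranspose_def by (rule **(2)) (use * in blast)+
qed

lemma left_adjoint_sigma:
  assumes F: "arr F"
  shows "left_adjoint (over (c1 F)) (over (c3 F))
    (functor_of (c1 F) (sigma_ob F) (sigma_map F)) (pullback_functor F)"
proof (rule left_adjointI[OF sigma_functor[OF F] pullback_functor[OF F],
      where tr = "sigma_transpose F" and rt = "sigma_untranspose F"])
  show "definable_class (Full True) (\<lambda>e E. sigma_ob F (E 0))"
    unfolding sigma_ob_def by (intro full_rules)
  show "definable_class (Full True)
      (\<lambda>e E. sigma_transpose F (E (Suc (Suc 0))) (E (Suc 0)) (E 0))"
    unfolding sigma_transpose_def over_arrow_def pullback_ob_eq
    by (intro full_rules definable_class_fibre_product)
next
  fix x y f assume *: "Ob (over (c1 F)) x" "Ob (over (c3 F)) y" "Hom (over (c3 F)) (sigma_ob F x) y f"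
  note t = Hom_sigma_transpose[OF F *]
  show "Hom (over (c1 F)) x (pullback_ob F y) (sigma_transpose F x y f)" by (rule t)
  show "sigma_untranspose F x y (sigma_transpose F x y f) = f"
    by (rule Hom_over_ext[OF Hom_sigma_untranspose[OF F *(1,2) t] *(3)])
      (simp add: apply_sigma_untranspose[OF F *(1,2) t] apply_sigma_transpose[OF F *])
next
  fix x y g assume *: "Ob (over (c1 F)) x" "Ob (over (c3 F)) y" "Hom (over (c1 F)) x (pullback_ob F y) g"
  have y: "arr y" using *(2) by simp
  note t = Hom_sigma_untranspose[OF F *]
  show "Hom (over (c3 F)) (sigma_ob F x) y (sigma_untranspose F x y g)" by (rule t)
  show "sigma_transpose F x y (sigma_untranspose F x y g) = g"
  proof (rule Hom_over_ext[OF Hom_sigma_transpose[OF F *(1,2) t] *(3)])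
    fix c assume c: "c \<in>\<^sub>1 c1 x"
    show "apply1 (c2 (sigma_transpose F x y (sigma_untranspose F x y g))) c = apply1 (c2 g) c"
      using F y *(3) c
      by (rule Hom_pullback_apply)
        (simp add: apply_sigma_transpose[OF F *(1,2) t c] apply_sigma_untranspose[OF F * c])
  qed
next
  fix x x' y y' a b f
  assume a: "Hom (over (c1 F)) x' x a" and b: "Hom (over (c3 F)) y y' b"
    and f: "Hom (over (c3 F)) (sigma_ob F x) y f"
  have obs: "Ob (over (c1 F)) x" "Ob (over (c1 F)) x'" "Ob (over (c3 F)) y" "Ob (over (c3 F)) y'"
    using Hom_overD(1-9)[OF a] Hom_overD(1-9)[OF b] by simp_all
  note A = Hom_sigma_map[OF F a] and B = Hom_pullback_map[OF F b]
  note fA = Hom_over_comp[OF A f] note bfA = Hom_over_comp[OF fA b]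
  note t = Hom_sigma_transpose[OF F obs(1,3) f]
  note ta = Hom_over_comp[OF a t] note Bta = Hom_over_comp[OF ta B]
  show "sigma_transpose F x' y' (Comp (over (c3 F)) b (Comp (over (c3 F)) f (sigma_map F a))) =
    Comp (over (c1 F)) (pullback_map F b) (Comp (over (c1 F)) (sigma_transpose F x y f) a)"
  proof (rule Hom_over_ext[OF Hom_sigma_transpose[OF F obs(2,4) bfA] Bta])
    fix c assume c: "c \<in>\<^sub>1 c1 x'"
    note ac = Hom_overD(10,11)[OF a c]
    \<comment> \<open>\<open>apply_pullback_map\<close> evaluates only at points of the fibre
      product, so the transpose of \<open>f\<close> at \<open>a c\<close> is first placed
      there.\<close>
    have "opair (apply1 x (apply1 (c2 a) c)) (apply1 (c2 f) (apply1 (c2 a) c)) \<in>\<^sub>1 fibre_product F y"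
      using Hom_overD(10)[OF t ac(1)] by (simp add: apply_sigma_transpose[OF F obs(1,3) f ac(1)])
    then show "apply1 (c2 (sigma_transpose F x' y'
        (Comp (over (c3 F)) b (Comp (over (c3 F)) f (sigma_map F a))))) c =
      apply1 (c2 (Comp (over (c1 F)) (pullback_map F b) (Comp (over (c1 F)) (sigma_transpose F x y f) a))) c"
      using c ac
      by (simp add: apply_sigma_transpose[OF F obs(2,4) bfA] apply_comp[OF ta B] apply_comp[OF a t]
          apply_comp[OF fA b] apply_comp[OF A f] apply_sigma_map[OF F a]
          apply_sigma_transpose[OF F obs(1,3) f] apply_pullback_map[OF F b])
  qed
qed

section \<open>The right adjoint: sections over the fibres of \<open>F\<close>\<close>

definition is_section :: "'c \<Rightarrow> 'c \<Rightarrow> 's \<Rightarrow> 's \<Rightarrow> bool" where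
  "is_section F g a s \<longleftrightarrow>
     (\<forall>q. q \<in>\<^sub>0 s \<longrightarrow> (\<exists>b c. q = opair b c \<and> b \<in>\<^sub>1 c1 F \<and> apply1 F b = a \<and>
        c \<in>\<^sub>1 c1 g \<and> apply1 g c = b)) \<and>
     (\<forall>b. b \<in>\<^sub>1 c1 F \<and> apply1 F b = a \<longrightarrow> (\<exists>!c. opair b c \<in>\<^sub>0 s))"

text \<open>The point \<open>a\<close> is recorded next to \<open>s\<close> because \<open>s\<close>
  need not determine it: over every point with empty fibre the empty set is the only
  section.\<close>

definition sections :: "'c \<Rightarrow> 'c \<Rightarrow> 'c" where
  "sections F g = class_or (\<lambda>p. \<exists>a s. p = opair a s \<and> a \<in>\<^sub>1 c3 F \<and> is_section F g a s)"

text \<open>That the graph over a fibre is a set is known only under local smallness;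
  \<open>set_or\<close> keeps the term meaningful, and definable, before this is proved.\<close>

definition section_of :: "'c \<Rightarrow> 's \<Rightarrow> ('s \<Rightarrow> 's) \<Rightarrow> 's" where
  "section_of F a \<phi> = set_or (\<lambda>q. \<exists>b. b \<in>\<^sub>1 c1 F \<and> apply1 F b = a \<and> q = opair b (\<phi> b))"

definition pi_ob :: "'c \<Rightarrow> 'c \<Rightarrow> 'c" where
  "pi_ob F g = arrow_of (sections F g) fst0 (c3 F)"

definition pi_map :: "'c \<Rightarrow> 'c \<Rightarrow> 'c" where
  "pi_map F t = over_arrow (pi_ob F (c1 t))
     (\<lambda>p. opair (fst0 p) (section_of F (fst0 p) (\<lambda>b. apply1 (c2 t) (apply0 (snd0 p) b))))
     (pi_ob F (c3 t))"

definition pi_transpose :: "'c \<Rightarrow> 'c \<Rightarrow> 'c \<Rightarrow> 'c \<Rightarrow> 'c" where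
  "pi_transpose F x y f = over_arrow x
     (\<lambda>k. opair (apply1 x k) (section_of F (apply1 x k) (\<lambda>b. apply1 (c2 f) (opair b k))))
     (pi_ob F y)"

definition pi_untranspose :: "'c \<Rightarrow> 'c \<Rightarrow> 'c \<Rightarrow> 'c \<Rightarrow> 'c" where
  "pi_untranspose F x y g = over_arrow (pullback_ob F x)
     (\<lambda>p. apply0 (snd0 (apply1 (c2 g) (snd0 p))) (fst0 p)) y"

lemma mem_sections:
  "p \<in>\<^sub>1 sections F g \<longleftrightarrow> (\<exists>a s. p = opair a s \<and> a \<in>\<^sub>1 c3 F \<and> is_section F g a s)"
  unfolding sections_def is_section_def by (rule mem_class_or) (intro full_rules)

lemma pi_ob_simps [simp]: "c1 (pi_ob F g) = sections F g" "c3 (pi_ob F g) = c3 F"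
  by (simp_all add: pi_ob_def)

lemma pi_ob:
  shows arr_pi_ob: "arr (pi_ob F g)"
    and apply_pi_ob: "p \<in>\<^sub>1 sections F g \<Longrightarrow> apply1 (pi_ob F g) p = fst0 p"
proof -
  have def: "definable_set (Full False) (\<lambda>e E. fst0 (e 0))" by (intro full_rules)
  have bd: "bounded_on (sections F g) fst0"
    by (rule bounded_on_fst0_id) (auto simp: mem_sections)
  have maps: "p \<in>\<^sub>1 sections F g \<Longrightarrow> fst0 p \<in>\<^sub>1 c3 F" for p
    unfolding mem_sections by auto
  note * = arrow_of[OF def bd maps]
  show "arr (pi_ob F g)" and "p \<in>\<^sub>1 sections F g \<Longrightarrow> apply1 (pi_ob F g) p = fst0 p"
    unfolding pi_ob_def by (rule *, assumption?)+
qed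

lemma definable_pi_ob: "definable_class (Full True) (\<lambda>e E. pi_ob F (E 0))"
  unfolding pi_ob_def sections_def is_section_def by (intro full_rules)

lemma definable_pi_map: "definable_class (Full True) (\<lambda>e E. pi_map F (E 0))"
  unfolding pi_map_def over_arrow_def pi_ob_def sections_def is_section_def section_of_def
  by (intro full_rules)

lemma definable_pi_transpose:
  "definable_class (Full True) (\<lambda>e E. pi_transpose F (E (Suc (Suc 0))) (E (Suc 0)) (E 0))"
  unfolding pi_transpose_def over_arrow_def pi_ob_def sections_def is_section_def section_of_def
  by (intro full_rules)

lemma is_section_apply:
  assumes s: "is_section F g a s" and b: "b \<in>\<^sub>1 c1 F" "apply1 F b = a"
  shows "opair b c \<in>\<^sub>0 s \<longleftrightarrow> c = apply0 s b" "apply0 s b \<in>\<^sub>1 c1 g" "apply1 g (apply0 s b) = b"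
    and "\<exists>!c. opair b c \<in>\<^sub>0 s"
proof -
  show ex1: "\<exists>!c. opair b c \<in>\<^sub>0 s" using s b unfolding is_section_def by blast
  show eq: "opair b c \<in>\<^sub>0 s \<longleftrightarrow> c = apply0 s b" for c using apply0_eq[OF ex1] by blast
  then have "opair b (apply0 s b) \<in>\<^sub>0 s" by blast
  then obtain b' c' where "opair b (apply0 s b) = opair b' c'" "c' \<in>\<^sub>1 c1 g" "apply1 g c' = b'"
    using s unfolding is_section_def by blast
  then show "apply0 s b \<in>\<^sub>1 c1 g" "apply1 g (apply0 s b) = b" by auto
qed

lemma is_section_ext:
  assumes s: "is_section F g a s" and s': "is_section F g a s'"
    and eq: "\<And>b. b \<in>\<^sub>1 c1 F \<Longrightarrow> apply1 F b = a \<Longrightarrow> apply0 s b = apply0 s' b"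
  shows "s = s'"
proof (rule set_ext, rule allI)
  fix q
  \<comment> \<open>A section is the graph of its own \<open>apply0\<close> over the fibre, so its
    values determine it.\<close>
  have "q \<in>\<^sub>0 r \<longleftrightarrow> (\<exists>b. b \<in>\<^sub>1 c1 F \<and> apply1 F b = a \<and> q = opair b (apply0 r b))"
    if r: "is_section F g a r" for r
  proof
    assume q: "q \<in>\<^sub>0 r"
    then obtain b c where bc: "q = opair b c" "b \<in>\<^sub>1 c1 F" "apply1 F b = a"
      using r unfolding is_section_def by blast
    then show "\<exists>b. b \<in>\<^sub>1 c1 F \<and> apply1 F b = a \<and> q = opair b (apply0 r b)"
      using q is_section_apply(1)[OF r bc(2,3), of c] by auto
  next
    assume "\<exists>b. b \<in>\<^sub>1 c1 F \<and> apply1 F b = a \<and> q = opair b (apply0 r b)"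
    then show "q \<in>\<^sub>0 r" using is_section_apply(1)[OF r] by blast
  qed
  from this[OF s] this[OF s'] eq show "q \<in>\<^sub>0 s \<longleftrightarrow> q \<in>\<^sub>0 s'" by metis
qed

text \<open>The assumption isolates the one set-theoretic fact needed about a fibre;
  \<open>bounded_on_section_of\<close> supplies it.\<close>

lemma section_of:
  assumes X: "\<exists>X. \<forall>q. q \<in>\<^sub>0 X \<longleftrightarrow> (\<exists>b. b \<in>\<^sub>1 c1 F \<and> apply1 F b = a \<and> q = opair b (\<phi> b))"
  shows mem_section_of:
      "q \<in>\<^sub>0 section_of F a \<phi> \<longleftrightarrow> (\<exists>b. b \<in>\<^sub>1 c1 F \<and> apply1 F b = a \<and> q = opair b (\<phi> b))"
    and apply_section_of: "b \<in>\<^sub>1 c1 F \<Longrightarrow> apply1 F b = a \<Longrightarrow> apply0 (section_of F a \<phi>) b = \<phi> b"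
    and is_section_section_of:
      "(\<And>b. b \<in>\<^sub>1 c1 F \<Longrightarrow> apply1 F b = a \<Longrightarrow> \<phi> b \<in>\<^sub>1 c1 g \<and> apply1 g (\<phi> b) = b)
       \<Longrightarrow> is_section F g a (section_of F a \<phi>)"
proof -
  obtain X where X: "\<And>q. q \<in>\<^sub>0 X \<longleftrightarrow> (\<exists>b. b \<in>\<^sub>1 c1 F \<and> apply1 F b = a \<and> q = opair b (\<phi> b))"
    using assms by blast
  have "section_of F a \<phi> = X"
    unfolding section_of_def by (rule set_or_eq) (rule X)
  with X show mem: "q \<in>\<^sub>0 section_of F a \<phi> \<longleftrightarrow>
      (\<exists>b. b \<in>\<^sub>1 c1 F \<and> apply1 F b = a \<and> q = opair b (\<phi> b))" for q by simp
  then have op: "opair b c \<in>\<^sub>0 section_of F a \<phi> \<longleftrightarrow> b \<in>\<^sub>1 c1 F \<and> apply1 F b = a \<and> c = \<phi> b" for b c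
    by auto
  show "b \<in>\<^sub>1 c1 F \<Longrightarrow> apply1 F b = a \<Longrightarrow> apply0 (section_of F a \<phi>) b = \<phi> b"
    unfolding apply0_def op by (rule the_or_undefined_eq) auto
  show "is_section F g a (section_of F a \<phi>)"
    if "\<And>b. b \<in>\<^sub>1 c1 F \<Longrightarrow> apply1 F b = a \<Longrightarrow> \<phi> b \<in>\<^sub>1 c1 g \<and> apply1 g (\<phi> b) = b"
    unfolding is_section_def op unfolding mem using that by blast
qed

lemma locally_small_preimage:
  assumes "arr F" "locally_small F" "S \<subseteq>\<^sub>0\<^sub>1 c3 F"
  shows "\<exists>U. \<forall>b. b \<in>\<^sub>0 U \<longleftrightarrow> b \<in>\<^sub>1 c1 F \<and> apply1 F b \<in>\<^sub>0 S"
proof -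
  obtain U where "\<forall>b. b \<in>\<^sub>0 U \<longleftrightarrow> (\<exists>a. a \<in>\<^sub>0 S \<and> opair b a \<in>\<^sub>1 c2 F)"
    using assms(2,3) unfolding locally_small_def locally_small_class_fun_def by blast
  then have "b \<in>\<^sub>0 U \<longleftrightarrow> b \<in>\<^sub>1 c1 F \<and> apply1 F b \<in>\<^sub>0 S" for b
    unfolding arr_graph[OF assms(1)] by blast
  then show ?thesis by blast
qed

text \<open>
  Over a set \<open>S\<close>, local smallness bounds the domain of the sections by the preimage \<open>U\<close> of the
  image of \<open>S\<close>, and boundedness of \<open>\<psi>\<close> bounds their values by a set \<open>V\<close>. All the sections are then
  elements of the power set of \<open>U \<times> V\<close>.
\<close>

lemma bounded_on_section_of:
  assumes F: "arr F" "locally_small F" and g: "arr g" "c3 g = c3 F"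
    and \<psi>: "bounded_on (fibre_product F g) (\<lambda>p. \<psi> (fst0 p) (snd0 p))"
  shows "bounded_on (c1 g) (\<lambda>x. section_of F (apply1 g x) (\<lambda>b. \<psi> b x))"
    and "x \<in>\<^sub>1 c1 g \<Longrightarrow>
      \<exists>X. \<forall>q. q \<in>\<^sub>0 X \<longleftrightarrow> (\<exists>b. b \<in>\<^sub>1 c1 F \<and> apply1 F b = apply1 g x \<and> q = opair b (\<psi> b x))"
proof -
  have main: "\<exists>U V H. (\<forall>x b. x \<in>\<^sub>0 S \<and> b \<in>\<^sub>1 c1 F \<and> apply1 F b = apply1 g x \<longrightarrow> b \<in>\<^sub>0 U \<and> \<psi> b x \<in>\<^sub>0 V) \<and>
      (\<forall>w v. opair w v \<in>\<^sub>0 H \<longleftrightarrow> (\<exists>b x. w = opair b x \<and> x \<in>\<^sub>0 S \<and> b \<in>\<^sub>1 c1 F \<and>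
        apply1 F b = apply1 g x \<and> v = \<psi> b x))"
    if S: "S \<subseteq>\<^sub>0\<^sub>1 c1 g" for S
  proof -
    obtain G T where G: "\<And>x y. opair x y \<in>\<^sub>0 G \<longleftrightarrow> x \<in>\<^sub>0 S \<and> y = apply1 g x"
      and T: "\<And>y. y \<in>\<^sub>0 T \<longleftrightarrow> (\<exists>x. x \<in>\<^sub>0 S \<and> y = apply1 g x)"
      using bounded_on_graph[OF arr_bounded_on[OF g(1)] S] by blast
    have "T \<subseteq>\<^sub>0\<^sub>1 c3 F"
      using S T arr_apply1[OF g(1)] g(2) unfolding sub01_def by metis
    then obtain U where U: "\<And>b. b \<in>\<^sub>0 U \<longleftrightarrow> b \<in>\<^sub>1 c1 F \<and> apply1 F b \<in>\<^sub>0 T"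
      using locally_small_preimage[OF F] by metis
    then have "U \<subseteq>\<^sub>0\<^sub>1 c1 F" unfolding sub01_def by blast
    \<comment> \<open>\<open>F\<close> restricted to the preimage \<open>U\<close> is a set as well.
      With it the equation of \<open>F b\<close> and \<open>g x\<close> becomes a bounded formula
      with set parameters.\<close>
    from bounded_on_graph[OF arr_bounded_on[OF F(1)] this]
    obtain GF where GF: "\<And>b a. opair b a \<in>\<^sub>0 GF \<longleftrightarrow> b \<in>\<^sub>0 U \<and> a = apply1 F b" by blast
    obtain P where P: "\<And>p. p \<in>\<^sub>0 P \<longleftrightarrow> (\<exists>b. b \<in>\<^sub>0 U \<and> (\<exists>x. x \<in>\<^sub>0 S \<and> p = opair b x))"
      using product_exists by metis
    have "definable Bounded (\<lambda>e E. \<exists>b. b \<in>\<^sub>0 U \<and> (\<exists>x. x \<in>\<^sub>0 S \<and> e 0 = opair b x \<and>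
        (\<exists>a. a \<in>\<^sub>0 T \<and> opair b a \<in>\<^sub>0 GF \<and> opair x a \<in>\<^sub>0 G)))"
      by (intro separation_rules)
    \<comment> \<open>\<open>W\<close> is the part of the fibre product lying over \<open>S\<close>.
      Being a set, it turns the boundedness of \<open>\<psi>\<close> into a set graph
      \<open>H\<close>.\<close>
    from separation[OF this, of P] obtain W where W: "\<And>w. w \<in>\<^sub>0 W \<longleftrightarrow> w \<in>\<^sub>0 P \<and>
        (\<exists>b. b \<in>\<^sub>0 U \<and> (\<exists>x. x \<in>\<^sub>0 S \<and> w = opair b x \<and>
        (\<exists>a. a \<in>\<^sub>0 T \<and> opair b a \<in>\<^sub>0 GF \<and> opair x a \<in>\<^sub>0 G)))"
      by blast
    have in_U: "b \<in>\<^sub>0 U" if "x \<in>\<^sub>0 S" "b \<in>\<^sub>1 c1 F" "apply1 F b = apply1 g x" for b x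
      using that U T by metis
    have W_iff: "w \<in>\<^sub>0 W \<longleftrightarrow> (\<exists>b x. w = opair b x \<and> x \<in>\<^sub>0 S \<and> b \<in>\<^sub>1 c1 F \<and> apply1 F b = apply1 g x)" for w
      unfolding W P GF G using in_U U T by metis
    have "W \<subseteq>\<^sub>0\<^sub>1 fibre_product F g"
      unfolding sub01_def W_iff
      using S opair_mem_fibre_product[OF F(1) g(1)] unfolding sub01_def by blast
    from bounded_on_graph[OF \<psi> this] obtain H V
      where H: "\<And>w v. opair w v \<in>\<^sub>0 H \<longleftrightarrow> w \<in>\<^sub>0 W \<and> v = \<psi> (fst0 w) (snd0 w)"
        and V: "\<And>v. v \<in>\<^sub>0 V \<longleftrightarrow> (\<exists>w. w \<in>\<^sub>0 W \<and> v = \<psi> (fst0 w) (snd0 w))" by blast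
    show ?thesis
    proof (intro exI conjI allI impI; (elim conjE)?)
      fix x b assume *: "x \<in>\<^sub>0 S" "b \<in>\<^sub>1 c1 F" "apply1 F b = apply1 g x"
      show "b \<in>\<^sub>0 U" using * by (rule in_U)
      have "opair b x \<in>\<^sub>0 W" using * W_iff by blast
      then show "\<psi> b x \<in>\<^sub>0 V" unfolding V by (intro exI[of _ "opair b x"]) simp
    next
      fix w v
      show "opair w v \<in>\<^sub>0 H \<longleftrightarrow> (\<exists>b x. w = opair b x \<and> x \<in>\<^sub>0 S \<and> b \<in>\<^sub>1 c1 F \<and>
        apply1 F b = apply1 g x \<and> v = \<psi> b x)"
        unfolding H W_iff by auto
    qed
  qed
  have sets: "\<exists>X. \<forall>q. q \<in>\<^sub>0 X \<longleftrightarrow> (\<exists>b. b \<in>\<^sub>1 c1 F \<and> apply1 F b = apply1 g x \<and> q = opair b (\<psi> b x))"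
    if x: "x \<in>\<^sub>1 c1 g" for x
  proof -
    \<comment> \<open>A single fibre is the case of the singleton of \<open>x\<close>.\<close>
    have "upair x x \<subseteq>\<^sub>0\<^sub>1 c1 g" using x unfolding sub01_def by simp
    from main[OF this] obtain U V H where
      UV: "\<And>y b. y \<in>\<^sub>0 upair x x \<Longrightarrow> b \<in>\<^sub>1 c1 F \<Longrightarrow> apply1 F b = apply1 g y \<Longrightarrow>
        b \<in>\<^sub>0 U \<and> \<psi> b y \<in>\<^sub>0 V" and
      H: "\<And>w v. opair w v \<in>\<^sub>0 H \<longleftrightarrow> (\<exists>b y. w = opair b y \<and> y \<in>\<^sub>0 upair x x \<and> b \<in>\<^sub>1 c1 F \<and>
        apply1 F b = apply1 g y \<and> v = \<psi> b y)" by blast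
    obtain P where P: "\<And>p. p \<in>\<^sub>0 P \<longleftrightarrow> (\<exists>b. b \<in>\<^sub>0 U \<and> (\<exists>v. v \<in>\<^sub>0 V \<and> p = opair b v))"
      using product_exists by metis
    obtain Q where Q: "\<And>p. p \<in>\<^sub>0 Q \<longleftrightarrow> (\<exists>b. b \<in>\<^sub>0 U \<and> (\<exists>y. y \<in>\<^sub>0 upair x x \<and> p = opair b y))"
      using product_exists by metis
    \<comment> \<open>The pair of \<open>b\<close> and \<open>x\<close> is itself a first component
      in \<open>H\<close>, so it needs a name bounded by a set; \<open>Q\<close> provides the
      range.\<close>
    have "definable Bounded (\<lambda>e E. \<exists>b. b \<in>\<^sub>0 U \<and> (\<exists>v. v \<in>\<^sub>0 V \<and> e 0 = opair b v \<and>
        (\<exists>w. w \<in>\<^sub>0 Q \<and> w = opair b x \<and> opair w v \<in>\<^sub>0 H)))"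
      by (intro separation_rules)
    from separation[OF this, of P] obtain X where X: "\<And>q. q \<in>\<^sub>0 X \<longleftrightarrow> q \<in>\<^sub>0 P \<and>
        (\<exists>b. b \<in>\<^sub>0 U \<and> (\<exists>v. v \<in>\<^sub>0 V \<and> q = opair b v \<and>
        (\<exists>w. w \<in>\<^sub>0 Q \<and> w = opair b x \<and> opair w v \<in>\<^sub>0 H)))" by blast
    have "q \<in>\<^sub>0 X \<longleftrightarrow> (\<exists>b. b \<in>\<^sub>1 c1 F \<and> apply1 F b = apply1 g x \<and> q = opair b (\<psi> b x))" for q
      unfolding X P Q H using UV[of x] by auto
    then show ?thesis by blast
  qed
  then show "x \<in>\<^sub>1 c1 g \<Longrightarrow>
      \<exists>X. \<forall>q. q \<in>\<^sub>0 X \<longleftrightarrow> (\<exists>b. b \<in>\<^sub>1 c1 F \<and> apply1 F b = apply1 g x \<and> q = opair b (\<psi> b x))" .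
  show "bounded_on (c1 g) (\<lambda>x. section_of F (apply1 g x) (\<lambda>b. \<psi> b x))"
  proof (rule bounded_onI)
    fix S assume S: "S \<subseteq>\<^sub>0\<^sub>1 c1 g"
    from main[OF S] obtain U V H where
      UV: "\<And>x b. x \<in>\<^sub>0 S \<Longrightarrow> b \<in>\<^sub>1 c1 F \<Longrightarrow> apply1 F b = apply1 g x \<Longrightarrow> b \<in>\<^sub>0 U \<and> \<psi> b x \<in>\<^sub>0 V" and
      H: "\<And>w v. opair w v \<in>\<^sub>0 H \<longleftrightarrow> (\<exists>b x. w = opair b x \<and> x \<in>\<^sub>0 S \<and> b \<in>\<^sub>1 c1 F \<and>
        apply1 F b = apply1 g x \<and> v = \<psi> b x)" by blast
    obtain P where P: "\<And>p. p \<in>\<^sub>0 P \<longleftrightarrow> (\<exists>b. b \<in>\<^sub>0 U \<and> (\<exists>v. v \<in>\<^sub>0 V \<and> p = opair b v))"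
      using product_exists by metis
    obtain Q where Q: "\<And>p. p \<in>\<^sub>0 Q \<longleftrightarrow> (\<exists>b. b \<in>\<^sub>0 U \<and> (\<exists>y. y \<in>\<^sub>0 S \<and> p = opair b y))"
      using product_exists by metis
    obtain Pow where Pow: "\<And>s. s \<in>\<^sub>0 Pow \<longleftrightarrow> s \<subseteq>\<^sub>0 P" using power_set by metis
    define R where "R x q \<longleftrightarrow> (\<exists>b. b \<in>\<^sub>0 U \<and> (\<exists>v. v \<in>\<^sub>0 V \<and> q = opair b v \<and>
        (\<exists>w. w \<in>\<^sub>0 Q \<and> w = opair b x \<and> opair w v \<in>\<^sub>0 H)))" for x q
    \<comment> \<open>Among the subsets of \<open>P\<close> a section is pinned down by its members
      in \<open>P\<close>, so equality with the section becomes a formula bounded by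
      \<open>P\<close>.\<close>
    let ?D = "\<lambda>x s. \<forall>q. q \<in>\<^sub>0 P \<longrightarrow> (q \<in>\<^sub>0 s \<longleftrightarrow> R x q)"
    have D: "definable Bounded (\<lambda>e E. ?D (e (Suc 0)) (e 0))"
      unfolding R_def by (intro separation_rules)
    have mem: "q \<in>\<^sub>0 section_of F (apply1 g x) (\<lambda>b. \<psi> b x) \<longleftrightarrow> q \<in>\<^sub>0 P \<and> R x q"
      if x: "x \<in>\<^sub>0 S" for q x
    proof -
      have "x \<in>\<^sub>1 c1 g" using S x unfolding sub01_def by blast
      from mem_section_of[OF sets[OF this]] show ?thesis
        unfolding P Q H R_def using UV[OF x] x by auto
    qed
    have in_Pow: "section_of F (apply1 g x) (\<lambda>b. \<psi> b x) \<in>\<^sub>0 Pow" if x: "x \<in>\<^sub>0 S" for x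
      unfolding Pow sub0_def using mem[OF x] by blast
    have iff: "?D x s \<longleftrightarrow> s = section_of F (apply1 g x) (\<lambda>b. \<psi> b x)"
      if x: "x \<in>\<^sub>0 S" and s: "s \<in>\<^sub>0 Pow" for x s
    proof
      assume "s = section_of F (apply1 g x) (\<lambda>b. \<psi> b x)"
      then show "?D x s" using mem[OF x] by simp
    next
      assume D: "?D x s"
      show "s = section_of F (apply1 g x) (\<lambda>b. \<psi> b x)"
      proof (rule set_ext, rule allI)
        fix q
        have "q \<in>\<^sub>0 s \<Longrightarrow> q \<in>\<^sub>0 P" using s unfolding Pow sub0_def by blast
        then show "q \<in>\<^sub>0 s \<longleftrightarrow> q \<in>\<^sub>0 section_of F (apply1 g x) (\<lambda>b. \<psi> b x)"
          unfolding mem[OF x] using D by blast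
      qed
    qed
    show "\<exists>V P. (\<forall>x. x \<in>\<^sub>0 S \<longrightarrow> section_of F (apply1 g x) (\<lambda>b. \<psi> b x) \<in>\<^sub>0 V) \<and>
      definable Bounded (\<lambda>e E. P (e (Suc 0)) (e 0)) \<and>
      (\<forall>x y. x \<in>\<^sub>0 S \<and> y \<in>\<^sub>0 V \<longrightarrow> P x y = (y = section_of F (apply1 g x) (\<lambda>b. \<psi> b x)))"
      by (rule exI[of _ Pow], rule exI[of _ ?D]) (intro conjI allI impI; (elim conjE)?; rule D in_Pow iff; assumption)
  qed
qed

text \<open>The value is described by a section \<open>s'\<close> and its values rather than by
  \<open>section_of\<close>. Equations between arrows can then be settled by
  \<open>is_section_ext\<close>.\<close>

lemma pi_map:
  assumes F: "arr F" "locally_small F" and t: "Hom (over (c1 F)) g g' t"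
  shows Hom_pi_map: "Hom (over (c3 F)) (pi_ob F g) (pi_ob F g') (pi_map F t)"
    and apply_pi_map: "opair a s \<in>\<^sub>1 sections F g \<Longrightarrow> \<exists>s'. is_section F g' a s' \<and>
      apply1 (c2 (pi_map F t)) (opair a s) = opair a s' \<and>
      (\<forall>b. b \<in>\<^sub>1 c1 F \<and> apply1 F b = a \<longrightarrow> apply0 s' b = apply1 (c2 t) (apply0 s b))"
proof -
  note T = Hom_overD[OF t]
  let ?\<psi> = "\<lambda>b p. apply1 (c2 t) (apply0 (snd0 p) b)"
  let ?\<phi> = "\<lambda>p. opair (fst0 p) (section_of F (fst0 p) (\<lambda>b. ?\<psi> b p))"
  have def: "definable_set (Full False) (\<lambda>e E. ?\<phi> (e 0))"
    unfolding section_of_def by (intro full_rules)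
  have fp: "\<exists>b a s. q = opair b (opair a s) \<and> b \<in>\<^sub>1 c1 F \<and> apply1 F b = a \<and> is_section F g a s"
    if "q \<in>\<^sub>1 fibre_product F (pi_ob F g)" for q
    using that F(1) arr_pi_ob
    by (rule fibre_productE) (auto simp: mem_sections apply_pi_ob)
  \<comment> \<open>Its elements are the pairs of a point \<open>b\<close> and a section over
    \<open>F b\<close>. This is the domain of the evaluation map, whose boundedness comes from
    \<open>bounded_on_apply0\<close>.\<close>
  let ?E = "fibre_product F (pi_ob F g)"
  have s: "bounded_on ?E (\<lambda>q. snd0 (snd0 q))"
    by (rule bounded_on_snd0[OF bounded_on_snd0[OF bounded_on_id]]) (use fp in fastforce)+
  have b: "bounded_on ?E fst0"
    by (rule bounded_on_fst0_id) (use fp in blast)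
  have "bounded_on ?E (\<lambda>q. apply0 (snd0 (snd0 q)) (fst0 q))"
  proof (rule bounded_on_apply0[OF s b])
    fix q assume "q \<in>\<^sub>1 ?E"
    then obtain b a s where q: "q = opair b (opair a s)" "b \<in>\<^sub>1 c1 F" "apply1 F b = a" "is_section F g a s"
      using fp by blast
    then show "\<exists>!c. opair (fst0 q) c \<in>\<^sub>0 snd0 (snd0 q)" using is_section_apply(4) by simp
  qed
  then have \<psi>: "bounded_on ?E (\<lambda>q. ?\<psi> (fst0 q) (snd0 q))"
  proof (rule bounded_on_apply1[OF T(7)])
    fix q assume "q \<in>\<^sub>1 ?E"
    then obtain b a s where q: "q = opair b (opair a s)" "b \<in>\<^sub>1 c1 F" "apply1 F b = a" "is_section F g a s"
      using fp by blast
    then show "apply0 (snd0 (snd0 q)) (fst0 q) \<in>\<^sub>1 c1 (c2 t)"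
      using is_section_apply(2) T(8) by simp
  qed
  note so = bounded_on_section_of[OF F arr_pi_ob pi_ob_simps(2) \<psi>, unfolded pi_ob_simps]
  \<comment> \<open>\<open>so\<close> is phrased with the projection of \<open>pi_ob F g\<close>,
    which agrees with \<open>fst0\<close> only on \<open>sections F g\<close>.\<close>
  have "bounded_on (sections F g) (\<lambda>p. section_of F (fst0 p) (\<lambda>b. ?\<psi> b p))"
    by (rule bounded_on_cong[OF so(1)]) (simp add: apply_pi_ob)
  moreover have "bounded_on (sections F g) fst0"
    by (rule bounded_on_fst0_id) (auto simp: mem_sections)
  ultimately have bd: "bounded_on (sections F g) ?\<phi>" by (intro bounded_on_opair)
  have sec: "is_section F g' a (section_of F a (\<lambda>b. ?\<psi> b (opair a s))) \<and>
      (\<forall>b. b \<in>\<^sub>1 c1 F \<and> apply1 F b = a \<longrightarrow>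
        apply0 (section_of F a (\<lambda>b. ?\<psi> b (opair a s))) b = apply1 (c2 t) (apply0 s b))"
    if as: "opair a s \<in>\<^sub>1 sections F g" for a s
  proof -
    have s: "is_section F g a s" using as unfolding mem_sections by simp
    note X = so(2)[OF as, unfolded apply_pi_ob[OF as] fst0_opair snd0_opair]
    show ?thesis
      unfolding snd0_opair
      by (intro conjI allI impI is_section_section_of[OF X]; (elim conjE)?;
          simp add: apply_section_of[OF X] T(10,11) is_section_apply(2,3)[OF s])
  qed
  have maps: "?\<phi> p \<in>\<^sub>1 sections F g'" if "p \<in>\<^sub>1 sections F g" for p
  proof -
    obtain a s where p: "p = opair a s" "a \<in>\<^sub>1 c3 F" using \<open>p \<in>\<^sub>1 sections F g\<close> unfolding mem_sections by blast
    show ?thesis unfolding mem_sections[of _ F g'] using sec[of a s] that p by simp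
  qed
  have comm: "apply1 (pi_ob F g') (?\<phi> p) = apply1 (pi_ob F g) p" if "p \<in>\<^sub>1 sections F g" for p
    using maps[OF that] that by (simp add: apply_pi_ob)
  note * = over_arrow[where g = "pi_ob F g" and g' = "pi_ob F g'" and A = "c3 F",
      OF arr_pi_ob _ arr_pi_ob _ def, unfolded pi_ob_simps, OF refl refl bd maps comm]
  show "Hom (over (c3 F)) (pi_ob F g) (pi_ob F g') (pi_map F t)"
    unfolding pi_map_def T(1,2) by (rule *(1))
  assume as: "opair a s \<in>\<^sub>1 sections F g"
  have "apply1 (c2 (pi_map F t)) (opair a s) = opair a (section_of F a (\<lambda>b. ?\<psi> b (opair a s)))"
    unfolding pi_map_def T(1,2) by (subst *(2)[OF _ _ as]) simp_all
  with sec[OF as] show "\<exists>s'. is_section F g' a s' \<and>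
      apply1 (c2 (pi_map F t)) (opair a s) = opair a s' \<and>
      (\<forall>b. b \<in>\<^sub>1 c1 F \<and> apply1 F b = a \<longrightarrow> apply0 s' b = apply1 (c2 t) (apply0 s b))"
    by blast
qed

lemma opair_mem_sections: "opair a s \<in>\<^sub>1 sections F g \<longleftrightarrow> a \<in>\<^sub>1 c3 F \<and> is_section F g a s"
  unfolding mem_sections by auto

lemma sectionsD:
  "p \<in>\<^sub>1 sections F g \<Longrightarrow> \<exists>a s. p = opair a s \<and> opair a s \<in>\<^sub>1 sections F g \<and>
     a \<in>\<^sub>1 c3 F \<and> is_section F g a s"
  unfolding mem_sections by blast

lemma pi_functor:
  assumes F: "arr F" "locally_small F"
  defines "P \<equiv> functor_of (c1 F) (pi_ob F) (pi_map F)"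
  shows "is_functor (over (c1 F)) (over (c3 F)) P"
    and "Ob (over (c1 F)) g \<Longrightarrow> on_ob P g = pi_ob F g"
    and "Hom (over (c1 F)) g g' t \<Longrightarrow> on_ar P t = pi_map F t"
proof -
  have ob: "Ob (over (c3 F)) (pi_ob F g)" for g by (simp add: arr_pi_ob)
  have ident: "pi_map F (Ident (over (c1 F)) g) = Ident (over (c3 F)) (pi_ob F g)"
    if g: "Ob (over (c1 F)) g" for g
  proof (rule Hom_over_ext)
    have i: "Hom (over (c1 F)) g g (Ident (over (c1 F)) g)" using g by (simp add: Hom_over_ident)
    show "Hom (over (c3 F)) (pi_ob F g) (pi_ob F g) (pi_map F (Ident (over (c1 F)) g))"
      by (rule Hom_pi_map[OF F i])
    show "Hom (over (c3 F)) (pi_ob F g) (pi_ob F g) (Ident (over (c3 F)) (pi_ob F g))"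
      by (simp add: Hom_over_ident arr_pi_ob)
    fix p assume "p \<in>\<^sub>1 c1 (pi_ob F g)"
    then obtain a s where p: "p = opair a s" "opair a s \<in>\<^sub>1 sections F g" "is_section F g a s"
      unfolding pi_ob_simps using sectionsD by blast
    obtain s' where s': "is_section F g a s'"
      "apply1 (c2 (pi_map F (Ident (over (c1 F)) g))) (opair a s) = opair a s'"
      "\<And>b. b \<in>\<^sub>1 c1 F \<Longrightarrow> apply1 F b = a \<Longrightarrow>
        apply0 s' b = apply1 (c2 (Ident (over (c1 F)) g)) (apply0 s b)"
      using apply_pi_map[OF F i p(2)] by blast
    have "s' = s"
      by (rule is_section_ext[OF s'(1) p(3)])
        (simp add: s'(3) apply_ident is_section_apply(2)[OF p(3)])
    then show "apply1 (c2 (pi_map F (Ident (over (c1 F)) g))) p =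
      apply1 (c2 (Ident (over (c3 F)) (pi_ob F g))) p"
      unfolding p(1) using s'(2) p(2) by (simp add: apply_ident)
  qed
  have comp: "pi_map F (Comp (over (c1 F)) u t) = Comp (over (c3 F)) (pi_map F u) (pi_map F t)"
    if t: "Hom (over (c1 F)) g g' t" and u: "Hom (over (c1 F)) g' g'' u" for g g' g'' t u
  proof (rule Hom_over_ext)
    note tu = Hom_over_comp[OF t u]
    note t' = Hom_pi_map[OF F t] and u' = Hom_pi_map[OF F u]
    show "Hom (over (c3 F)) (pi_ob F g) (pi_ob F g'') (pi_map F (Comp (over (c1 F)) u t))"
      by (rule Hom_pi_map[OF F tu])
    show "Hom (over (c3 F)) (pi_ob F g) (pi_ob F g'') (Comp (over (c3 F)) (pi_map F u) (pi_map F t))"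
      by (rule Hom_over_comp[OF t' u'])
    fix p assume "p \<in>\<^sub>1 c1 (pi_ob F g)"
    then obtain a s where p: "p = opair a s" "opair a s \<in>\<^sub>1 sections F g" "a \<in>\<^sub>1 c3 F" "is_section F g a s"
      unfolding pi_ob_simps using sectionsD by blast
    obtain r where r: "is_section F g'' a r"
      "apply1 (c2 (pi_map F (Comp (over (c1 F)) u t))) (opair a s) = opair a r"
      "\<And>b. b \<in>\<^sub>1 c1 F \<Longrightarrow> apply1 F b = a \<Longrightarrow>
        apply0 r b = apply1 (c2 (Comp (over (c1 F)) u t)) (apply0 s b)"
      using apply_pi_map[OF F tu p(2)] by blast
    obtain s' where s': "is_section F g' a s'"
      "apply1 (c2 (pi_map F t)) (opair a s) = opair a s'"
      "\<And>b. b \<in>\<^sub>1 c1 F \<Longrightarrow> apply1 F b = a \<Longrightarrow> apply0 s' b = apply1 (c2 t) (apply0 s b)"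
      using apply_pi_map[OF F t p(2)] by blast
    have "opair a s' \<in>\<^sub>1 sections F g'" using p(3) s'(1) by (simp add: opair_mem_sections)
    then obtain s'' where s'': "is_section F g'' a s''"
      "apply1 (c2 (pi_map F u)) (opair a s') = opair a s''"
      "\<And>b. b \<in>\<^sub>1 c1 F \<Longrightarrow> apply1 F b = a \<Longrightarrow> apply0 s'' b = apply1 (c2 u) (apply0 s' b)"
      using apply_pi_map[OF F u] by blast
    \<comment> \<open>Both are sections over \<open>a\<close> with the value of \<open>u\<close>
      after \<open>t\<close> at each point of \<open>s\<close>.\<close>
    have "r = s''"
      by (rule is_section_ext[OF r(1) s''(1)])
        (simp add: r(3) s''(3) s'(3) apply_comp[OF t u] is_section_apply(2)[OF p(4)])
    then show "apply1 (c2 (pi_map F (Comp (over (c1 F)) u t))) p =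
        apply1 (c2 (Comp (over (c3 F)) (pi_map F u) (pi_map F t))) p"
      unfolding p(1) using r(2) s'(2) s''(2) p(2) by (simp add: apply_comp[OF t' u'])
  qed
  note * = functor_of[OF definable_pi_ob definable_pi_map ob Hom_pi_map[OF F] ident comp]
  show "is_functor (over (c1 F)) (over (c3 F)) P"
    unfolding P_def by (rule *(1))
  show "Ob (over (c1 F)) g \<Longrightarrow> on_ob P g = pi_ob F g"
    unfolding P_def by (rule *(2))
  show "Hom (over (c1 F)) g g' t \<Longrightarrow> on_ar P t = pi_map F t"
    unfolding P_def by (rule *(3))
qed

lemma pi_transpose:
  assumes F: "arr F" "locally_small F" and x: "Ob (over (c3 F)) x" and y: "Ob (over (c1 F)) y"
    and f: "Hom (over (c1 F)) (pullback_ob F x) y f"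
  shows Hom_pi_transpose: "Hom (over (c3 F)) x (pi_ob F y) (pi_transpose F x y f)"
    and apply_pi_transpose: "k \<in>\<^sub>1 c1 x \<Longrightarrow> \<exists>s. is_section F y (apply1 x k) s \<and>
      apply1 (c2 (pi_transpose F x y f)) k = opair (apply1 x k) s \<and>
      (\<forall>b. b \<in>\<^sub>1 c1 F \<and> apply1 F b = apply1 x k \<longrightarrow> apply0 s b = apply1 (c2 f) (opair b k))"
proof -
  note T = Hom_overD[OF f, unfolded pullback_ob_simps]
  have x': "arr x" "c3 x = c3 F" using x by simp_all
  let ?\<psi> = "\<lambda>b k. apply1 (c2 f) (opair b k)"
  let ?\<phi> = "\<lambda>k. opair (apply1 x k) (section_of F (apply1 x k) (\<lambda>b. ?\<psi> b k))"
  have def: "definable_set (Full False) (\<lambda>e E. ?\<phi> (e 0))"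
    unfolding section_of_def by (intro full_rules)
  have "bounded_on (fibre_product F x) (apply1 (c2 f))"
    using arr_bounded_on[OF T(7)] T(8) by simp
  \<comment> \<open>Elements of the fibre product are pairs, so reassembling their components
    changes nothing.\<close>
  then have \<psi>: "bounded_on (fibre_product F x) (\<lambda>q. ?\<psi> (fst0 q) (snd0 q))"
    by (rule bounded_on_cong) (use fibre_product_pairs in fastforce)
  note so = bounded_on_section_of[OF F x' \<psi>]
  have bd: "bounded_on (c1 x) ?\<phi>"
    by (intro bounded_on_opair so(1) arr_bounded_on x')
  have sec: "is_section F y (apply1 x k) (section_of F (apply1 x k) (\<lambda>b. ?\<psi> b k)) \<and>
      (\<forall>b. b \<in>\<^sub>1 c1 F \<and> apply1 F b = apply1 x k \<longrightarrow>
        apply0 (section_of F (apply1 x k) (\<lambda>b. ?\<psi> b k)) b = ?\<psi> b k)"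
    if k: "k \<in>\<^sub>1 c1 x" for k
  proof -
    note X = so(2)[OF k]
    \<comment> \<open>\<open>f\<close> commutes with the projections to the domain of
      \<open>F\<close>, so its value at \<open>(b, k)\<close> lies over \<open>b\<close>. This is
      what makes the curried function a section.\<close>
    have "apply1 y (?\<psi> b k) = b \<and> ?\<psi> b k \<in>\<^sub>1 c1 y" if "b \<in>\<^sub>1 c1 F" "apply1 F b = apply1 x k" for b
    proof -
      have m: "opair b k \<in>\<^sub>1 fibre_product F x"
        using that k by (simp add: opair_mem_fibre_product[OF F(1) x'(1)])
      then show ?thesis using T(10,11)[OF m] by (simp add: apply_pullback_ob)
    qed
    then show ?thesis
      by (intro conjI is_section_section_of[OF X]) (auto simp: apply_section_of[OF X])
  qed
  have maps: "?\<phi> k \<in>\<^sub>1 sections F y" if k: "k \<in>\<^sub>1 c1 x" for k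
    using sec[OF k] arr_apply1[OF x'(1) k] x'(2) by (simp add: opair_mem_sections)
  have comm: "apply1 (pi_ob F y) (?\<phi> k) = apply1 x k" if k: "k \<in>\<^sub>1 c1 x" for k
    using maps[OF k] by (simp add: apply_pi_ob)
  note * = over_arrow[where g = x and g' = "pi_ob F y" and A = "c3 F",
      OF x' arr_pi_ob _ def bd, unfolded pi_ob_simps, OF refl maps comm]
  show "Hom (over (c3 F)) x (pi_ob F y) (pi_transpose F x y f)"
    unfolding pi_transpose_def by (rule *(1))
  assume k: "k \<in>\<^sub>1 c1 x"
  have "apply1 (c2 (pi_transpose F x y f)) k = ?\<phi> k"
    unfolding pi_transpose_def by (rule *(2)[OF _ _ k])
  with sec[OF k] show "\<exists>s. is_section F y (apply1 x k) s \<and>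
      apply1 (c2 (pi_transpose F x y f)) k = opair (apply1 x k) s \<and>
      (\<forall>b. b \<in>\<^sub>1 c1 F \<and> apply1 F b = apply1 x k \<longrightarrow> apply0 s b = apply1 (c2 f) (opair b k))"
    by blast
qed

text \<open>A map over the codomain of \<open>F\<close> cannot choose the point of its value, only
  the section; this is why transposition can be undone from \<open>snd0\<close> alone.\<close>

lemma Hom_pi_apply:
  assumes g: "Hom (over (c3 F)) x (pi_ob F y) g" and k: "k \<in>\<^sub>1 c1 x"
  shows "\<exists>s. apply1 (c2 g) k = opair (apply1 x k) s \<and> is_section F y (apply1 x k) s"
proof -
  have m: "apply1 (c2 g) k \<in>\<^sub>1 sections F y" using Hom_overD(10)[OF g k] by simp
  then obtain a s where as: "apply1 (c2 g) k = opair a s" "is_section F y a s" using sectionsD by blast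
  have "apply1 x k = a" using Hom_overD(11)[OF g k] apply_pi_ob[OF m] as(1) by simp
  with as show ?thesis by blast
qed

lemma pi_untranspose:
  assumes F: "arr F" and x: "Ob (over (c3 F)) x" and y: "Ob (over (c1 F)) y"
    and g: "Hom (over (c3 F)) x (pi_ob F y) g"
  shows Hom_pi_untranspose: "Hom (over (c1 F)) (pullback_ob F x) y (pi_untranspose F x y g)"
    and apply_pi_untranspose: "opair b k \<in>\<^sub>1 fibre_product F x \<Longrightarrow>
      apply1 (c2 (pi_untranspose F x y g)) (opair b k) = apply0 (snd0 (apply1 (c2 g) k)) b"
proof -
  note T = Hom_overD[OF g]
  have x': "arr x" "c3 x = c3 F" and y': "arr y" "c3 y = c1 F" using x y by simp_all
  let ?\<phi> = "\<lambda>p. apply0 (snd0 (apply1 (c2 g) (snd0 p))) (fst0 p)"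
  let ?E = "fibre_product F x"
  have def: "definable_set (Full False) (\<lambda>e E. ?\<phi> (e 0))" by (intro full_rules)
  have fp: "\<exists>b k s. q = opair b k \<and> b \<in>\<^sub>1 c1 F \<and> k \<in>\<^sub>1 c1 x \<and> apply1 F b = apply1 x k \<and>
      apply1 (c2 g) k = opair (apply1 x k) s \<and> is_section F y (apply1 x k) s"
    if q: "q \<in>\<^sub>1 ?E" for q
    using q F x'(1) by (rule fibre_productE) (use Hom_pi_apply[OF g] in blast)
  \<comment> \<open>Uncurrying evaluates the section chosen by \<open>g\<close> at \<open>k\<close>
    on the point \<open>b\<close>; section and point are shown bounded separately and combined by
    \<open>bounded_on_apply0\<close>.\<close>
  have k: "bounded_on ?E (\<lambda>q. apply1 (c2 g) (snd0 q))"
    by (rule bounded_on_apply1[OF T(7) bounded_on_snd0_id]) (use fp T(8) in fastforce)+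
  have s: "bounded_on ?E (\<lambda>q. snd0 (apply1 (c2 g) (snd0 q)))"
    by (rule bounded_on_snd0[OF k]) (use fp in fastforce)
  have b: "bounded_on ?E fst0"
    by (rule bounded_on_fst0_id) (use fp in blast)
  have bd: "bounded_on ?E ?\<phi>"
  proof (rule bounded_on_apply0[OF s b])
    fix q assume "q \<in>\<^sub>1 ?E"
    then obtain b k s where q: "q = opair b k" "b \<in>\<^sub>1 c1 F" "apply1 F b = apply1 x k"
      "apply1 (c2 g) k = opair (apply1 x k) s" "is_section F y (apply1 x k) s"
      using fp by blast
    then show "\<exists>!c. opair (fst0 q) c \<in>\<^sub>0 snd0 (apply1 (c2 g) (snd0 q))"
      using is_section_apply(4)[OF q(5) q(2,3)] by simp
  qed
  have *: "?\<phi> q \<in>\<^sub>1 c1 y \<and> apply1 y (?\<phi> q) = apply1 (pullback_ob F x) q" if qE: "q \<in>\<^sub>1 ?E" for q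
  proof -
    obtain b k s where q: "q = opair b k" "b \<in>\<^sub>1 c1 F" "apply1 F b = apply1 x k"
      "apply1 (c2 g) k = opair (apply1 x k) s" "is_section F y (apply1 x k) s"
      using fp[OF qE] by blast
    then show ?thesis
      using is_section_apply(2,3)[OF q(5) q(2,3)] apply_pullback_ob[OF qE] by simp
  qed
  note ** = over_arrow[where g = "pullback_ob F x" and g' = y and A = "c1 F",
      OF arr_pullback_ob _ y' def, unfolded pullback_ob_simps, OF refl bd]
  show "Hom (over (c1 F)) (pullback_ob F x) y (pi_untranspose F x y g)"
    unfolding pi_untranspose_def by (rule **(1)) (use * in blast)+
  assume bk: "opair b k \<in>\<^sub>1 fibre_product F x"
  have "apply1 (c2 (pi_untranspose F x y g)) (opair b k) = ?\<phi> (opair b k)"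
    unfolding pi_untranspose_def by (rule **(2)) (use * bk in blast)+
  then show "apply1 (c2 (pi_untranspose F x y g)) (opair b k) = apply0 (snd0 (apply1 (c2 g) k)) b"
    by simp
qed

lemma left_adjoint_pi:
  assumes F: "arr F" "locally_small F"
  shows "left_adjoint (over (c3 F)) (over (c1 F)) (pullback_functor F)
    (functor_of (c1 F) (pi_ob F) (pi_map F))"
proof (rule left_adjointI[OF pullback_functor[OF F(1)] pi_functor[OF F],
      where tr = "pi_transpose F" and rt = "pi_untranspose F"])
  show "definable_class (Full True) (\<lambda>e E. pullback_ob F (E 0))"
    by (rule definable_pullback_ob)
  show "definable_class (Full True)
      (\<lambda>e E. pi_transpose F (E (Suc (Suc 0))) (E (Suc 0)) (E 0))"
    by (rule definable_pi_transpose)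
next
  fix x y f assume *: "Ob (over (c3 F)) x" "Ob (over (c1 F)) y" "Hom (over (c1 F)) (pullback_ob F x) y f"
  have x: "arr x" using *(1) by simp
  note t = Hom_pi_transpose[OF F *]
  show "Hom (over (c3 F)) x (pi_ob F y) (pi_transpose F x y f)" by (rule t)
  show "pi_untranspose F x y (pi_transpose F x y f) = f"
  proof (rule Hom_over_ext[OF Hom_pi_untranspose[OF F(1) *(1,2) t] *(3)])
    fix q assume "q \<in>\<^sub>1 c1 (pullback_ob F x)"
    then have "q \<in>\<^sub>1 fibre_product F x" by simp
    then obtain b k where q: "q = opair b k" "b \<in>\<^sub>1 c1 F" "k \<in>\<^sub>1 c1 x" "apply1 F b = apply1 x k"
      using F(1) x by (rule fibre_productE)
    then have m: "opair b k \<in>\<^sub>1 fibre_product F x" by (simp add: opair_mem_fibre_product[OF F(1) x])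
    obtain s where "apply1 (c2 (pi_transpose F x y f)) k = opair (apply1 x k) s"
      "apply0 s b = apply1 (c2 f) (opair b k)"
      using apply_pi_transpose[OF F * q(3)] q(2,4) by blast
    then show "apply1 (c2 (pi_untranspose F x y (pi_transpose F x y f))) q = apply1 (c2 f) q"
      unfolding q(1) by (simp add: apply_pi_untranspose[OF F(1) *(1,2) t m])
  qed
next
  fix x y g assume *: "Ob (over (c3 F)) x" "Ob (over (c1 F)) y" "Hom (over (c3 F)) x (pi_ob F y) g"
  have x: "arr x" using *(1) by simp
  note t = Hom_pi_untranspose[OF F(1) *]
  show "Hom (over (c1 F)) (pullback_ob F x) y (pi_untranspose F x y g)" by (rule t)
  show "pi_transpose F x y (pi_untranspose F x y g) = g"
  proof (rule Hom_over_ext[OF Hom_pi_transpose[OF F *(1,2) t] *(3)])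
    fix k assume k: "k \<in>\<^sub>1 c1 x"
    obtain s where s: "apply1 (c2 g) k = opair (apply1 x k) s" "is_section F y (apply1 x k) s"
      using Hom_pi_apply[OF *(3) k] by blast
    obtain s' where s': "is_section F y (apply1 x k) s'"
      "apply1 (c2 (pi_transpose F x y (pi_untranspose F x y g))) k = opair (apply1 x k) s'"
      "\<And>b. b \<in>\<^sub>1 c1 F \<Longrightarrow> apply1 F b = apply1 x k \<Longrightarrow>
        apply0 s' b = apply1 (c2 (pi_untranspose F x y g)) (opair b k)"
      using apply_pi_transpose[OF F *(1,2) t k] by blast
    \<comment> \<open>Currying the uncurried map gives at \<open>b\<close> the value of
      \<open>s\<close> at \<open>b\<close>, so the two sections agree over the fibre.\<close>
    have "s' = s"
      by (rule is_section_ext[OF s'(1) s(2)])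
        (simp add: s'(3) apply_pi_untranspose[OF F(1) *] opair_mem_fibre_product[OF F(1) x] k s(1))
    then show "apply1 (c2 (pi_transpose F x y (pi_untranspose F x y g))) k = apply1 (c2 g) k"
      using s(1) s'(2) by simp
  qed
next
  fix x x' y y' a b f
  assume a: "Hom (over (c3 F)) x' x a" and b: "Hom (over (c1 F)) y y' b"
    and f: "Hom (over (c1 F)) (pullback_ob F x) y f"
  have obs: "Ob (over (c3 F)) x" "Ob (over (c3 F)) x'" "Ob (over (c1 F)) y" "Ob (over (c1 F)) y'"
    using Hom_overD(1-9)[OF a] Hom_overD(1-9)[OF b] by simp_all
  have x: "arr x" "c3 x = c3 F" and x': "arr x'" using obs by simp_all
  note A = Hom_pullback_map[OF F(1) a] and B = Hom_pi_map[OF F b]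
  note fA = Hom_over_comp[OF A f] note bfA = Hom_over_comp[OF fA b]
  note t = Hom_pi_transpose[OF F obs(1,3) f]
  note ta = Hom_over_comp[OF a t] note Bta = Hom_over_comp[OF ta B]
  show "pi_transpose F x' y' (Comp (over (c1 F)) b (Comp (over (c1 F)) f (pullback_map F a))) =
    Comp (over (c3 F)) (pi_map F b) (Comp (over (c3 F)) (pi_transpose F x y f) a)"
  proof (rule Hom_over_ext[OF Hom_pi_transpose[OF F obs(2,4) bfA] Bta])
    fix k assume k: "k \<in>\<^sub>1 c1 x'"
    note ak = Hom_overD(10,11)[OF a k]
    obtain r where r: "is_section F y' (apply1 x' k) r"
      "apply1 (c2 (pi_transpose F x' y'
        (Comp (over (c1 F)) b (Comp (over (c1 F)) f (pullback_map F a))))) k = opair (apply1 x' k) r"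
      "\<And>d. d \<in>\<^sub>1 c1 F \<Longrightarrow> apply1 F d = apply1 x' k \<Longrightarrow> apply0 r d =
        apply1 (c2 (Comp (over (c1 F)) b (Comp (over (c1 F)) f (pullback_map F a)))) (opair d k)"
      using apply_pi_transpose[OF F obs(2,4) bfA k] by blast
    \<comment> \<open>Since \<open>a\<close> is a map over the codomain of \<open>F\<close>,
      \<open>x\<close> at \<open>a k\<close> equals \<open>x'\<close> at \<open>k\<close>. All
      sections here thus live over the same fibre.\<close>
    obtain s where s: "is_section F y (apply1 x' k) s"
      "apply1 (c2 (pi_transpose F x y f)) (apply1 (c2 a) k) = opair (apply1 x' k) s"
      "\<And>d. d \<in>\<^sub>1 c1 F \<Longrightarrow> apply1 F d = apply1 x' k \<Longrightarrow>
        apply0 s d = apply1 (c2 f) (opair d (apply1 (c2 a) k))"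
      using apply_pi_transpose[OF F obs(1,3) f ak(1)] unfolding ak(2) by blast
    have "apply1 x' k \<in>\<^sub>1 c3 F" using arr_apply1[OF x(1) ak(1)] x(2) ak(2) by simp
    then have sm: "opair (apply1 x' k) s \<in>\<^sub>1 sections F y"
      using s(1) by (simp add: opair_mem_sections)
    obtain s' where s': "is_section F y' (apply1 x' k) s'"
      "apply1 (c2 (pi_map F b)) (opair (apply1 x' k) s) = opair (apply1 x' k) s'"
      "\<And>d. d \<in>\<^sub>1 c1 F \<Longrightarrow> apply1 F d = apply1 x' k \<Longrightarrow>
        apply0 s' d = apply1 (c2 b) (apply0 s d)"
      using apply_pi_map[OF F b sm] by blast
    \<comment> \<open>At a point \<open>d\<close> of the fibre both sides yield \<open>b\<close>
      applied to the value of \<open>f\<close> at \<open>(d, a k)\<close>.\<close>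
    have "r = s'"
    proof (rule is_section_ext[OF r(1) s'(1)])
      fix d assume d: "d \<in>\<^sub>1 c1 F" "apply1 F d = apply1 x' k"
      have m: "opair d k \<in>\<^sub>1 fibre_product F x'"
        using d k by (simp add: opair_mem_fibre_product[OF F(1) x'])
      then show "apply0 r d = apply0 s' d"
        by (simp add: r(3)[OF d] s'(3)[OF d] s(3)[OF d] apply_comp[OF fA b] apply_comp[OF A f]
            apply_pullback_map[OF F(1) a])
    qed
    then show "apply1 (c2 (pi_transpose F x' y'
        (Comp (over (c1 F)) b (Comp (over (c1 F)) f (pullback_map F a))))) k =
      apply1 (c2 (Comp (over (c3 F)) (pi_map F b) (Comp (over (c3 F)) (pi_transpose F x y f) a))) k"
      using r(2) s(2) s'(2) k by (simp add: apply_comp[OF ta B] apply_comp[OF a t])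
  qed
qed

end

theorem theorem2p8:
  fixes mem0 :: "'s \<Rightarrow> 's \<Rightarrow> bool"
    and mem1 :: "'s \<Rightarrow> 'c \<Rightarrow> bool"
    and mem2 :: "'c \<Rightarrow> 'k \<Rightarrow> bool"
    and F A B :: 'c
  assumes "MTT mem0 mem1 mem2"
    and "Hom (MTT_language.BClass mem0 mem1) B A F"
  shows
    "(\<exists>\<Sigma>F. MTT_language.left_adjoint mem0 mem1 mem2
         (MTT_language.slice mem0 mem1 (MTT_language.BClass mem0 mem1) B)
         (MTT_language.slice mem0 mem1 (MTT_language.BClass mem0 mem1) A)
         \<Sigma>F (MTT_language.pullback_functor mem0 mem1 mem2 F))
     \<and> (MTT_language.locally_small mem0 mem1 F \<longrightarrow>
       (\<exists>\<Pi>F. MTT_language.left_adjoint mem0 mem1 mem2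
         (MTT_language.slice mem0 mem1 (MTT_language.BClass mem0 mem1) A)
         (MTT_language.slice mem0 mem1 (MTT_language.BClass mem0 mem1) B)
         (MTT_language.pullback_functor mem0 mem1 mem2 F) \<Pi>F))"
proof -
  interpret MTT mem0 mem1 mem2 by fact
  have F: "arr F" "c1 F = B" "c3 F = A"
    using assms(2) unfolding Hom_def by simp_all
  show ?thesis
    using left_adjoint_sigma[OF F(1)] left_adjoint_pi[OF F(1)] unfolding F(2,3) by blast
qed

end
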